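(* The recurrent matrix problem in $\mathrm{SL}(2,\mathbb{Z})$ is decidable and NP-hard: given a finite set $G$ of matrices in $\mathrm{SL}(2,\mathbb{Z})$, generating the multiplicative semigroup $S$, and a matrix $M\in S$, decide whether $M$ has infinitely many different factorizations over $G$.
   Context: $\mathrm{SL}(2,\mathbb{Z})$ is the group of $2\times2$ integer matrices with determinant $1$. For a finite set $G$ of matrices, $S=\langle G\rangle$ denotes the semigroup of all finite nonempty products of elements of $G$. A factorization of $M\in S$ over $G$ is a finite nonempty sequence $(A_1,\dots,A_t)$ of elements of $G$ with $A_1A_2\cdots A_t=M$; two factorizations are different if they are different sequences. *)

theory Defs
  imports "HOL-Analysis.Determinants" "HOL-Computational_Algebra.Polynomial"
begin

section \<open>Turing machines\<close>

text \<open>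
  Deterministic multi-tape machines with two-way infinite tapes. States and tape symbols are
  the natural numbers below \<open>num_states\<close> and \<open>num_symbols\<close>. State 0 is initial, state 1 is
  halting. Symbol 0 is the blank; symbols 1 and 2 stand for the bits \<open>False\<close> and \<open>True\<close>.
  In each step the machine replaces the scanned symbol of every tape and moves each head by
  -1, 0 or 1. Only the values of \<open>delta\<close> on actual states and tape symbols matter, so the
  control is finite.
\<close>

record tm =
  num_tapes :: nat
  num_symbols :: nat
  num_states :: nat
  delta :: "nat \<Rightarrow> nat list \<Rightarrow> nat \<times> (nat \<times> int) list"

definition wf_tm :: "tm \<Rightarrow> bool" where
  "wf_tm M \<longleftrightarrow>
     1 \<le> num_tapes M \<and> 3 \<le> num_symbols M \<and> 2 \<le> num_states M \<and>
     (\<forall>q ss. q < num_states M \<and> length ss = num_tapes M \<and> set ss \<subseteq> {..<num_symbols M} \<longrightarrow>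
        fst (delta M q ss) < num_states M \<and>
        length (snd (delta M q ss)) = num_tapes M \<and>
        set (snd (delta M q ss)) \<subseteq> {..<num_symbols M} \<times> {-1, 0, 1})"

text \<open>Cell 0 of a tape is always the scanned one: moving the head shifts the contents.\<close>

type_synonym tape = "int \<Rightarrow> nat"

definition act :: "tape \<Rightarrow> nat \<times> int \<Rightarrow> tape" where
  "act t a = (\<lambda>i. (t(0 := fst a)) (i + snd a))"

definition step :: "tm \<Rightarrow> nat \<times> tape list \<Rightarrow> nat \<times> tape list" where
  "step M c = (case c of (q, ts) \<Rightarrow>
     if q = 1 then c
     else (case delta M q (map (\<lambda>t. t 0) ts) of (q', as) \<Rightarrow> (q', map2 act ts as)))"

definition tape_of :: "bool list \<Rightarrow> tape" where
  "tape_of x = (\<lambda>i. if 0 \<le> i \<and> nat i < length x then (if x ! nat i then 2 else 1) else 0)"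

definition init :: "tm \<Rightarrow> bool list list \<Rightarrow> nat \<times> tape list" where
  "init M xs = (0, map tape_of xs @ replicate (num_tapes M - length xs) (\<lambda>_. 0))"

text \<open>
  On inputs \<open>xs\<close>, written on the first tapes, \<open>M\<close> halts after at most \<open>n\<close> steps with output
  \<open>y\<close> on its first tape. (A halted configuration is left unchanged by \<open>step\<close>.)
\<close>

definition halts_with :: "tm \<Rightarrow> bool list list \<Rightarrow> bool list \<Rightarrow> nat \<Rightarrow> bool" where
  "halts_with M xs y n \<longleftrightarrow>
     length xs \<le> num_tapes M \<and>
     (\<exists>ts. (step M ^^ n) (init M xs) = (1, ts) \<and> hd ts = tape_of y)"


section \<open>Decidability and NP-hardness\<close>

text \<open>
  A decision problem whose inputs are subject to a promise is a pair (yes-instances,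
  no-instances) of sets of strings; nothing is required of an algorithm on other strings.
\<close>

type_synonym problem = "bool list set \<times> bool list set"

definition decidable :: "problem \<Rightarrow> bool" where
  "decidable P \<longleftrightarrow>
     (\<exists>M. wf_tm M \<and>
        (\<forall>x \<in> fst P. \<exists>n. halts_with M [x] [True] n) \<and>
        (\<forall>x \<in> snd P. \<exists>n. halts_with M [x] [False] n))"

definition polytime :: "(bool list \<Rightarrow> bool list) \<Rightarrow> bool" where
  "polytime f \<longleftrightarrow>
     (\<exists>M (p :: nat poly). wf_tm M \<and> (\<forall>x. halts_with M [x] (f x) (poly p (length x))))"

definition polytime_rel :: "(bool list \<Rightarrow> bool list \<Rightarrow> bool) \<Rightarrow> bool" where
  "polytime_rel R \<longleftrightarrow>
     (\<exists>M (p :: nat poly). wf_tm M \<and>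
        (\<forall>x w. halts_with M [x, w] [R x w] (poly p (length x + length w))))"

definition NP :: "bool list set set" where
  "NP = {L. \<exists>R (p :: nat poly). polytime_rel R \<and>
           (\<forall>x. x \<in> L \<longleftrightarrow> (\<exists>w. length w \<le> poly p (length x) \<and> R x w))}"

text \<open>Hardness under polynomial-time many-one reductions, which must respect the promise.\<close>

definition NP_hard :: "problem \<Rightarrow> bool" where
  "NP_hard P \<longleftrightarrow>
     (\<forall>L \<in> NP. \<exists>f. polytime f \<and>
        (\<forall>x. (x \<in> L \<longrightarrow> f x \<in> fst P) \<and> (x \<notin> L \<longrightarrow> f x \<in> snd P)))"


section \<open>Factorizations of matrices\<close>

type_synonym mat2 = "int ^ 2 ^ 2"

definition SL2Z :: "mat2 set" where
  "SL2Z = {A. det A = 1}"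

definition matprod :: "mat2 list \<Rightarrow> mat2" where
  "matprod As = foldr (**) As (mat 1)"

definition factorizations :: "mat2 set \<Rightarrow> mat2 \<Rightarrow> mat2 list set" where
  "factorizations G M = {As. As \<noteq> [] \<and> set As \<subseteq> G \<and> matprod As = M}"

definition semigroup_gen :: "mat2 set \<Rightarrow> mat2 set" where
  "semigroup_gen G = {matprod As | As. As \<noteq> [] \<and> set As \<subseteq> G}"


section \<open>The recurrent matrix problem\<close>

text \<open>
  Integers are written in binary (sign bit first, then the digits of the absolute value, least
  significant first), each bit preceded by \<open>True\<close> and the whole number closed by \<open>False\<close>, so
  that concatenations can be parsed. Entries of matrices are listed by rows.
\<close>

fun digits :: "nat \<Rightarrow> bool list" where
  "digits n = (if n = 0 then [] else odd n # digits (n div 2))"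

declare digits.simps [simp del]

definition enc_int :: "int \<Rightarrow> bool list" where
  "enc_int z = concat (map (\<lambda>b. [True, b]) ((z < 0) # digits (nat \<bar>z\<bar>))) @ [False]"

definition enc_mat :: "mat2 \<Rightarrow> bool list" where
  "enc_mat A = enc_int (A $ 1 $ 1) @ enc_int (A $ 1 $ 2) @ enc_int (A $ 2 $ 1) @ enc_int (A $ 2 $ 2)"

definition encodes :: "bool list \<Rightarrow> mat2 set \<Rightarrow> mat2 \<Rightarrow> bool" where
  "encodes x G M \<longleftrightarrow>
     (\<exists>Gs. distinct Gs \<and> set Gs = G \<and> x = enc_mat M @ concat (map enc_mat Gs))"

definition recurrent_matrix_problem :: problem where
  "recurrent_matrix_problem =
     ({x. \<exists>G M. encodes x G M \<and> finite G \<and> G \<subseteq> SL2Z \<and> M \<in> semigroup_gen G \<and>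
            infinite (factorizations G M)},
      {x. \<exists>G M. encodes x G M \<and> finite G \<and> G \<subseteq> SL2Z \<and> M \<in> semigroup_gen G \<and>
            finite (factorizations G M)})"

text \<open>Encodings are unambiguous; in particular no string is both a yes- and a no-instance.\<close>

lemma digits_0 [simp]: "digits 0 = []"
  by (subst digits.simps) simp

lemma digits_inj: "digits m = digits n \<Longrightarrow> m = n"
proof (induction m arbitrary: n rule: less_induct)
  case (less m)
  show ?case
  proof (cases "m = 0")
    case True
    with less.prems show ?thesis
      by (cases "n = 0") (auto simp: digits.simps[of n])
  next
    case False
    then have eq: "odd m # digits (m div 2) = digits n"
      using less.prems by (simp add: digits.simps[of m])
    have "n \<noteq> 0"
    proof
      assume "n = 0"
      with eq show False by simp
    qed
    then have "odd m = odd n" "digits (m div 2) = digits (n div 2)"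
      using eq by (simp_all add: digits.simps[of n])
    moreover have "m div 2 < m"
      using False by simp
    ultimately have "m div 2 = n div 2" "odd m = odd n"
      using less.IH by blast+
    then show ?thesis
      by (metis even_two_times_div_two odd_two_times_div_two_succ)
  qed
qed

lemma marked_bits_inj:
  "concat (map (\<lambda>b. [True, b]) bs) @ False # u = concat (map (\<lambda>b. [True, b]) cs) @ False # v \<Longrightarrow>
   bs = cs \<and> u = v"
proof (induction bs arbitrary: cs)
  case Nil
  then show ?case by (cases cs) auto
next
  case (Cons b bs)
  then show ?case by (cases cs) auto
qed

lemma enc_int_inj: "enc_int a @ u = enc_int b @ v \<Longrightarrow> a = b \<and> u = v"
proof -
  assume "enc_int a @ u = enc_int b @ v"
  then have "((a < 0) # digits (nat \<bar>a\<bar>)) = ((b < 0) # digits (nat \<bar>b\<bar>)) \<and> u = v"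
    unfolding enc_int_def by (intro marked_bits_inj) simp
  then show ?thesis
    by (auto dest!: digits_inj split: if_splits)
qed

lemma enc_mat_inj: "enc_mat A @ u = enc_mat B @ v \<Longrightarrow> A = B \<and> u = v"
  unfolding enc_mat_def append_assoc
  by (auto dest!: enc_int_inj simp: vec_eq_iff forall_2)

lemma enc_mat_nonempty: "enc_mat A \<noteq> []"
  by (simp add: enc_mat_def enc_int_def)

lemma enc_mats_inj: "concat (map enc_mat As) = concat (map enc_mat Bs) \<Longrightarrow> As = Bs"
proof (induction As arbitrary: Bs)
  case Nil
  then show ?case by (cases Bs) (auto simp: enc_mat_nonempty)
next
  case (Cons A As)
  then show ?case by (cases Bs) (auto simp: enc_mat_nonempty dest!: enc_mat_inj)
qed

lemma encodes_unique: "encodes x G M \<Longrightarrow> encodes x G' M' \<Longrightarrow> G = G' \<and> M = M'"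
  unfolding encodes_def by (metis enc_mat_inj enc_mats_inj)

lemma recurrent_matrix_problem_disjoint:
  "fst recurrent_matrix_problem \<inter> snd recurrent_matrix_problem = {}"
  by (auto simp: recurrent_matrix_problem_def dest: encodes_unique)

end

theory Submission
  imports Defs
begin

text \<open>
  Decidability. SL(2,Z) acts on the tree dual to the Farey tessellation. A factorization is a
  walk with bounded steps in this tree, so by the four-point condition every product of at least
  two factors that lies in a ball splits into two shorter products that lie in the same ball.
  Along nested splittings of a long factorization some element of the ball recurs: this gives
  \<open>v w x = w\<close> as elements of the group, for infixes \<open>v w x\<close> and \<open>w\<close> with \<open>v x\<close> nonempty, and \<open>v\<close> and
  \<open>x\<close> can be pumped simultaneously, up or down. Hence there are infinitely many factorizations
  if and only if there is one whose length lies between \<open>B\<close> and \<open>3 B\<close>, for a computable \<open>B\<close>.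

  NP-hardness. An accepting computation is a tiling of a helix, one tile per stage. A tile is
  encoded in the digits of a number in such a way that a choice of one tile per stage is a tiling
  exactly if the alternating sum of the numbers vanishes. The generators place powers of a lower
  unipotent matrix, given by these numbers, between powers of an upper one that identify the
  stage and cancel exactly between consecutive stages; the product over all stages then contains
  the alternating sum in the lower left entry. If the sum can be made to vanish, then the
  identity is a product of generators and every element has infinitely many factorizations;
  otherwise a ping-pong argument bounds the lengths of factorizations.

  Turing machines are obtained by compiling a small language of expressions, with bounded
  iteration over strings, to programs on stacks.
\<close>

section \<open>Stack programs\<close>

text \<open>An element may have infinitely many factorizations although the identity is not a
  product of generators, so that pumping one infix cannot suffice. Two-sided pumping is that of
  context-free languages; it is available because SL(2,Z) is virtually free. The bound
  \<open>B\<close> is triply exponential: entries are exponential in the input, the radius is linear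
  in the entries, a ball is exponential in its radius, and each element of the ball costs one
  halving of the word. The helix puts the stages of a two-dimensional tableau in one linear order,
  so that cancellation is needed between consecutive stages only. Signs alternate along it, and
  matching codes must meet with opposite signs: hence the odd width and, for a constant top digit,
  the even number of stages. The ping-pong needs every chain sum to be nonzero, also those of
  partial chains; this is why horizontal codes are nonzero inside the helix. The promise asks for an
  element of the semigroup, so the reduction takes its first generator as the target. Only the
  reduction has to run in polynomial time; the decision procedure may use iteration with state,
  whose values can grow exponentially.\<close>

text \<open>
  A program works on stacks of natural numbers. Stack \<open>i\<close> is held on tape \<open>i\<close>, top under the
  head, entry \<open>a\<close> written as the symbol \<open>Suc a\<close>, so that the blank marks the empty stack.
  \<open>Mv r ds\<close> pops \<open>r\<close> and pushes the popped entry on all of \<open>ds\<close>.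
\<close>

datatype cmd =
    Push nat nat
  | Mv nat "nat list"
  | Seq cmd cmd
  | Test nat nat cmd cmd
  | While nat cmd

type_synonym store = "nat \<Rightarrow> nat list"

text \<open>
  A control state \<open>(ds, a, K)\<close> consists of the continuation \<open>K\<close> and of a pending write of the
  symbol \<open>a\<close> to the tapes \<open>ds\<close>, whose heads have already been moved to the new cell.
\<close>

type_synonym ctrl = "nat list \<times> nat \<times> cmd list"

text \<open>A machine step writes before it moves, while a push has to write into the cell reached
  by the move; a push therefore takes a second step. A pop blanks the cell that it leaves, so that
  nothing remains behind the top of a stack.\<close>

fun ctl :: "ctrl \<Rightarrow> (nat \<Rightarrow> nat) \<Rightarrow> ctrl \<times> (nat \<Rightarrow> nat \<times> int)" where
  "ctl (d # ds, a, K) h = (([], 0, K), \<lambda>i. (if i = d \<or> i \<in> set ds then a else h i, 0))"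
| "ctl ([], b, []) h = (([], b, []), \<lambda>i. (h i, 0))"
| "ctl ([], b, Push r a # K) h = (([r], Suc a, K), \<lambda>i. (h i, if i = r then -1 else 0))"
| "ctl ([], b, Mv r ds # K) h =
     ((ds, if ds = [] then 0 else h r, K),
      \<lambda>i. if i = r then (0, 1) else (h i, if i \<in> set ds then -1 else 0))"
| "ctl ([], b, Seq c d # K) h = (([], b, c # d # K), \<lambda>i. (h i, 0))"
| "ctl ([], b, Test r a c d # K) h =
     (([], b, (if h r = Suc a then c else d) # K), \<lambda>i. (h i, 0))"
| "ctl ([], b, While r c # K) h =
     (([], b, if h r = 0 then K else c # While r c # K), \<lambda>i. (h i, 0))"

definition cstep :: "ctrl \<times> (nat \<Rightarrow> tape) \<Rightarrow> ctrl \<times> (nat \<Rightarrow> tape)" where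
  "cstep x = (let r = ctl (fst x) (\<lambda>i. snd x i 0) in (fst r, \<lambda>i. act (snd x i) (snd r i)))"

definition stack :: "nat list \<Rightarrow> tape" where
  "stack l = (\<lambda>i. if 0 \<le> i \<and> nat i < length l then Suc (l ! nat i) else 0)"

text \<open>The arbitrary continuation \<open>K\<close> allows a run to be embedded in any larger
  program.\<close>

definition runs :: "cmd \<Rightarrow> store \<Rightarrow> store \<Rightarrow> nat \<Rightarrow> bool" where
  "runs c s s' t \<longleftrightarrow>
     (\<forall>K. (cstep ^^ t) (([], 0, c # K), stack \<circ> s) = (([], 0, K), stack \<circ> s'))"

section \<open>Execution rules of stack programs\<close>

lemma stack_0: "stack l 0 = (case l of [] \<Rightarrow> 0 | a # _ \<Rightarrow> Suc a)"
  by (cases l) (auto simp: stack_def)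

lemma act_stay [simp]: "act t (t 0, 0) = t"
  by (auto simp: act_def)

lemma act_stack_stay [simp]: "act (stack l) (case l of [] \<Rightarrow> 0 | a # _ \<Rightarrow> Suc a, 0) = stack l"
  by (metis act_stay stack_0)

lemma act_pop: "act (stack l) (0, 1) = stack (tl l)"
proof
  fix i :: int
  consider "i < -1" | "i = -1" | "0 \<le> i" by linarith
  then show "act (stack l) (0, 1) i = stack (tl l) i"
  proof cases
    case 3
    then have "nat (i + 1) = Suc (nat i)" by linarith
    with 3 show ?thesis by (cases l) (simp_all add: act_def stack_def)
  qed (simp_all add: act_def stack_def)
qed

lemma act_push: "act (act (stack l) (stack l 0, -1)) (Suc a, 0) = stack (a # l)"
proof -
  have *: "(a # l) ! nat i = l ! (nat i - 1)" if "0 < i" for i :: int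
    using that by (simp add: nth_Cons')
  show ?thesis
  proof
    fix i :: int
    consider "i < 0" | "i = 0" | "0 < i" by linarith
    then show "act (act (stack l) (stack l 0, -1)) (Suc a, 0) i = stack (a # l) i"
    proof cases
      case 3
      then have "nat (i - 1) = nat i - 1" "nat i - 1 < length l \<longleftrightarrow> nat i < Suc (length l)" by linarith+
      with 3 show ?thesis by (simp add: act_def stack_def *)
    qed (simp_all add: act_def stack_def)
  qed
qed

lemma runs_Push: "runs (Push r a) s (s(r := a # s r)) 2"
  unfolding runs_def
  by (auto simp: numeral_2_eq_2 cstep_def fun_eq_iff act_push simp del: fun_upd_apply)
     (auto simp: act_push)

lemma runs_Mv:
  assumes "s r = a # l" "r \<notin> set ds"
  shows "runs (Mv r ds) s (\<lambda>i. if i = r then l else if i \<in> set ds then a # s i else s i)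
           (if ds = [] then 1 else 2)"
proof -
  have "stack (s r) 0 = Suc a" using assms by (simp add: stack_0)
  then show ?thesis
    using assms unfolding runs_def
    by (cases ds) (auto simp: numeral_2_eq_2 cstep_def fun_eq_iff act_push act_pop)
qed

lemma runs_Mv_empty:
  assumes "s r = []" shows "runs (Mv r []) s s 1"
  using assms unfolding runs_def by (auto simp: cstep_def fun_eq_iff act_pop)

lemma runs_Seq:
  assumes "runs c s s' t" "runs d s' s'' t'"
  shows "runs (Seq c d) s s'' (Suc (t + t'))"
proof -
  have "(cstep ^^ Suc (t + t')) (([], 0, Seq c d # K), stack \<circ> s) = (([], 0, K), stack \<circ> s'')" for K
  proof -
    have "cstep (([], 0, Seq c d # K), stack \<circ> s) = (([], 0, c # d # K), stack \<circ> s)"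
      by (auto simp: cstep_def)
    then have "(cstep ^^ Suc (t + t')) (([], 0, Seq c d # K), stack \<circ> s) =
               (cstep ^^ (t' + t)) (([], 0, c # d # K), stack \<circ> s)"
      by (simp add: funpow_swap1 add.commute)
    then show ?thesis using assms by (simp add: funpow_add runs_def)
  qed
  then show ?thesis by (simp add: runs_def del: funpow.simps)
qed

lemma runs_Test:
  assumes "runs (if s r \<noteq> [] \<and> hd (s r) = a then c else d) s s' t"
  shows "runs (Test r a c d) s s' (Suc t)"
proof -
  have "cstep (([], 0, Test r a c d # K), stack \<circ> s) =
        (([], 0, (if s r \<noteq> [] \<and> hd (s r) = a then c else d) # K), stack \<circ> s)" for K
    by (auto simp: cstep_def stack_0 fun_eq_iff split: list.splits)
  then show ?thesis using assms unfolding runs_def by (simp add: funpow_swap1)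
qed

lemma runs_While_empty:
  assumes "s r = []" shows "runs (While r c) s s 1"
  using assms unfolding runs_def by (auto simp: cstep_def fun_eq_iff stack_0)

lemma runs_While_step:
  assumes "s r \<noteq> []" "runs c s s' t" "runs (While r c) s' s'' t'"
  shows "runs (While r c) s s'' (Suc (t + t'))"
proof -
  have "(cstep ^^ Suc (t + t')) (([], 0, While r c # K), stack \<circ> s) = (([], 0, K), stack \<circ> s'')" for K
  proof -
    have "cstep (([], 0, While r c # K), stack \<circ> s) = (([], 0, c # While r c # K), stack \<circ> s)"
      using assms(1) by (auto simp: cstep_def stack_0 fun_eq_iff split: list.splits)
    then have "(cstep ^^ Suc (t + t')) (([], 0, While r c # K), stack \<circ> s) =
               (cstep ^^ (t' + t)) (([], 0, c # While r c # K), stack \<circ> s)"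
      by (simp add: funpow_swap1 add.commute)
    then show ?thesis using assms by (simp add: funpow_add runs_def)
  qed
  then show ?thesis by (simp add: runs_def del: funpow.simps)
qed


subsection \<open>Stack programs as Turing machines\<close>

fun ok_cmd :: "nat \<Rightarrow> nat \<Rightarrow> cmd \<Rightarrow> bool" where
  "ok_cmd k A (Push r a) \<longleftrightarrow> r < k \<and> a < A"
| "ok_cmd k A (Mv r ds) \<longleftrightarrow> r < k \<and> set ds \<subseteq> {..<k} \<and> length ds \<le> k"
| "ok_cmd k A (Seq c d) \<longleftrightarrow> ok_cmd k A c \<and> ok_cmd k A d"
| "ok_cmd k A (Test r a c d) \<longleftrightarrow> r < k \<and> ok_cmd k A c \<and> ok_cmd k A d"
| "ok_cmd k A (While r c) \<longleftrightarrow> r < k \<and> ok_cmd k A c"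

text \<open>These are the continuations that occur while the command runs in front of
  \<open>K\<close>, apart from \<open>K\<close> itself. They are finitely many because a loop body
  continues with the loop itself and not with a growing list; this makes the control finite.\<close>

fun conts :: "cmd \<Rightarrow> cmd list \<Rightarrow> cmd list set" where
  "conts (Push r a) K = {Push r a # K}"
| "conts (Mv r ds) K = {Mv r ds # K}"
| "conts (Seq c d) K = insert (Seq c d # K) (conts c (d # K) \<union> conts d K)"
| "conts (Test r a c d) K = insert (Test r a c d # K) (conts c K \<union> conts d K)"
| "conts (While r c) K = insert (While r c # K) (conts c (While r c # K))"

lemma finite_conts: "finite (conts c K)"
  by (induction c arbitrary: K) auto

lemma conts_self: "c # K \<in> conts c K"
  by (cases c) auto

lemma conts_Cons: "L \<in> conts c K \<Longrightarrow> ok_cmd k A c \<Longrightarrow> \<exists>d L'. L = d # L' \<and> ok_cmd k A d"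
  by (induction c arbitrary: K) auto

lemma conts_closed:
  "L \<in> conts c K \<Longrightarrow> snd (snd (fst (ctl ([], b, L) h))) \<in> insert K (conts c K)"
proof (induction c arbitrary: K)
  case (Seq c d)
  let ?L = "snd (snd (fst (ctl ([], b, L) h)))"
  have "L \<in> conts c (d # K) \<Longrightarrow> ?L = d # K \<or> ?L \<in> conts c (d # K)"
    using Seq.IH(1)[of "d # K"] by blast
  moreover have "L \<in> conts d K \<Longrightarrow> ?L = K \<or> ?L \<in> conts d K"
    using Seq.IH(2)[of K] by blast
  ultimately show ?case
    using Seq.prems conts_self[of c "d # K"] conts_self[of d K] by auto
next
  case (Test r a c d)
  then show ?case using conts_self[of c K] conts_self[of d K] by auto
next
  case (While r c)
  then show ?case using While.IH[of "While r c # K"] conts_self[of c "While r c # K"] by (auto split: if_splits)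
qed auto

definition states :: "nat \<Rightarrow> nat \<Rightarrow> cmd \<Rightarrow> ctrl set" where
  "states k A c = {ds. set ds \<subseteq> {..<k} \<and> length ds \<le> k} \<times> {..A} \<times> insert [] (conts c [])"

lemma finite_states: "finite (states k A c)"
  unfolding states_def by (intro finite_cartesian_product) (auto simp: finite_conts finite_lists_length_le)

lemma states_closed:
  assumes "x \<in> states k A c" "ok_cmd k A c" "\<And>i. h i \<le> A" "k > 0"
  shows "fst (ctl x h) \<in> states k A c" "fst (snd (ctl x h) i) \<le> A" "snd (snd (ctl x h) i) \<in> {-1, 0, 1}"
proof -
  obtain ds a L where x: "x = (ds, a, L)" by (cases x)
  have L: "L = [] \<or> L \<in> conts c []" using assms(1) by (auto simp: x states_def)
  have a: "a \<le> A" using assms(1) by (auto simp: x states_def)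
  have "fst (ctl x h) \<in> states k A c \<and> fst (snd (ctl x h) i) \<le> A \<and> snd (snd (ctl x h) i) \<in> {-1, 0, 1}"
  proof (cases "ds = [] \<and> L \<noteq> []")
    case False
    then show ?thesis
      using assms(1,3,4) a by (cases ds; cases L) (auto simp: x states_def)
  next
    case True
    then have Lc: "L \<in> conts c []" using L by auto
    obtain d L' where d: "L = d # L'" "ok_cmd k A d" using conts_Cons[OF Lc assms(2)] by auto
    have "snd (snd (fst (ctl ([], a, L) h))) \<in> insert [] (conts c [])"
      using conts_closed[OF Lc] by blast
    then show ?thesis
      using True d assms(3,4) a by (cases d) (auto simp: x states_def split: if_splits)
  qed
  then show "fst (ctl x h) \<in> states k A c" "fst (snd (ctl x h) i) \<le> A" "snd (snd (ctl x h) i) \<in> {-1, 0, 1}"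
    by auto
qed

text \<open>\<open>ctl\<close> expects the symbols of infinitely many tapes; this reduces it to the
  \<open>k\<close> tapes of an actual machine.\<close>

lemma ctl_cong:
  assumes "x \<in> states k A c" "ok_cmd k A c" "\<And>i. i < k \<Longrightarrow> h i = h' i"
  shows "fst (ctl x h) = fst (ctl x h')" "i < k \<Longrightarrow> snd (ctl x h) i = snd (ctl x h') i"
proof -
  obtain ds a L where x: "x = (ds, a, L)" by (cases x)
  have L: "L = [] \<or> L \<in> conts c []" using assms(1) by (auto simp: x states_def)
  have "fst (ctl x h) = fst (ctl x h') \<and> (i < k \<longrightarrow> snd (ctl x h) i = snd (ctl x h') i)"
  proof (cases "ds = [] \<and> L \<noteq> []")
    case False
    then show ?thesis using assms(3) by (cases ds; cases L) (auto simp: x)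
  next
    case True
    then obtain d L' where d: "L = d # L'" "ok_cmd k A d" using conts_Cons assms(2) L by blast
    then show ?thesis using True assms(3) by (cases d) (auto simp: x)
  qed
  then show "fst (ctl x h) = fst (ctl x h')" "i < k \<Longrightarrow> snd (ctl x h) i = snd (ctl x h') i" by auto
qed

definition bit :: "bool \<Rightarrow> nat" where
  "bit b = (if b then 1 else 0)"

lemma tape_of_stack: "tape_of x = stack (map bit x)"
  by (auto simp: tape_of_def stack_def bit_def)

definition input :: "bool list list \<Rightarrow> store" where
  "input xs = (\<lambda>i. if i < length xs then map bit (xs ! i) else [])"

text \<open>The finite control is numbered so that the program in front of nothing gets 0 and the
  empty continuation gets 1, as the machine model demands. \<open>step\<close> freezes state 1 and
  \<open>ctl\<close> idles on the empty continuation, so the simulation is exact step by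
  step.\<close>

lemma cmd_tm:
  assumes ok: "ok_cmd k A c" and A: "2 \<le> A" and k: "0 < k"
  obtains M where "wf_tm M" "num_tapes M = k"
    "\<And>xs s t y. length xs \<le> k \<Longrightarrow> runs c (input xs) s t \<Longrightarrow> s 0 = map bit y \<Longrightarrow> halts_with M xs y t"
proof -
  define Q where "Q = states k A c"
  define c0 :: ctrl where "c0 = ([], 0, [c])"
  define cf :: ctrl where "cf = ([], 0, [])"
  have Q: "finite Q" "c0 \<in> Q" "cf \<in> Q" "c0 \<noteq> cf"
    unfolding Q_def
    by (rule finite_states) (simp_all add: c0_def cf_def states_def conts_self)
  obtain f n where f: "bij_betw f (Q - {c0, cf}) {0..<n::nat}"
    using ex_bij_betw_finite_nat[of "Q - {c0, cf}"] Q(1) by blast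
  define code where "code x = (if x = c0 then 0 else if x = cf then 1 else f x + 2)" for x
  have f_less: "f x < n" if "x \<in> Q" "x \<noteq> c0" "x \<noteq> cf" for x
    using bij_betwE[OF f] that by auto
  have code_less: "code x < n + 2" if "x \<in> Q" for x
    using that f_less by (auto simp: code_def)
  have code_inj: "inj_on code Q"
  proof (rule inj_onI)
    fix x y assume xy: "x \<in> Q" "y \<in> Q" "code x = code y"
    have "f x = f y \<Longrightarrow> x \<notin> {c0, cf} \<Longrightarrow> y \<notin> {c0, cf} \<Longrightarrow> x = y"
      using bij_betw_imp_inj_on[OF f] xy by (auto dest: inj_onD)
    then show "x = y" using xy(3) Q(4) by (simp add: code_def split: if_splits)
  qed
  have code_surj: "\<exists>x\<in>Q. q = code x" if "q < n + 2" for q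
  proof -
    consider "q = 0" | "q = 1" | "2 \<le> q" by linarith
    then show ?thesis
    proof cases
      case 1 then show ?thesis using Q by (intro bexI[of _ c0]) (auto simp: code_def)
    next
      case 2 then show ?thesis using Q by (intro bexI[of _ cf]) (auto simp: code_def)
    next
      case 3
      then have "q - 2 \<in> f ` (Q - {c0, cf})"
        using that bij_betw_imp_surj_on[OF f] by auto
      then obtain x where "x \<in> Q" "x \<noteq> c0" "x \<noteq> cf" "f x = q - 2" by force
      then show ?thesis using 3 by (intro bexI[of _ x]) (auto simp: code_def)
    qed
  qed
  define decode where "decode q = inv_into Q code q" for q
  have decode: "decode (code x) = x" if "x \<in> Q" for x
    using code_inj that by (simp add: decode_def)
  have decode_in: "decode q \<in> Q" if "q < n + 2" for q
    using code_surj[OF that] decode by auto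
  define look where "look ss = (\<lambda>i. if i < k then ss ! i else 0)" for ss :: "nat list"
  have look_le: "look ss i \<le> A" if "length ss = k \<and> set ss \<subseteq> {..<Suc A}" for ss i
    using that nth_mem[of i ss] by (auto simp: look_def subset_eq less_Suc_eq_le)
  define M where "M = \<lparr>num_tapes = k, num_symbols = Suc A, num_states = n + 2,
     delta = (\<lambda>q ss. let r = ctl (decode q) (look ss) in (code (fst r), map (snd r) [0..<k]))\<rparr>"
  have M_sel: "num_tapes M = k" "num_symbols M = Suc A" "num_states M = n + 2"
    by (simp_all add: M_def)
  have M_delta: "delta M q ss =
      (code (fst (ctl (decode q) (look ss))), map (snd (ctl (decode q) (look ss))) [0..<k])" for q ss
    by (simp add: M_def Let_def)
  have "fst (delta M q ss) < n + 2 \<and> length (snd (delta M q ss)) = k \<and>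
      set (snd (delta M q ss)) \<subseteq> {..<Suc A} \<times> {-1, 0, 1}"
    if "q < n + 2" "length ss = k" "set ss \<subseteq> {..<Suc A}" for q ss
  proof -
    have d: "decode q \<in> states k A c" using decode_in[OF that(1)] by (simp add: Q_def)
    have l: "\<And>i. look ss i \<le> A" using look_le that by blast
    have "code (fst (ctl (decode q) (look ss))) < n + 2"
      using states_closed(1)[where h = "look ss", OF d ok l k] by (intro code_less) (simp add: Q_def)
    moreover have "snd (ctl (decode q) (look ss)) i \<in> {..<Suc A} \<times> {-1, 0, 1}" for i
      using states_closed(2,3)[where h = "look ss" and i = i, OF d ok l k] by (simp add: mem_Times_iff less_Suc_eq_le)
    ultimately show ?thesis unfolding M_delta by (simp add: image_subset_iff)
  qed
  then have "wf_tm M"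
    using A k unfolding wf_tm_def M_sel by auto
  moreover have "halts_with M xs y t"
    if xs: "length xs \<le> k" and run: "runs c (input xs) s t" and y: "s 0 = map bit y" for xs s t y
  proof -
    define x0 where "x0 = (c0, stack \<circ> input xs)"
    let ?x = "\<lambda>m. (cstep ^^ m) x0"
    have sim: "(step M ^^ m) (init M xs) = (code (fst (?x m)), map (snd (?x m)) [0..<k]) \<and>
        fst (?x m) \<in> Q \<and> (\<forall>i j. snd (?x m) i j \<le> A)" for m
    proof (induction m)
      case 0
      have "map tape_of xs @ replicate (k - length xs) (\<lambda>_. 0) = map (stack \<circ> input xs) [0..<k]"
        using xs by (intro nth_equalityI)
          (auto simp: nth_append input_def tape_of_stack stack_def)
      moreover have "stack (input xs i) j \<le> A" for i j
        using A by (auto simp: stack_def input_def bit_def)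
      ultimately show ?case using Q by (auto simp: x0_def init_def M_sel code_def)
    next
      case (Suc m)
      obtain x T where xT: "?x m = (x, T)" by (cases "?x m")
      have IH: "(step M ^^ m) (init M xs) = (code x, map T [0..<k])" "x \<in> Q" "\<And>i j. T i j \<le> A"
        using Suc xT by auto
      define h where "h = (\<lambda>i. T i 0)"
      have h: "h i \<le> A" for i using IH(3) by (simp add: h_def)
      note clo = states_closed[where h = h, OF IH(2)[unfolded Q_def] ok h k]
      define r where "r = ctl x h"
      have next_x: "?x (Suc m) = (fst r, \<lambda>i. act (T i) (snd r i))"
        using xT by (simp add: cstep_def r_def h_def Let_def)
      have "step M (code x, map T [0..<k]) = (code (fst r), map (\<lambda>i. act (T i) (snd r i)) [0..<k])"
      proof (cases "x = cf")
        case True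
        then have "code x = 1" using Q by (auto simp: code_def)
        moreover have "r = (cf, \<lambda>i. (h i, 0))" using True by (simp add: r_def cf_def)
        moreover have "act (T i) (h i, 0) = T i" for i by (simp add: h_def)
        ultimately show ?thesis using True by (simp add: step_def)
      next
        case False
        then have "code x \<noteq> 1" by (auto simp: code_def)
        have agree: "look (map (\<lambda>t. t 0) (map T [0..<k])) i = h i" if "i < k" for i
          using that by (simp add: look_def h_def)
        have "fst (ctl x (look (map (\<lambda>t. t 0) (map T [0..<k])))) = fst r"
          "\<And>i. i < k \<Longrightarrow> snd (ctl x (look (map (\<lambda>t. t 0) (map T [0..<k])))) i = snd r i"
          unfolding r_def using ctl_cong[OF IH(2)[unfolded Q_def] ok agree] by auto
        then have "delta M (code x) (map (\<lambda>t. t 0) (map T [0..<k])) = (code (fst r), map (snd r) [0..<k])"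
          using decode[OF IH(2)] by (simp add: M_delta)
        moreover have "map2 act (map T [0..<k]) (map (snd r) [0..<k]) =
             map (\<lambda>i. act (T i) (snd r i)) [0..<k]"
          by (simp add: zip_map_map zip_same_conv_map comp_def)
        ultimately show ?thesis using \<open>code x \<noteq> 1\<close> by (simp add: step_def)
      qed
      moreover have "act (T i) (snd r i) j \<le> A" for i j
        using clo(2)[of i] IH(3) by (auto simp: act_def r_def)
      ultimately show ?case using IH clo(1) unfolding next_x by (simp add: r_def Q_def)
    qed
    have "?x t = (cf, stack \<circ> s)" using run by (simp add: runs_def x0_def c0_def cf_def)
    then have "(step M ^^ t) (init M xs) = (1, map (stack \<circ> s) [0..<k])"
      using sim[of t] Q by (simp add: code_def)
    moreover have "hd (map (stack \<circ> s) [0..<k]) = tape_of y"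
      using k y by (simp add: hd_map tape_of_stack)
    ultimately show ?thesis using xs by (auto simp: halts_with_def M_sel)
  qed
  ultimately show thesis using that[of M] by (auto simp: M_sel)
qed

lemma halts_with_mono:
  assumes "halts_with M xs y n" "n \<le> m"
  shows "halts_with M xs y m"
proof -
  obtain ts where ts: "(step M ^^ n) (init M xs) = (1, ts)" "hd ts = tape_of y" "length xs \<le> num_tapes M"
    using assms(1) by (auto simp: halts_with_def)
  have "(step M ^^ (d + n)) (init M xs) = (1, ts)" for d
    by (induction d) (use ts in \<open>simp_all add: step_def[of M "(Suc 0, ts)"]\<close>)
  then show ?thesis using ts assms(2) by (auto simp: halts_with_def le_iff_add add.commute)
qed

section \<open>Expressions\<close>

text \<open>
  Expressions denote functions on lists of lists of symbols. \<open>Loop\<close> and \<open>Iter\<close> bind new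
  variables behind those of the environment; \<open>Iter\<close> iterates several steps simultaneously.
\<close>

datatype ex =
    Var nat
  | Nl
  | Sym nat
  | Cat ex ex
  | Drop ex ex
  | Cond nat ex ex ex
  | Loop ex ex
  | Iter ex "ex list" "ex list" ex
  | Call ex "ex list"

abbreviation un :: "nat \<Rightarrow> nat list" where
  "un n \<equiv> replicate n 0"

text \<open>The number of a bound variable is the length of the environment at its binder, so an
  expression with binders changes its meaning in a longer environment; \<open>Call\<close> evaluates
  it in a fresh one. Mapping \<open>eval\<close> over a list before applying it keeps the recursion
  primitive.\<close>

primrec eval :: "ex \<Rightarrow> nat list list \<Rightarrow> nat list" where
  "eval (Var i) = (\<lambda>env. if i < length env then env ! i else [])"
| "eval Nl = (\<lambda>env. [])"
| "eval (Sym a) = (\<lambda>env. [a])"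
| "eval (Cat d e) = (\<lambda>env. eval d env @ eval e env)"
| "eval (Drop d e) = (\<lambda>env. drop (length (eval d env)) (eval e env))"
| "eval (Cond a c d e) = (\<lambda>env.
     if eval c env \<noteq> [] \<and> hd (eval c env) = a then eval d env else eval e env)"
| "eval (Loop d e) = (\<lambda>env.
     concat (map (\<lambda>j. eval e (env @ [un j])) [0..<length (eval d env)]))"
| "eval (Iter d ins ss e) = (\<lambda>env.
     eval e (env @ ((\<lambda>vs. map (\<lambda>g. g (env @ vs)) (map eval ss)) ^^ length (eval d env))
                     (map (\<lambda>g. g env) (map eval ins))))"
| "eval (Call e es) = (\<lambda>env. eval e (map (\<lambda>g. g env) (map eval es)))"

primrec wf_ex :: "ex \<Rightarrow> bool" where
  "wf_ex (Var i) \<longleftrightarrow> True"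
| "wf_ex Nl \<longleftrightarrow> True"
| "wf_ex (Sym a) \<longleftrightarrow> True"
| "wf_ex (Cat d e) \<longleftrightarrow> wf_ex d \<and> wf_ex e"
| "wf_ex (Drop d e) \<longleftrightarrow> wf_ex d \<and> wf_ex e"
| "wf_ex (Cond a c d e) \<longleftrightarrow> wf_ex c \<and> wf_ex d \<and> wf_ex e"
| "wf_ex (Loop d e) \<longleftrightarrow> wf_ex d \<and> wf_ex e"
| "wf_ex (Iter d ins ss e) \<longleftrightarrow> length ins = length ss \<and> wf_ex d \<and> wf_ex e \<and>
     list_all id (map wf_ex ins) \<and> list_all id (map wf_ex ss)"
| "wf_ex (Call e es) \<longleftrightarrow> wf_ex e \<and> list_all id (map wf_ex es)"

text \<open>\<open>Iter\<close> can double the length of its state in every round. The values of a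
  \<open>Loop\<close> body are only concatenated and never fed back, so lengths stay
  polynomial.\<close>

primrec poly_ex :: "ex \<Rightarrow> bool" where
  "poly_ex (Var i) \<longleftrightarrow> True"
| "poly_ex Nl \<longleftrightarrow> True"
| "poly_ex (Sym a) \<longleftrightarrow> True"
| "poly_ex (Cat d e) \<longleftrightarrow> poly_ex d \<and> poly_ex e"
| "poly_ex (Drop d e) \<longleftrightarrow> poly_ex d \<and> poly_ex e"
| "poly_ex (Cond a c d e) \<longleftrightarrow> poly_ex c \<and> poly_ex d \<and> poly_ex e"
| "poly_ex (Loop d e) \<longleftrightarrow> poly_ex d \<and> poly_ex e"
| "poly_ex (Iter d ins ss e) \<longleftrightarrow> False"
| "poly_ex (Call e es) \<longleftrightarrow> poly_ex e \<and> list_all id (map poly_ex es)"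


subsection \<open>Compilation\<close>

text \<open>Only when \<open>p\<close> holds is the running time required to obey the bound \<open>b\<close>.\<close>

definition rb :: "bool \<Rightarrow> cmd \<Rightarrow> store \<Rightarrow> store \<Rightarrow> nat \<Rightarrow> bool" where
  "rb p c s s' b \<longleftrightarrow> (\<exists>t. runs c s s' t \<and> (p \<longrightarrow> t \<le> b))"

lemma rb_weaken: "rb p c s s' b \<Longrightarrow> (p \<Longrightarrow> b \<le> b') \<Longrightarrow> rb p c s s' b'"
  unfolding rb_def by (meson le_trans)

lemma rb_Push: "rb p (Push r a) s (s(r := a # s r)) 2"
  unfolding rb_def using runs_Push by blast

lemma rb_pop: "rb p (Mv r []) s (s(r := tl (s r))) 1"
proof (cases "s r")
  case Nil
  then have "s(r := tl (s r)) = s" by auto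
  then show ?thesis using runs_Mv_empty[of s r] Nil unfolding rb_def by auto
next
  case (Cons a l)
  then have "(\<lambda>i. if i = r then l else if i \<in> set [] then a # s i else s i) = s(r := tl (s r))" by auto
  then show ?thesis using runs_Mv[of s r a l "[]"] Cons unfolding rb_def by auto
qed

lemma rb_Seq: "rb p c s s' b \<Longrightarrow> rb p d s' s'' b' \<Longrightarrow> rb p (Seq c d) s s'' (Suc (b + b'))"
  unfolding rb_def by (meson runs_Seq Suc_le_mono add_mono)

lemma rb_Test:
  "rb p (if s r \<noteq> [] \<and> hd (s r) = a then c else d) s s' b \<Longrightarrow> rb p (Test r a c d) s s' (Suc b)"
  unfolding rb_def by (meson runs_Test Suc_le_mono)

lemma rb_While:
  assumes "\<And>j. j < n \<Longrightarrow> S j r \<noteq> [] \<and> rb p c (S j) (S (Suc j)) (b j)" "S n r = []"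
  shows "rb p (While r c) (S 0) (S n) (Suc (\<Sum>j<n. Suc (b j)))"
proof -
  have "i \<le> n \<Longrightarrow> rb p (While r c) (S i) (S n) (Suc (\<Sum>j=i..<n. Suc (b j)))" for i
  proof (induction "n - i" arbitrary: i)
    case 0
    then show ?case using runs_While_empty[of "S n" r] assms(2) by (auto simp: rb_def)
  next
    case (Suc k)
    then have "rb p (While r c) (S (Suc i)) (S n) (Suc (\<Sum>j=Suc i..<n. Suc (b j)))" by simp
    then obtain t' where t': "runs (While r c) (S (Suc i)) (S n) t'"
      "p \<longrightarrow> t' \<le> Suc (\<Sum>j=Suc i..<n. Suc (b j))" by (auto simp: rb_def)
    obtain t where t: "S i r \<noteq> []" "runs c (S i) (S (Suc i)) t" "p \<longrightarrow> t \<le> b i"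
      using assms(1)[of i] Suc(2) unfolding rb_def by (metis zero_less_Suc zero_less_diff)
    have "runs (While r c) (S i) (S n) (Suc (t + t'))" using runs_While_step t t' by blast
    moreover have "{i..<n} = insert i {Suc i..<n}" using Suc by auto
    ultimately show ?case using t t' by (auto simp: rb_def intro!: exI[of _ "Suc (t + t')"])
  qed
  from this[of 0] show ?thesis by (simp add: lessThan_atLeast0)
qed

text \<open>Popping the stack \<open>f\<close>, which is empty whenever this is reached, stands in
  for a skip command.\<close>

primrec seqs :: "nat \<Rightarrow> cmd list \<Rightarrow> cmd" where
  "seqs f [] = Mv f []"
| "seqs f (c # cs) = Seq c (seqs f cs)"

lemma rb_seqs:
  assumes "\<And>j. j < length cs \<Longrightarrow> rb p (cs ! j) (S j) (S (Suc j)) (b j)" "S (length cs) f = []"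
  shows "rb p (seqs f cs) (S 0) (S (length cs)) (Suc (\<Sum>j<length cs. Suc (b j)))"
  using assms
proof (induction cs arbitrary: S b)
  case Nil
  then show ?case using rb_pop[of p f "S 0"] by (simp add: fun_upd_idem)
next
  case (Cons c cs)
  have "rb p (seqs f cs) (S (Suc 0)) (S (Suc (length cs))) (Suc (\<Sum>j<length cs. Suc (b (Suc j))))"
    using Cons.IH[of "\<lambda>j. S (Suc j)" "\<lambda>j. b (Suc j)"] Cons.prems by fastforce
  moreover have "rb p c (S 0) (S (Suc 0)) (b 0)" using Cons.prems(1)[of 0] by simp
  ultimately show ?case
    using rb_Seq by (fastforce simp: sum.lessThan_Suc_shift simp del: sum.lessThan_Suc)
qed

section \<open>Moving, clearing and copying stacks\<close>

definition flip :: "nat \<Rightarrow> nat \<Rightarrow> cmd" where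
  "flip r d = While r (Mv r [d])"

definition clear :: "nat \<Rightarrow> cmd" where
  "clear r = While r (Mv r [])"

lemma rb_flip:
  assumes "r \<noteq> d"
  shows "rb p (flip r d) s (s(r := [], d := rev (s r) @ s d)) (Suc (3 * length (s r)))"
proof -
  define S where "S j = s(r := drop j (s r), d := rev (take j (s r)) @ s d)" for j
  have "rb p (While r (Mv r [d])) (S 0) (S (length (s r))) (Suc (\<Sum>j<length (s r). Suc 2))"
  proof (rule rb_While)
    fix j assume j: "j < length (s r)"
    then have d: "drop j (s r) = s r ! j # drop (Suc j) (s r)" by (simp add: Cons_nth_drop_Suc)
    then have "S j r = s r ! j # drop (Suc j) (s r)" using assms by (simp add: S_def)
    from runs_Mv[of "S j", OF this, of "[d]"] assms
    have "runs (Mv r [d]) (S j) (\<lambda>i. if i = r then drop (Suc j) (s r)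
        else if i \<in> set [d] then s r ! j # S j i else S j i) 2" by simp
    also have "(\<lambda>i. if i = r then drop (Suc j) (s r)
        else if i \<in> set [d] then s r ! j # S j i else S j i) = S (Suc j)"
      using assms j by (auto simp: S_def take_Suc_conv_app_nth)
    finally have "rb p (Mv r [d]) (S j) (S (Suc j)) 2" unfolding rb_def by blast
    then show "S j r \<noteq> [] \<and> rb p (Mv r [d]) (S j) (S (Suc j)) 2"
      using assms j by (simp add: S_def)
  qed (use assms in \<open>simp add: S_def\<close>)
  moreover have "S 0 = s" by (auto simp: S_def)
  moreover have "S (length (s r)) = s(r := [], d := rev (s r) @ s d)" by (auto simp: S_def)
  ultimately show ?thesis by (simp add: flip_def mult.commute)
qed

lemma rb_clear: "rb p (clear r) s (s(r := [])) (Suc (2 * length (s r)))"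
proof -
  define S where "S j = s(r := drop j (s r))" for j
  have "rb p (While r (Mv r [])) (S 0) (S (length (s r))) (Suc (\<Sum>j<length (s r). Suc 1))"
  proof (rule rb_While)
    fix j assume j: "j < length (s r)"
    then have "(S j)(r := tl (S j r)) = S (Suc j)" by (simp add: S_def drop_Suc tl_drop)
    then show "S j r \<noteq> [] \<and> rb p (Mv r []) (S j) (S (Suc j)) 1"
      using rb_pop[of p r "S j"] j by (auto simp: S_def)
  qed (simp add: S_def)
  moreover have "S 0 = s" by (auto simp: S_def)
  moreover have "S (length (s r)) = s(r := [])" by (auto simp: S_def)
  ultimately show ?thesis by (simp add: clear_def mult_2)
qed

text \<open>A stack can be read only by emptying it, so its entries are parked on \<open>f\<close>
  and flipped back. The copy on \<open>d\<close> comes out reversed.\<close>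

definition copy :: "nat \<Rightarrow> nat \<Rightarrow> nat \<Rightarrow> cmd" where
  "copy r d f = Seq (While r (Mv r [f, d])) (flip f r)"

lemma rb_copy:
  assumes "r \<noteq> d" "r \<noteq> f" "d \<noteq> f" "s f = []"
  shows "rb p (copy r d f) s (s(d := rev (s r) @ s d)) (3 + 6 * length (s r))"
proof -
  define S where "S j = s(r := drop j (s r), d := rev (take j (s r)) @ s d, f := rev (take j (s r)))" for j
  have "rb p (While r (Mv r [f, d])) (S 0) (S (length (s r))) (Suc (\<Sum>j<length (s r). Suc 2))"
  proof (rule rb_While)
    fix j assume j: "j < length (s r)"
    then have d: "drop j (s r) = s r ! j # drop (Suc j) (s r)" by (simp add: Cons_nth_drop_Suc)
    then have "S j r = s r ! j # drop (Suc j) (s r)" using assms by (simp add: S_def)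
    from runs_Mv[of "S j", OF this, of "[f, d]"] assms
    have "runs (Mv r [f, d]) (S j) (\<lambda>i. if i = r then drop (Suc j) (s r)
        else if i \<in> set [f, d] then s r ! j # S j i else S j i) 2" by simp
    also have "(\<lambda>i. if i = r then drop (Suc j) (s r)
        else if i \<in> set [f, d] then s r ! j # S j i else S j i) = S (Suc j)"
      using assms j by (auto simp: S_def take_Suc_conv_app_nth)
    finally have "rb p (Mv r [f, d]) (S j) (S (Suc j)) 2" unfolding rb_def by blast
    then show "S j r \<noteq> [] \<and> rb p (Mv r [f, d]) (S j) (S (Suc j)) 2"
      using assms j by (simp add: S_def)
  qed (use assms in \<open>simp add: S_def\<close>)
  moreover have "S 0 = s" using assms by (auto simp: S_def)
  moreover define s1 where "s1 = S (length (s r))"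
  ultimately have 1: "rb p (While r (Mv r [f, d])) s s1 (Suc (3 * length (s r)))"
    by (simp add: mult.commute)
  have s1: "s1 f = rev (s r)" "s1 r = []" using assms by (auto simp: s1_def S_def)
  have 2: "rb p (flip f r) s1 (s1(f := [], r := rev (s1 f) @ s1 r)) (Suc (3 * length (s r)))"
    using rb_flip[of f r p s1] assms s1 by simp
  have "s1(f := [], r := rev (s1 f) @ s1 r) = s(d := rev (s r) @ s d)"
    using assms s1 by (auto simp: s1_def S_def)
  with rb_Seq[OF 1 2] show ?thesis unfolding copy_def by (rule_tac rb_weaken) auto
qed

text \<open>Calling convention: the variables lie on the stacks \<open>rs\<close>, all stacks from
  \<open>f\<close> on are empty before and after, and the value is pushed on \<open>out\<close>
  entry by entry, hence reversed. Under this convention \<open>Cat\<close> is mere sequential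
  execution.\<close>

primrec compile :: "ex \<Rightarrow> nat list \<Rightarrow> nat \<Rightarrow> nat \<Rightarrow> cmd" where
  "compile (Var i) = (\<lambda>rs out f. if i < length rs then copy (rs ! i) out f else Mv f [])"
| "compile Nl = (\<lambda>rs out f. Mv f [])"
| "compile (Sym a) = (\<lambda>rs out f. Push out a)"
| "compile (Cat d e) = (\<lambda>rs out f. Seq (compile d rs out f) (compile e rs out f))"
| "compile (Drop d e) = (\<lambda>rs out f.
     Seq (compile d rs f (f + 3)) (Seq (compile e rs (f + 1) (f + 3)) (Seq (flip (f + 1) (f + 2))
       (Seq (While f (Seq (Mv f []) (Mv (f + 2) []))) (flip (f + 2) out)))))"
| "compile (Cond a c d e) = (\<lambda>rs out f.
     Seq (compile c rs f (f + 1)) (Seq (flip f (f + 1))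
       (Seq (Test (f + 1) a (compile d rs out (f + 2)) (compile e rs out (f + 2))) (clear (f + 1)))))"
| "compile (Loop d e) = (\<lambda>rs out f.
     Seq (compile d rs f (f + 1))
       (Seq (While f (Seq (Mv f []) (Seq (compile e (rs @ [f + 1]) out (f + 2)) (Push (f + 1) 0))))
         (clear (f + 1))))"
| "compile (Iter d ins ss e) = (\<lambda>rs out f. let m = length ins; vs = [f + 1..<f + 1 + m]; g = f + 1 + 2 * m;
       flips = seqs g (map (\<lambda>j. flip (f + 1 + m + j) (f + 1 + j)) [0..<m]);
       clears = seqs g (map (\<lambda>j. clear (f + 1 + j)) [0..<m]) in
     Seq (compile d rs f (f + 1)) (Seq
       (seqs g (map (\<lambda>j. (map compile ins ! j) rs (f + 1 + m + j) g) [0..<m])) (Seq flips (Seq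
       (While f (Seq (Mv f []) (Seq
          (seqs g (map (\<lambda>j. (map compile ss ! j) (rs @ vs) (f + 1 + m + j) g) [0..<m]))
          (Seq clears flips))))
       (Seq (compile e (rs @ vs) out g) clears)))))"
| "compile (Call e es) = (\<lambda>rs out f. let m = length es; vs = [f..<f + m]; g = f + 2 * m in
     Seq (seqs g (map (\<lambda>j. (map compile es ! j) rs (f + m + j) g) [0..<m]))
      (Seq (seqs g (map (\<lambda>j. flip (f + m + j) (f + j)) [0..<m]))
      (Seq (compile e vs out g) (seqs g (map (\<lambda>j. clear (f + j)) [0..<m])))))"

section \<open>Blocks of consecutive stacks\<close>

definition put :: "store \<Rightarrow> nat \<Rightarrow> nat list list \<Rightarrow> store" where
  "put s b vs = (\<lambda>i. if b \<le> i \<and> i < b + length vs then vs ! (i - b) else s i)"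

lemma map_put: "length vs = m \<Longrightarrow> map (put s b vs) [b..<b + m] = vs"
  by (rule nth_equalityI) (simp_all add: put_def)

lemma rb_block:
  assumes "\<And>j. j < m \<Longrightarrow>
      rb p (c j) (put s b (map w [0..<j])) ((put s b (map w [0..<j]))(b + j := w j)) (t j)"
    and "s f = []" "b + m \<le> f"
  shows "rb p (seqs f (map c [0..<m])) s (put s b (map w [0..<m])) (Suc (\<Sum>j<m. Suc (t j)))"
proof -
  define S where "S j = put s b (map w [0..<j])" for j
  have "rb p (seqs f (map c [0..<m])) (S 0) (S (length (map c [0..<m])))
          (Suc (\<Sum>j<length (map c [0..<m]). Suc (t j)))"
  proof (rule rb_seqs)
    fix j assume j: "j < length (map c [0..<m])"
    have "(S j)(b + j := w j) = S (Suc j)"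
      by (auto simp: S_def put_def fun_eq_iff simp del: upt_Suc)
    then show "rb p (map c [0..<m] ! j) (S j) (S (Suc j)) (t j)"
      using assms(1)[of j] j by (simp add: S_def)
  qed (use assms in \<open>simp add: S_def put_def\<close>)
  moreover have "S 0 = s" by (auto simp: S_def put_def fun_eq_iff)
  ultimately show ?thesis by (simp add: S_def)
qed

lemma rb_clears:
  assumes "s f = []" "b + m \<le> f"
  shows "rb p (seqs f (map (\<lambda>j. clear (b + j)) [0..<m])) s (put s b (replicate m []))
           (Suc (\<Sum>j<m. Suc (Suc (2 * length (s (b + j))))))"
proof -
  have "rb p (seqs f (map (\<lambda>j. clear (b + j)) [0..<m])) s (put s b (map (\<lambda>_. []) [0..<m]))
           (Suc (\<Sum>j<m. Suc (Suc (2 * length (s (b + j))))))"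
  proof (rule rb_block)
    fix j assume "j < m"
    show "rb p (clear (b + j)) (put s b (map (\<lambda>_. []) [0..<j]))
      ((put s b (map (\<lambda>_. []) [0..<j]))(b + j := [])) (Suc (2 * length (s (b + j))))"
      using rb_clear[of p "b + j" "put s b (map (\<lambda>_. []) [0..<j])"] by (simp add: put_def)
  qed (use assms in auto)
  then show ?thesis by (simp add: map_replicate_const)
qed

lemma rb_flips:
  assumes "s f = []" "b + 2 * m \<le> f" "\<And>j. j < m \<Longrightarrow> s (b + j) = []"
  shows "rb p (seqs f (map (\<lambda>j. flip (b + m + j) (b + j)) [0..<m])) s
      (put s b (map (\<lambda>j. rev (s (b + m + j))) [0..<m] @ replicate m []))
           (Suc (\<Sum>j<m. Suc (Suc (3 * length (s (b + m + j))))))"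
proof -
  define S where "S j = (\<lambda>i. if b \<le> i \<and> i < b + j then rev (s (m + i))
      else if b + m \<le> i \<and> i < b + m + j then [] else s i)" for j
  let ?cs = "map (\<lambda>j. flip (b + m + j) (b + j)) [0..<m]"
  have "rb p (seqs f ?cs) (S 0) (S (length ?cs))
          (Suc (\<Sum>j<length ?cs. Suc (Suc (3 * length (s (b + m + j))))))"
  proof (rule rb_seqs)
    fix j assume j: "j < length ?cs"
    have "(S j)(b + m + j := [], b + j := rev (S j (b + m + j)) @ S j (b + j)) = S (Suc j)"
      using j assms(3)[of j] by (auto simp: S_def fun_eq_iff less_Suc_eq add_ac)
    moreover have "S j (b + m + j) = s (b + m + j)" using j by (simp add: S_def)
    ultimately show "rb p (?cs ! j) (S j) (S (Suc j)) (Suc (3 * length (s (b + m + j))))"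
      using rb_flip[of "b + m + j" "b + j" p "S j"] j by simp
  qed (use assms in \<open>simp add: S_def\<close>)
  moreover have "S 0 = s" by (auto simp: S_def fun_eq_iff)
  moreover have "S m = put s b (map (\<lambda>j. rev (s (b + m + j))) [0..<m] @ replicate m [])"
    by (auto simp: S_def put_def fun_eq_iff nth_append add_ac)
  ultimately show ?thesis by simp
qed

text \<open>Bounds are claimed only under \<open>poly_ex\<close>, which excludes
  \<open>Iter\<close>; hence the value 0 there. \<open>Cond\<close> charges both branches.\<close>

primrec cost :: "ex \<Rightarrow> nat list list \<Rightarrow> nat" where
  "cost (Var i) = (\<lambda>env. 3 + 6 * length (eval (Var i) env))"
| "cost Nl = (\<lambda>env. 1)"
| "cost (Sym a) = (\<lambda>env. 2)"
| "cost (Cat d e) = (\<lambda>env. Suc (cost d env + cost e env))"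
| "cost (Drop d e) = (\<lambda>env.
     cost d env + cost e env + 10 + 4 * length (eval d env) + 6 * length (eval e env))"
| "cost (Cond a c d e) = (\<lambda>env.
     cost c env + cost d env + cost e env + 10 + 5 * length (eval c env))"
| "cost (Loop d e) = (\<lambda>env. cost d env + 4 + 2 * length (eval d env) +
     (\<Sum>j<length (eval d env). cost e (env @ [un j]) + 6))"
| "cost (Iter d ins ss e) = (\<lambda>env. 0)"
| "cost (Call e es) = (\<lambda>env. 7 + cost e (map (\<lambda>g. g env) (map eval es)) +
     (\<Sum>j<length es. (map cost es ! j) env + 6 + 5 * length ((map eval es ! j) env)))"

definition fits :: "store \<Rightarrow> nat list \<Rightarrow> nat list list \<Rightarrow> nat \<Rightarrow> nat \<Rightarrow> bool" where
  "fits s rs env out f \<longleftrightarrow> map s rs = env \<and> (\<forall>r\<in>set rs. r < f) \<and> (\<forall>i\<ge>f. s i = []) \<and> out < f \<and> out \<notin> set rs"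

lemma fits_mono:
  assumes "fits s rs env out f" "\<And>r. r \<in> set rs \<Longrightarrow> s' r = s r" "f \<le> f'" "\<And>i. f' \<le> i \<Longrightarrow> s' i = []"
    "out' < f'" "out' \<notin> set rs"
  shows "fits s' rs env out' f'"
  using assms unfolding fits_def by auto

text \<open>The flag \<open>p\<close> lets one induction serve both correctness and running time:
  where it is false, bounds may be replaced at will, and the case of \<open>Iter\<close> proceeds
  without accounting.\<close>

lemma compile_correct:
  assumes "wf_ex e" "p \<longrightarrow> poly_ex e" "fits s rs env out f"
  shows "rb p (compile e rs out f) s (s(out := rev (eval e env) @ s out)) (cost e env)"
  using assms
proof (induction e arbitrary: s rs env out f)
  case (Var i)
  then have *: "f \<notin> set rs" "out \<noteq> f" "s f = []" "length rs = length env" by (auto simp: fits_def)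
  show ?case
  proof (cases "i < length rs")
    case True
    then have "rs ! i \<in> set rs" by simp
    then have "rb p (copy (rs ! i) out f) s (s(out := rev (s (rs ! i)) @ s out)) (3 + 6 * length (s (rs ! i)))"
      using Var * by (intro rb_copy) (auto simp: fits_def)
    moreover have "s (rs ! i) = env ! i" using Var True by (auto simp: fits_def)
    ultimately show ?thesis using True * by (simp add: fun_upd_def)
  next
    case False
    then show ?thesis using * rb_pop[of p f s] by (auto simp: fun_upd_idem intro: rb_weaken)
  qed
next
  case Nl
  then show ?case using rb_pop[of p f s] by (simp add: fun_upd_idem fits_def)
next
  case (Sym a)
  then show ?case using rb_Push[of p out a s] by (simp add: fun_upd_def)
next
  case (Cat d e)
  have IH1: "rb p (compile d rs out f) s (s(out := rev (eval d env) @ s out)) (cost d env)"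
    if "fits s rs env out f" for s rs env out f
    by (rule Cat.IH(1)) (use Cat.prems that in auto)
  have IH2: "rb p (compile e rs out f) s (s(out := rev (eval e env) @ s out)) (cost e env)"
    if "fits s rs env out f" for s rs env out f
    by (rule Cat.IH(2)) (use Cat.prems that in auto)
  let ?s = "s(out := rev (eval d env) @ s out)"
  have "rb p (compile d rs out f) s ?s (cost d env)" using IH1 Cat.prems(3) by blast
  moreover have "fits ?s rs env out f"
    using Cat.prems(3) by (rule fits_mono) (use Cat.prems(3) in \<open>auto simp: fits_def\<close>)
  then have "rb p (compile e rs out f) ?s (?s(out := rev (eval e env) @ ?s out)) (cost e env)"
    by (rule IH2)
  moreover have "?s(out := rev (eval e env) @ ?s out) = s(out := rev (eval (Cat d e) env) @ s out)" by simp
  ultimately show ?case using rb_Seq by (simp add: fun_upd_def)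
next
  case (Drop d e)
  note fit = Drop.prems(3)
  have IH1: "rb p (compile d rs out f) s (s(out := rev (eval d env) @ s out)) (cost d env)"
    if "fits s rs env out f" for s rs env out f
    by (rule Drop.IH(1)) (use Drop.prems that in auto)
  have IH2: "rb p (compile e rs out f) s (s(out := rev (eval e env) @ s out)) (cost e env)"
    if "fits s rs env out f" for s rs env out f
    by (rule Drop.IH(2)) (use Drop.prems that in auto)
  have fr: "f \<le> i \<Longrightarrow> s i = []" "r \<in> set rs \<Longrightarrow> r < f" "out < f" "out \<notin> set rs" for i r
    using fit by (auto simp: fits_def)
  let ?a = "eval d env" let ?b = "eval e env"
  let ?s1 = "s(f := rev ?a)"
  let ?s2 = "?s1(f + 1 := rev ?b)"
  let ?s3 = "?s2(f + 1 := [], f + 2 := ?b)"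
  let ?s4 = "?s3(f := [], f + 2 := drop (length ?a) ?b)"
  let ?s5 = "?s4(f + 2 := [], out := rev (drop (length ?a) ?b) @ s out)"
  have "fits s rs env f (f + 3)" by (rule fits_mono[OF fit]) (use fr in fastforce)+
  from IH1[OF this] have 1: "rb p (compile d rs f (f + 3)) s ?s1 (cost d env)" using fr(1)[of f] by simp
  have "fits ?s1 rs env (f + 1) (f + 3)" by (rule fits_mono[OF fit]) (use fr in fastforce)+
  from IH2[OF this] have 2: "rb p (compile e rs (f + 1) (f + 3)) ?s1 ?s2 (cost e env)" using fr(1)[of "f + 1"] by simp
  have 3: "rb p (flip (f + 1) (f + 2)) ?s2 ?s3 (Suc (3 * length ?b))"
    using rb_flip[of "f + 1" "f + 2" p ?s2] fr(1) by simp
  \<comment> \<open>Only the length of the value of \<open>d\<close> matters here: it counts the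
    entries to be dropped.\<close>
  have 4: "rb p (While f (Seq (Mv f []) (Mv (f + 2) []))) ?s3 ?s4 (Suc (\<Sum>j<length ?a. Suc 3))"
  proof -
    define S where "S j = ?s3(f := drop j (rev ?a), f + 2 := drop j ?b)" for j
    have "rb p (While f (Seq (Mv f []) (Mv (f + 2) []))) (S 0) (S (length ?a)) (Suc (\<Sum>j<length ?a. Suc 3))"
    proof (rule rb_While)
      fix j assume j: "j < length ?a"
      have eq: "(S j)(f := tl (S j f), f + 2 := tl (S j (f + 2))) = S (Suc j)"
        by (auto simp: S_def drop_Suc tl_drop)
      have "rb p (Mv (f + 2) []) ((S j)(f := tl (S j f))) (S (Suc j)) 1"
        using rb_pop[of p "f + 2" "(S j)(f := tl (S j f))"] unfolding eq[symmetric] by simp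
      from rb_Seq[OF rb_pop this] show "S j f \<noteq> [] \<and> rb p (Seq (Mv f []) (Mv (f + 2) [])) (S j) (S (Suc j)) 3"
        using j by (simp add: S_def numeral_3_eq_3)
    qed (simp add: S_def)
    moreover have "S 0 = ?s3" by (auto simp: S_def)
    moreover have "S (length ?a) = ?s4" by (auto simp: S_def)
    ultimately show ?thesis by simp
  qed
  have 5: "rb p (flip (f + 2) out) ?s4 ?s5 (Suc (3 * length (drop (length ?a) ?b)))"
    using rb_flip[of "f + 2" out p ?s4] fr(1,3) by simp
  have fin: "s(out := rev (eval (Drop d e) env) @ s out) = ?s5" using fr by (auto simp: fun_eq_iff)
  show ?case unfolding fin compile.simps
    by (rule rb_weaken[OF rb_Seq[OF 1 rb_Seq[OF 2 rb_Seq[OF 3 rb_Seq[OF 4 5]]]]]) simp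
next
  case (Cond a c d e)
  note fit = Cond.prems(3)
  have IH1: "rb p (compile c rs out f) s (s(out := rev (eval c env) @ s out)) (cost c env)"
    if "fits s rs env out f" for s rs env out f
    by (rule Cond.IH(1)) (use Cond.prems that in auto)
  have IH2: "rb p (compile d rs out f) s (s(out := rev (eval d env) @ s out)) (cost d env)"
    if "fits s rs env out f" for s rs env out f
    by (rule Cond.IH(2)) (use Cond.prems that in auto)
  have IH3: "rb p (compile e rs out f) s (s(out := rev (eval e env) @ s out)) (cost e env)"
    if "fits s rs env out f" for s rs env out f
    by (rule Cond.IH(3)) (use Cond.prems that in auto)
  have fr: "f \<le> i \<Longrightarrow> s i = []" "r \<in> set rs \<Longrightarrow> r < f" "out < f" "out \<notin> set rs" for i r
    using fit by (auto simp: fits_def)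
  let ?a = "eval c env" let ?b = "eval (Cond a c d e) env"
  let ?s1 = "s(f := rev ?a)"
  let ?s2 = "?s1(f := [], f + 1 := ?a)"
  let ?s3 = "?s2(out := rev ?b @ s out)"
  have "fits s rs env f (f + 1)" by (rule fits_mono[OF fit]) (use fr in fastforce)+
  from IH1[OF this] have 1: "rb p (compile c rs f (f + 1)) s ?s1 (cost c env)" using fr(1)[of f] by simp
  have 2: "rb p (flip f (f + 1)) ?s1 ?s2 (Suc (3 * length ?a))"
    using rb_flip[of f "f + 1" p ?s1] fr(1) by simp
  have fit2: "fits ?s2 rs env out (f + 2)" by (rule fits_mono[OF fit]) (use fr in fastforce)+
  have "rb p (compile d rs out (f + 2)) ?s2 (?s2(out := rev (eval d env) @ ?s2 out)) (cost d env)"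
    "rb p (compile e rs out (f + 2)) ?s2 (?s2(out := rev (eval e env) @ ?s2 out)) (cost e env)"
    by (rule IH2[OF fit2], rule IH3[OF fit2])
  then have "rb p (if ?s2 (f + 1) \<noteq> [] \<and> hd (?s2 (f + 1)) = a then compile d rs out (f + 2) else compile e rs out (f + 2))
     ?s2 ?s3 (cost d env + cost e env)"
    using fr(3) by (auto intro: rb_weaken)
  from rb_Test[OF this] have 3: "rb p (Test (f + 1) a (compile d rs out (f + 2)) (compile e rs out (f + 2)))
     ?s2 ?s3 (Suc (cost d env + cost e env))" .
  have 4: "rb p (clear (f + 1)) ?s3 (?s3(f + 1 := [])) (Suc (2 * length ?a))"
    using rb_clear[of p "f + 1" ?s3] fr(3) by simp
  have fin: "s(out := rev ?b @ s out) = ?s3(f + 1 := [])" using fr by (auto simp: fun_eq_iff)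
  show ?case unfolding fin compile.simps
    by (rule rb_weaken[OF rb_Seq[OF 1 rb_Seq[OF 2 rb_Seq[OF 3 4]]]]) simp
next
  case (Loop d e)
  note fit = Loop.prems(3)
  have IH1: "rb p (compile d rs out f) s (s(out := rev (eval d env) @ s out)) (cost d env)"
    if "fits s rs env out f" for s rs env out f
    by (rule Loop.IH(1)) (use Loop.prems that in auto)
  have IH2: "rb p (compile e rs out f) s (s(out := rev (eval e env) @ s out)) (cost e env)"
    if "fits s rs env out f" for s rs env out f
    by (rule Loop.IH(2)) (use Loop.prems that in auto)
  have fr: "f \<le> i \<Longrightarrow> s i = []" "r \<in> set rs \<Longrightarrow> r < f" "out < f" "out \<notin> set rs" for i r
    using fit by (auto simp: fits_def)
  let ?a = "eval d env"
  define S where "S j = s(f := drop j (rev ?a), f + 1 := un j,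
     out := rev (concat (map (\<lambda>j. eval e (env @ [un j])) [0..<j])) @ s out)" for j
  have "fits s rs env f (f + 1)" by (rule fits_mono[OF fit]) (use fr in fastforce)+
  from IH1[OF this] have "rb p (compile d rs f (f + 1)) s (s(f := rev ?a @ s f)) (cost d env)" .
  moreover have "s(f := rev ?a @ s f) = S 0" using fr by (auto simp: S_def fun_eq_iff)
  ultimately have 1: "rb p (compile d rs f (f + 1)) s (S 0) (cost d env)" by simp
  have 2: "rb p (While f (Seq (Mv f []) (Seq (compile e (rs @ [f + 1]) out (f + 2)) (Push (f + 1) 0))))
      (S 0) (S (length ?a)) (Suc (\<Sum>j<length ?a. Suc (cost e (env @ [un j]) + 5)))"
  proof (rule rb_While)
    fix j assume j: "j < length ?a"
    let ?s1 = "(S j)(f := drop (Suc j) (rev ?a))"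
    let ?s2 = "?s1(out := rev (eval e (env @ [un j])) @ ?s1 out)"
    have 1: "rb p (Mv f []) (S j) ?s1 1"
      using rb_pop[of p f "S j"] fr(3) by (simp add: S_def drop_Suc tl_drop fun_upd_twist)
    have "f \<notin> set rs" "f + 1 \<notin> set rs" using fr(2) by fastforce+
    then have "map ?s1 rs = env" using fit fr(4) by (auto simp: S_def fits_def)
    then have "fits ?s1 (rs @ [f + 1]) (env @ [un j]) out (f + 2)"
      using fr by (fastforce simp: fits_def S_def)
    from IH2[OF this] have 2: "rb p (compile e (rs @ [f + 1]) out (f + 2)) ?s1 ?s2 (cost e (env @ [un j]))" .
    have 3: "rb p (Push (f + 1) 0) ?s2 (S (Suc j)) 2"
    proof -
      have "?s2(f + 1 := 0 # ?s2 (f + 1)) = S (Suc j)"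
        using fr(3) by (auto simp: S_def fun_eq_iff)
      then show ?thesis using rb_Push[of p "f + 1" 0 ?s2] by simp
    qed
    from rb_Seq[OF 1 rb_Seq[OF 2 3]]
    show "S j f \<noteq> [] \<and> rb p (Seq (Mv f []) (Seq (compile e (rs @ [f + 1]) out (f + 2)) (Push (f + 1) 0)))
        (S j) (S (Suc j)) (cost e (env @ [un j]) + 5)"
      using j fr(3) by (auto simp: S_def intro: rb_weaken)
  qed (use fr in \<open>simp add: S_def\<close>)
  let ?s3 = "S (length ?a)"
  have 3: "rb p (clear (f + 1)) ?s3 (?s3(f + 1 := [])) (Suc (2 * length ?a))"
    using rb_clear[of p "f + 1" ?s3] fr(3) by (simp add: S_def)
  have fin: "s(out := rev (eval (Loop d e) env) @ s out) = ?s3(f + 1 := [])"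
    using fr by (auto simp: S_def fun_eq_iff)
  show ?case unfolding fin compile.simps
    by (rule rb_weaken[OF rb_Seq[OF 1 rb_Seq[OF 2 3]]]) (simp add: sum.distrib)
next
  case (Iter d ins ss e)
  note fit = Iter.prems(3)
  have IH1: "rb p (compile d rs out f) s (s(out := rev (eval d env) @ s out)) (cost d env)"
    if "fits s rs env out f" for s rs env out f
    by (rule Iter.IH(1)) (use Iter.prems that in auto)
  have IH2: "rb p (compile e rs out f) s (s(out := rev (eval e env) @ s out)) (cost e env)"
    if "fits s rs env out f" for s rs env out f
    by (rule Iter.IH(4)) (use Iter.prems that in auto)
  have p: "\<not> p" using Iter.prems(2) by simp
  have any: "rb p c x y b \<Longrightarrow> rb p c x y b'" for c x y b b' using p by (blast intro: rb_weaken)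
  have fr: "f \<le> i \<Longrightarrow> s i = []" "r \<in> set rs \<Longrightarrow> r < f" "out < f" "out \<notin> set rs" for i r
    using fit by (auto simp: fits_def)
  define m where "m = length ins"
  define g where "g = f + 1 + 2 * m"
  define vr where "vr = [f + 1..<f + 1 + m]"
  define flips where "flips = seqs g (map (\<lambda>j. flip (f + 1 + m + j) (f + 1 + j)) [0..<m])"
  define clears where "clears = seqs g (map (\<lambda>j. clear (f + 1 + j)) [0..<m])"
  have m: "length ss = m" "length ins = m" using Iter.prems(1) by (auto simp: m_def)
  let ?a = "eval d env"
  define stp where "stp vs = map (\<lambda>e. eval e (env @ vs)) ss" for vs
  define vals where "vals k = (stp ^^ k) (map (\<lambda>e. eval e env) ins)" for k
  have len: "length (vals k) = m" for k by (cases k) (auto simp: vals_def stp_def m)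
  define T where "T k = s(f := drop k (rev ?a))" for k
  have "fits s rs env f (f + 1)" by (rule fits_mono[OF fit]) (use fr in fastforce)+
  from IH1[OF this] have "rb p (compile d rs f (f + 1)) s (s(f := rev ?a @ s f)) (cost d env)" .
  then have A: "rb p (compile d rs f (f + 1)) s (T 0) 0" using fr(1)[of f] any by (simp add: T_def)
  have block: "rb p (seqs g (map (\<lambda>j. (map compile es ! j) rs' (f + 1 + m + j) g) [0..<m])) X
      (put X (f + 1 + m) (map (\<lambda>e. rev (eval e env')) es)) 0"
    if es: "length es = m" "\<And>e s rs env out f. e \<in> set es \<Longrightarrow> fits s rs env out f \<Longrightarrow>
         rb p (compile e rs out f) s (s(out := rev (eval e env) @ s out)) (cost e env)"
      and X: "map X rs' = env'" "\<And>r. r \<in> set rs' \<Longrightarrow> r < f + 1 + m" "\<And>i. f + 1 + m \<le> i \<Longrightarrow> X i = []"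
    for es X rs' env'
  proof -
    have "rb p (seqs g (map (\<lambda>j. (map compile es ! j) rs' (f + 1 + m + j) g) [0..<m])) X
        (put X (f + 1 + m) (map (\<lambda>j. rev (eval (es ! j) env')) [0..<m])) (Suc (\<Sum>j<m. Suc 0))"
    proof (rule rb_block)
      fix j assume j: "j < m"
      let ?X = "put X (f + 1 + m) (map (\<lambda>j. rev (eval (es ! j) env')) [0..<j])"
      have "map ?X rs' = map X rs'" using X(2) by (intro map_cong) (fastforce simp: put_def)+
      then have "fits ?X rs' env' (f + 1 + m + j) g"
        using X j by (fastforce simp: fits_def g_def put_def)
      from es(2)[OF _ this, of "es ! j"] j es(1)
      have "rb p (compile (es ! j) rs' (f + 1 + m + j) g) ?X
        (?X(f + 1 + m + j := rev (eval (es ! j) env') @ ?X (f + 1 + m + j))) 0"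
        by (auto intro: any)
      moreover have "?X (f + 1 + m + j) = []" using X(3) by (simp add: put_def)
      ultimately show "rb p ((map compile es ! j) rs' (f + 1 + m + j) g) ?X
        (?X(f + 1 + m + j := rev (eval (es ! j) env'))) 0" using j es(1) by simp
    qed (use X in \<open>auto simp: g_def\<close>)
    moreover have "map (\<lambda>j. rev (eval (es ! j) env')) [0..<m] = map (\<lambda>e. rev (eval e env')) es"
      using es(1) by (intro nth_equalityI) auto
    ultimately show ?thesis using any by simp
  qed
  have flips: "rb p flips X (put Y (f + 1) vs) 0"
    if "X = put Y (f + 1 + m) (map rev vs)" "length vs = m" "\<And>i. f + 1 \<le> i \<Longrightarrow> Y i = []" for X Y vs
  proof -
    have "rb p flips X (put X (f + 1) (map (\<lambda>j. rev (X (f + 1 + m + j))) [0..<m] @ replicate m []))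
      (Suc (\<Sum>j<m. Suc (Suc (3 * length (X (f + 1 + m + j))))))"
      unfolding flips_def by (rule rb_flips) (use that in \<open>auto simp: g_def put_def\<close>)
    also have "map (\<lambda>j. rev (X (f + 1 + m + j))) [0..<m] = vs"
      using that by (intro nth_equalityI) (auto simp: put_def)
    also have "put X (f + 1) (vs @ replicate m []) = put Y (f + 1) vs"
      using that by (auto simp: put_def fun_eq_iff nth_append)
    finally show ?thesis by (rule any)
  qed
  have clears: "rb p clears X (put X (f + 1) (replicate m [])) 0" if "X g = []" for X
    unfolding clears_def by (rule any, rule rb_clears) (use that in \<open>auto simp: g_def\<close>)
  have wfl: "\<And>e. e \<in> set ins \<Longrightarrow> wf_ex e" "\<And>e. e \<in> set ss \<Longrightarrow> wf_ex e"
    using Iter.prems(1) by (auto simp: list_all_iff)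
  have IHs: "rb p (compile e rs out f) s (s(out := rev (eval e env) @ s out)) (cost e env)"
    if "e \<in> set ins \<union> set ss" "fits s rs env out f" for e s rs env out f
    using that Iter.IH(2)[OF _ _ _ that(2)] Iter.IH(3)[OF _ _ _ that(2)] p wfl by blast
  have B: "rb p (seqs g (map (\<lambda>j. (map compile ins ! j) rs (f + 1 + m + j) g) [0..<m])) (T 0)
      (put (T 0) (f + 1 + m) (map (\<lambda>e. rev (eval e env)) ins)) 0"
  proof (rule block)
    show "map (T 0) rs = env" using fit by (auto simp: fits_def T_def)
  next
    fix e s rs env out f assume "e \<in> set ins" "fits s rs env out f"
    then show "rb p (compile e rs out f) s (s(out := rev (eval e env) @ s out)) (cost e env)"
      by (intro IHs) auto
  qed (use m fr in \<open>auto simp: T_def dest: fr(2)\<close>)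
  have C: "rb p flips (put (T 0) (f + 1 + m) (map (\<lambda>e. rev (eval e env)) ins)) (put (T 0) (f + 1) (vals 0)) 0"
    by (rule flips) (use fr m in \<open>auto simp: vals_def T_def o_def\<close>)
  define S where "S k = put (T k) (f + 1) (vals k)" for k
  \<comment> \<open>The new values are computed on the upper block of \<open>m\<close> stacks while
    the old ones stay readable on the lower block, which makes the update simultaneous. Flipping
    them down also undoes the reversal.\<close>
  have D: "rb p (While f (Seq (Mv f []) (Seq
          (seqs g (map (\<lambda>j. (map compile ss ! j) (rs @ vr) (f + 1 + m + j) g) [0..<m]))
          (Seq clears flips)))) (S 0) (S (length ?a)) (Suc (\<Sum>j<length ?a. Suc 0))"
  proof (rule rb_While)
    fix k assume k: "k < length ?a"
    let ?X = "put (T (Suc k)) (f + 1) (vals k)"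
    have "(S k)(f := tl (S k f)) = ?X" by (auto simp: S_def T_def put_def fun_eq_iff drop_Suc tl_drop)
    then have 1: "rb p (Mv f []) (S k) ?X 1" using rb_pop[of p f "S k"] by simp
    let ?Y = "put ?X (f + 1 + m) (map (\<lambda>e. rev (eval e (env @ vals k))) ss)"
    have 2: "rb p (seqs g (map (\<lambda>j. (map compile ss ! j) (rs @ vr) (f + 1 + m + j) g) [0..<m])) ?X ?Y 0"
    proof (rule block)
      have "map ?X rs = map s rs" by (intro map_cong refl) (use fr in \<open>force simp: put_def T_def dest: fr(2)\<close>)
      moreover have "map ?X vr = vals k"
        unfolding vr_def by (rule map_put) (rule len)
      ultimately show "map ?X (rs @ vr) = env @ vals k"
        using fit unfolding fits_def by (elim conjE) (simp only: map_append)
    next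
      fix e s rs env out f assume "e \<in> set ss" "fits s rs env out f"
      then show "rb p (compile e rs out f) s (s(out := rev (eval e env) @ s out)) (cost e env)"
        by (intro IHs) auto
    qed (use m fr len in \<open>auto simp: T_def put_def vr_def dest: fr(2)\<close>)
    have 3: "rb p clears ?Y (put ?Y (f + 1) (replicate m [])) 0"
      by (rule clears) (use fr m len in \<open>auto simp: g_def put_def T_def\<close>)
    have 4: "rb p flips (put ?Y (f + 1) (replicate m [])) (put (T (Suc k)) (f + 1) (vals (Suc k))) 0"
    proof (rule flips)
      show "put ?Y (f + 1) (replicate m []) = put (T (Suc k)) (f + 1 + m) (map rev (vals (Suc k)))"
        using fr m len by (auto simp: put_def T_def fun_eq_iff vals_def stp_def o_def)
    qed (use fr len in \<open>auto simp: T_def\<close>)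
    have "S k f \<noteq> []" using k by (simp add: S_def put_def T_def)
    moreover from rb_Seq[OF 1 rb_Seq[OF 2 rb_Seq[OF 3 4]]]
    have "rb p (Seq (Mv f []) (Seq
          (seqs g (map (\<lambda>j. (map compile ss ! j) (rs @ vr) (f + 1 + m + j) g) [0..<m]))
          (Seq clears flips))) (S k) (S (Suc k)) 0" unfolding S_def by (rule any)
    ultimately show "S k f \<noteq> [] \<and> rb p (Seq (Mv f []) (Seq
          (seqs g (map (\<lambda>j. (map compile ss ! j) (rs @ vr) (f + 1 + m + j) g) [0..<m]))
          (Seq clears flips))) (S k) (S (Suc k)) 0" by blast
  qed (simp add: S_def put_def T_def)
  let ?X = "S (length ?a)" and ?v = "vals (length ?a)"
  let ?Y = "?X(out := rev (eval e (env @ ?v)) @ s out)"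
  have E: "rb p (compile e (rs @ vr) out g) ?X ?Y 0"
  proof -
    have "map ?X rs = map s rs" by (intro map_cong refl) (use fr in \<open>force simp: S_def put_def T_def dest: fr(2)\<close>)
    moreover have "map ?X vr = ?v"
      unfolding vr_def S_def by (rule map_put) (rule len)
    ultimately have "map ?X (rs @ vr) = env @ ?v"
      using fit unfolding fits_def by (elim conjE) (simp only: map_append)
    then have "fits ?X (rs @ vr) (env @ ?v) out g"
      using fr len by (fastforce simp: fits_def g_def vr_def S_def put_def T_def dest: fr(2))
    from IH2[OF this] have "rb p (compile e (rs @ vr) out g) ?X (?X(out := rev (eval e (env @ ?v)) @ ?X out)) (cost e (env @ ?v))" .
    moreover have "?X out = s out" using fr(3) by (simp add: S_def put_def T_def)
    ultimately show ?thesis using any by simp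
  qed
  have F: "rb p clears ?Y (put ?Y (f + 1) (replicate m [])) 0"
    by (rule clears) (use fr len in \<open>auto simp: g_def S_def put_def T_def\<close>)
  have ev: "eval (Iter d ins ss e) env = eval e (env @ ?v)"
    by (simp add: vals_def stp_def[abs_def] o_def)
  have "put ?Y (f + 1) (replicate m []) = s(out := rev (eval (Iter d ins ss e) env) @ s out)"
    unfolding ev using fr len by (auto simp: S_def put_def T_def fun_eq_iff)
  with rb_Seq[OF A rb_Seq[OF B rb_Seq[OF C[folded S_def] rb_Seq[OF D rb_Seq[OF E F]]]]]
  show ?case
    by (simp only: compile.simps Let_def m_def[symmetric] g_def[symmetric] vr_def[symmetric]
        flips_def[symmetric] clears_def[symmetric]) (erule any)
next
  case (Call e es)
  note fit = Call.prems(3)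
  have fr: "f \<le> i \<Longrightarrow> s i = []" "r \<in> set rs \<Longrightarrow> r < f" "out < f" "out \<notin> set rs" for i r
    using fit by (auto simp: fits_def)
  define m where "m = length es"
  define g where "g = f + 2 * m"
  define vs where "vs = map (\<lambda>e. eval e env) es"
  have vs: "length vs = m" "\<And>j. j < m \<Longrightarrow> vs ! j = eval (es ! j) env" by (simp_all add: vs_def m_def)
  have IH: "rb p (compile (es ! j) rs out f) s (s(out := rev (eval (es ! j) env) @ s out)) (cost (es ! j) env)"
    if "j < m" "fits s rs env out f" for j s rs env out f
    by (rule Call.IH(2)[OF _ _ _ that(2)]) (use that(1) Call.prems(1,2) in \<open>auto simp: list_all_iff m_def\<close>)
  let ?s1 = "put s (f + m) (map (\<lambda>j. rev (vs ! j)) [0..<m])"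
  have 1: "rb p (seqs g (map (\<lambda>j. (map compile es ! j) rs (f + m + j) g) [0..<m])) s ?s1
      (Suc (\<Sum>j<m. Suc (cost (es ! j) env)))"
  proof (rule rb_block)
    fix j assume j: "j < m"
    let ?X = "put s (f + m) (map (\<lambda>j. rev (vs ! j)) [0..<j])"
    have "map ?X rs = map s rs" by (intro map_cong refl) (use fr in \<open>force simp: put_def dest: fr(2)\<close>)
    then have "fits ?X rs env (f + m + j) g"
      using fit j by (fastforce simp: fits_def g_def put_def)
    from IH[OF j this] have "rb p (compile (es ! j) rs (f + m + j) g) ?X
        (?X(f + m + j := rev (eval (es ! j) env) @ ?X (f + m + j))) (cost (es ! j) env)" .
    moreover have "?X (f + m + j) = []" using fr(1) by (simp add: put_def)
    ultimately show "rb p ((map compile es ! j) rs (f + m + j) g) ?X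
        (?X(f + m + j := rev (vs ! j))) (cost (es ! j) env)" using j vs by (simp add: m_def)
  qed (use fr in \<open>auto simp: g_def\<close>)
  let ?s2 = "put s f vs"
  have 2: "rb p (seqs g (map (\<lambda>j. flip (f + m + j) (f + j)) [0..<m])) ?s1 ?s2
      (Suc (\<Sum>j<m. Suc (Suc (3 * length (vs ! j)))))"
  proof -
    have "rb p (seqs g (map (\<lambda>j. flip (f + m + j) (f + j)) [0..<m])) ?s1
        (put ?s1 f (map (\<lambda>j. rev (?s1 (f + m + j))) [0..<m] @ replicate m []))
        (Suc (\<Sum>j<m. Suc (Suc (3 * length (?s1 (f + m + j))))))"
      by (rule rb_flips) (use fr in \<open>auto simp: g_def put_def\<close>)
    also have "(\<Sum>j<m. Suc (Suc (3 * length (?s1 (f + m + j))))) = (\<Sum>j<m. Suc (Suc (3 * length (vs ! j))))"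
      by (intro sum.cong) (auto simp: put_def)
    also have "map (\<lambda>j. rev (?s1 (f + m + j))) [0..<m] = vs"
      using vs by (intro nth_equalityI[where ys = vs]) (auto simp: put_def)
    also have "put ?s1 f (vs @ replicate m []) = ?s2"
      using vs fr by (auto simp: put_def fun_eq_iff nth_append)
    finally show ?thesis .
  qed
  let ?s3 = "?s2(out := rev (eval e vs) @ s out)"
  have 3: "rb p (compile e [f..<f + m] out g) ?s2 ?s3 (cost e vs)"
  proof -
    have "map ?s2 [f..<f + m] = vs" using vs(1) by (rule map_put)
    then have "fits ?s2 [f..<f + m] vs out g" using fr vs by (auto simp: fits_def g_def put_def)
    then have "rb p (compile e [f..<f + m] out g) ?s2 (?s2(out := rev (eval e vs) @ ?s2 out)) (cost e vs)"
      by (intro Call.IH(1)) (use Call.prems in auto)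
    moreover have "?s2 out = s out" using fr(3) by (simp add: put_def)
    ultimately show ?thesis by simp
  qed
  have 4: "rb p (seqs g (map (\<lambda>j. clear (f + j)) [0..<m])) ?s3 (put ?s3 f (replicate m []))
      (Suc (\<Sum>j<m. Suc (Suc (2 * length (vs ! j)))))"
  proof -
    have "rb p (seqs g (map (\<lambda>j. clear (f + j)) [0..<m])) ?s3 (put ?s3 f (replicate m []))
      (Suc (\<Sum>j<m. Suc (Suc (2 * length (?s3 (f + j))))))"
      by (rule rb_clears) (use fr vs in \<open>auto simp: g_def put_def\<close>)
    also have "(\<Sum>j<m. Suc (Suc (2 * length (?s3 (f + j))))) = (\<Sum>j<m. Suc (Suc (2 * length (vs ! j))))"
      using fr(3) vs by (intro sum.cong) (auto simp: put_def)
    finally show ?thesis .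
  qed
  have ev: "eval (Call e es) env = eval e vs" by (simp add: vs_def o_def)
  have fin: "put ?s3 f (replicate m []) = s(out := rev (eval (Call e es) env) @ s out)"
    unfolding ev using fr vs by (auto simp: put_def fun_eq_iff)
  have "cost (Call e es) env = 7 + cost e vs + (\<Sum>j<m. cost (es ! j) env + 6 + 5 * length (vs ! j))"
    using vs by (auto simp: vs_def[symmetric] o_def m_def intro!: sum.cong)
  with rb_Seq[OF 1 rb_Seq[OF 2 rb_Seq[OF 3 4]]] fin show ?case
    by (simp only: compile.simps Let_def m_def[symmetric] g_def[symmetric])
      (erule rb_weaken, simp add: sum.distrib sum_distrib_left[symmetric] sum_Suc)
qed


section \<open>From expressions to machines, decidability and polynomial time\<close>

lemma ok_cmd_ex: "\<exists>N. \<forall>k\<ge>N. \<forall>A\<ge>N. ok_cmd k A c"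
proof (induction c)
  case (Push r a)
  then show ?case by (intro exI[of _ "Suc (max r a)"]) auto
next
  case (Mv r ds)
  have "x \<in> set ds \<Longrightarrow> x \<le> sum_list ds" for x using member_le_sum_list by blast
  then show ?case by (intro exI[of _ "Suc (r + length ds + sum_list ds)"]) fastforce
next
  case (Seq c d)
  then obtain N N' where "\<forall>k\<ge>N. \<forall>A\<ge>N. ok_cmd k A c" "\<forall>k\<ge>N'. \<forall>A\<ge>N'. ok_cmd k A d" by blast
  then show ?case by (intro exI[of _ "max N N'"]) auto
next
  case (Test r a c d)
  then obtain N N' where "\<forall>k\<ge>N. \<forall>A\<ge>N. ok_cmd k A c" "\<forall>k\<ge>N'. \<forall>A\<ge>N'. ok_cmd k A d" by blast
  then show ?case by (intro exI[of _ "max (Suc r) (max N N')"]) auto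
next
  case (While r c)
  then obtain N where "\<forall>k\<ge>N. \<forall>A\<ge>N. ok_cmd k A c" by blast
  then show ?case by (intro exI[of _ "max (Suc r) N"]) auto
qed

lemma ex_tm:
  assumes "wf_ex e"
  obtains M where "wf_tm M"
    "\<And>x y. eval e [map bit x] = map bit y \<Longrightarrow> \<exists>t. halts_with M [x] y t \<and>
       (poly_ex e \<longrightarrow> t \<le> cost e [map bit x] + 5 + 2 * length x + 3 * length y)"
proof -
  \<comment> \<open>The final flip returns the result to the first tape and undoes its
    reversal.\<close>
  let ?c = "Seq (compile e [0] 1 2) (Seq (clear 0) (flip 1 0))"
  obtain N where N: "\<forall>k\<ge>N. \<forall>A\<ge>N. ok_cmd k A ?c" using ok_cmd_ex by blast
  obtain M where M: "wf_tm M" "\<And>xs s t y. length xs \<le> N + 2 \<Longrightarrow> runs ?c (input xs) s t \<Longrightarrow>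
      s 0 = map bit y \<Longrightarrow> halts_with M xs y t"
    using cmd_tm[of "N + 2" "N + 2" ?c] N by (metis add_2_eq_Suc' le_add1 le_add2 zero_less_Suc)
  have "\<exists>t. halts_with M [x] y t \<and> (poly_ex e \<longrightarrow> t \<le> cost e [map bit x] + 5 + 2 * length x + 3 * length y)"
    if y: "eval e [map bit x] = map bit y" for x y
  proof -
    let ?s = "input [x]" and ?p = "poly_ex e"
    let ?s1 = "?s(1 := rev (map bit y))"
    have "fits ?s [0] [map bit x] 1 2" by (auto simp: fits_def input_def)
    from compile_correct[OF assms _ this, of ?p] y
    have 1: "rb ?p (compile e [0] 1 2) ?s ?s1 (cost e [map bit x])" by (simp add: input_def)
    have 2: "rb ?p (clear 0) ?s1 (?s1(0 := [])) (Suc (2 * length x))"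
      using rb_clear[of ?p 0 ?s1] by (simp add: input_def)
    let ?s2 = "?s1(0 := [])"
    have 3: "rb ?p (flip 1 0) ?s2 (?s2(1 := [], 0 := map bit y)) (Suc (3 * length y))"
      using rb_flip[of 1 0 ?p ?s2] by (simp add: rev_map)
    from rb_Seq[OF 1 rb_Seq[OF 2 3]] obtain t where
      "runs ?c ?s (?s2(1 := [], 0 := map bit y)) t"
      "?p \<longrightarrow> t \<le> Suc (cost e [map bit x] + Suc (Suc (2 * length x) + Suc (3 * length y)))"
      unfolding rb_def by blast
    then show ?thesis using M(2)[of "[x]" _ t y] by (intro exI[of _ t]) auto
  qed
  then show thesis using that M(1) by blast
qed

lemma ex_decidable:
  assumes "wf_ex e" "\<And>x. x \<in> fst P \<Longrightarrow> eval e [map bit x] = [1]" "\<And>x. x \<in> snd P \<Longrightarrow> eval e [map bit x] = [0]"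
  shows "decidable P"
proof -
  obtain M where M: "wf_tm M" "\<And>x y. eval e [map bit x] = map bit y \<Longrightarrow> \<exists>t. halts_with M [x] y t \<and>
       (poly_ex e \<longrightarrow> t \<le> cost e [map bit x] + 5 + 2 * length x + 3 * length y)"
    using ex_tm[OF assms(1)] by metis
  have "x \<in> fst P \<Longrightarrow> \<exists>n. halts_with M [x] [True] n" "x \<in> snd P \<Longrightarrow> \<exists>n. halts_with M [x] [False] n" for x
    using M(2)[of x "[True]"] M(2)[of x "[False]"] assms(2,3) by (auto simp: bit_def)
  then show ?thesis unfolding decidable_def using M(1) by blast
qed

lemma poly_nat_mono: "n \<le> m \<Longrightarrow> poly (q :: nat poly) n \<le> poly q m"
  by (induction q) (auto intro!: add_mono mult_mono)

lemma poly_bound_list: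
  assumes "\<And>e. e \<in> set es \<Longrightarrow> \<exists>q :: nat poly. \<forall>x. P x \<longrightarrow> (g e x :: nat) \<le> poly q (N x) \<and> h e x \<le> poly q (N x)"
  shows "\<exists>q. \<forall>x. P x \<longrightarrow> (\<forall>e\<in>set es. g e x \<le> poly q (N x) \<and> h e x \<le> poly q (N x))"
  using assms
proof (induction es)
  case (Cons e es)
  then obtain q q' where "\<forall>x. P x \<longrightarrow> g e x \<le> poly q (N x) \<and> h e x \<le> poly q (N x)"
    "\<forall>x. P x \<longrightarrow> (\<forall>e\<in>set es. g e x \<le> poly q' (N x) \<and> h e x \<le> poly q' (N x))" by (metis list.set_intros)
  then show ?case by (intro exI[of _ "q + q'"]) (auto intro: trans_le_add1 trans_le_add2)
qed auto

text \<open>The bound depends only on the maximal length of the variables, not on their number or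
  contents. The pair packs environment and length into one argument, to suit
  \<open>poly_bound_list\<close>.\<close>

lemma poly_cost:
  assumes "poly_ex e"
  shows "\<exists>q. \<forall>x. (\<forall>v\<in>set (fst x). length v \<le> snd x) \<longrightarrow>
           length (eval e (fst x)) \<le> poly q (snd x) \<and> cost e (fst x) \<le> poly q (snd x)"
  using assms
proof (induction e)
  case (Var i)
  show ?case
  proof (intro exI[of _ "[:3, 6:]"] allI impI)
    fix x :: "nat list list \<times> nat" assume "\<forall>v\<in>set (fst x). length v \<le> snd x"
    then have "length (eval (Var i) (fst x)) \<le> snd x" by auto
    then show "length (eval (Var i) (fst x)) \<le> poly [:3, 6:] (snd x) \<and> cost (Var i) (fst x) \<le> poly [:3, 6:] (snd x)"
      by (simp del: eval.simps)
  qed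
next
  case Nl
  show ?case by (intro exI[of _ 1]) auto
next
  case (Sym a)
  show ?case by (intro exI[of _ "[:2:]"]) auto
next
  case (Cat d e)
  then obtain q q' where q: "\<forall>x. (\<forall>v\<in>set (fst x). length v \<le> snd x) \<longrightarrow>
      length (eval d (fst x)) \<le> poly q (snd x) \<and> cost d (fst x) \<le> poly q (snd x)"
    "\<forall>x. (\<forall>v\<in>set (fst x). length v \<le> snd x) \<longrightarrow>
      length (eval e (fst x)) \<le> poly q' (snd x) \<and> cost e (fst x) \<le> poly q' (snd x)" by auto
  show ?case by (intro exI[of _ "q + q' + 1"]) (use q in \<open>auto intro!: add_mono le_SucI\<close>)
next
  case (Drop d e)
  then obtain q q' where q: "\<forall>x. (\<forall>v\<in>set (fst x). length v \<le> snd x) \<longrightarrow>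
      length (eval d (fst x)) \<le> poly q (snd x) \<and> cost d (fst x) \<le> poly q (snd x)"
    "\<forall>x. (\<forall>v\<in>set (fst x). length v \<le> snd x) \<longrightarrow>
      length (eval e (fst x)) \<le> poly q' (snd x) \<and> cost e (fst x) \<le> poly q' (snd x)" by auto
  show ?case
    by (intro exI[of _ "smult 5 q + smult 7 q' + [:10:]"]) (use q in fastforce)
next
  case (Cond a c d e)
  then obtain q q' q'' where q: "\<forall>x. (\<forall>v\<in>set (fst x). length v \<le> snd x) \<longrightarrow>
      length (eval c (fst x)) \<le> poly q (snd x) \<and> cost c (fst x) \<le> poly q (snd x)"
    "\<forall>x. (\<forall>v\<in>set (fst x). length v \<le> snd x) \<longrightarrow>
      length (eval d (fst x)) \<le> poly q' (snd x) \<and> cost d (fst x) \<le> poly q' (snd x)"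
    "\<forall>x. (\<forall>v\<in>set (fst x). length v \<le> snd x) \<longrightarrow>
      length (eval e (fst x)) \<le> poly q'' (snd x) \<and> cost e (fst x) \<le> poly q'' (snd x)" by auto
  show ?case
    by (intro exI[of _ "smult 6 q + q' + q'' + [:10:]"]) (use q in fastforce)
next
  case (Loop d e)
  then obtain q q' where q: "\<And>env n. (\<forall>v\<in>set env. length v \<le> n) \<Longrightarrow>
      length (eval d env) \<le> poly q n \<and> cost d env \<le> poly q n"
    "\<And>env n. (\<forall>v\<in>set env. length v \<le> n) \<Longrightarrow>
      length (eval e env) \<le> poly q' n \<and> cost e env \<le> poly q' n" by auto
  \<comment> \<open>The loop counter can be as long as \<open>poly q n\<close>, so the body sees
    variables of length at most \<open>n + poly q n\<close>.\<close>
  let ?q = "pcompose q' ([:0, 1:] + q)"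
  show ?case
  proof (intro exI[of _ "smult 3 q + 4 + q * (?q + 6)"] allI impI)
    fix x :: "nat list list \<times> nat"
    obtain env n where x: "x = (env, n)" by (cases x)
    assume "\<forall>v\<in>set (fst x). length v \<le> snd x"
    then have env: "\<forall>v\<in>set env. length v \<le> n" by (simp add: x)
    let ?l = "length (eval d env)"
    have l: "?l \<le> poly q n" "cost d env \<le> poly q n" using q(1)[OF env] by auto
    have b: "length (eval e (env @ [un j])) \<le> poly ?q n \<and> cost e (env @ [un j]) \<le> poly ?q n" if "j < ?l" for j
    proof -
      have "\<forall>v\<in>set (env @ [un j]). length v \<le> n + poly q n" using env that l by fastforce
      from q(2)[OF this] show ?thesis by (simp add: poly_pcompose)
    qed
    have "length (eval (Loop d e) env) = (\<Sum>j<?l. length (eval e (env @ [un j])))"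
      by (simp add: length_concat o_def interv_sum_list_conv_sum_set_nat lessThan_atLeast0)
    also have "\<dots> \<le> (\<Sum>j<?l. poly ?q n)" using b by (intro sum_mono) auto
    also have "\<dots> \<le> poly q n * poly ?q n" using l by (simp add: mult_right_mono)
    finally have 1: "length (eval (Loop d e) env) \<le> poly q n * poly ?q n" .
    have "(\<Sum>j<?l. cost e (env @ [un j]) + 6) \<le> (\<Sum>j<?l. poly ?q n + 6)" using b by (intro sum_mono) auto
    also have "\<dots> \<le> poly q n * (poly ?q n + 6)" using l by (simp add: mult_right_mono)
    finally have "cost (Loop d e) env \<le> 3 * poly q n + 4 + poly q n * (poly ?q n + 6)" using l by simp
    moreover have "poly q n * poly ?q n \<le> poly q n * (poly ?q n + 6)" by simp
    ultimately show "length (eval (Loop d e) (fst x)) \<le> poly (smult 3 q + 4 + q * (?q + 6)) (snd x) \<and>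
        cost (Loop d e) (fst x) \<le> poly (smult 3 q + 4 + q * (?q + 6)) (snd x)"
      using 1 unfolding x fst_conv snd_conv poly_add poly_mult poly_smult poly_numeral by linarith
  qed
next
  case (Iter d ins ss e)
  then show ?case by simp
next
  case (Call e es)
  let ?P = "\<lambda>x :: nat list list \<times> nat. \<forall>v\<in>set (fst x). length v \<le> snd x"
  obtain q where q: "\<forall>x. ?P x \<longrightarrow>
      (\<forall>e\<in>set es. length (eval e (fst x)) \<le> poly q (snd x) \<and> cost e (fst x) \<le> poly q (snd x))"
    using poly_bound_list[of es ?P "\<lambda>e x. length (eval e (fst x))" snd "\<lambda>e x. cost e (fst x)"]
      Call.IH(2) Call.prems by (auto simp: list_all_iff)
  obtain q' where q': "\<And>env n. (\<forall>v\<in>set env. length v \<le> n) \<Longrightarrow>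
      length (eval e env) \<le> poly q' n \<and> cost e env \<le> poly q' n" using Call by auto
  let ?q = "pcompose q' q"
  show ?case
  proof (intro exI[of _ "?q + 7 + of_nat (length es) * (smult 6 q + 6)"] allI impI)
    fix x :: "nat list list \<times> nat" assume P: "?P x"
    obtain env n where x: "x = (env, n)" by (cases x)
    let ?vs = "map (\<lambda>e. eval e env) es"
    have vs: "\<forall>v\<in>set ?vs. length v \<le> poly q n" using q P x by auto
    have 1: "length (eval e ?vs) \<le> poly ?q n" "cost e ?vs \<le> poly ?q n"
      using q'[OF vs] by (auto simp: poly_pcompose)
    have "(\<Sum>j<length es. (map cost es ! j) env + 6 + 5 * length ((map eval es ! j) env)) \<le>
        (\<Sum>j<length es. 6 * poly q n + 6)"
    proof (rule sum_mono)
      fix j assume "j \<in> {..<length es}"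
      then have "length (eval (es ! j) env) \<le> poly q n" "cost (es ! j) env \<le> poly q n" using q P x by auto
      with \<open>j \<in> _\<close> show "(map cost es ! j) env + 6 + 5 * length ((map eval es ! j) env) \<le> 6 * poly q n + 6" by simp
    qed
    with 1 show "length (eval (Call e es) (fst x)) \<le> poly (?q + 7 + of_nat (length es) * (smult 6 q + 6)) (snd x) \<and>
        cost (Call e es) (fst x) \<le> poly (?q + 7 + of_nat (length es) * (smult 6 q + 6)) (snd x)"
      by (simp add: x o_def)
  qed
qed

lemma ex_polytime:
  assumes "wf_ex e" "poly_ex e" "\<And>x. eval e [map bit x] = map bit (f x)"
  shows "polytime f"
proof -
  obtain M where M: "wf_tm M" "\<And>x y. eval e [map bit x] = map bit y \<Longrightarrow> \<exists>t. halts_with M [x] y t \<and>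
       (poly_ex e \<longrightarrow> t \<le> cost e [map bit x] + 5 + 2 * length x + 3 * length y)"
    using ex_tm[OF assms(1)] by metis
  obtain q where q: "\<And>env n. (\<forall>v\<in>set env. length v \<le> n) \<Longrightarrow>
      length (eval e env) \<le> poly q n \<and> cost e env \<le> poly q n"
    using poly_cost[OF assms(2)] by auto
  have "halts_with M [x] (f x) (poly (smult 4 q + [:5, 2:]) (length x))" for x
  proof -
    obtain t where t: "halts_with M [x] (f x) t"
      "t \<le> cost e [map bit x] + 5 + 2 * length x + 3 * length (f x)" using M(2)[OF assms(3)] assms(2) by blast
    have "length (f x) \<le> poly q (length x)" "cost e [map bit x] \<le> poly q (length x)"
      using q[of "[map bit x]" "length x"] assms(3)[of x] by auto
    then show ?thesis using t by (intro halts_with_mono[OF t(1)]) simp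
  qed
  then show ?thesis unfolding polytime_def using M(1) by blast
qed

section \<open>The group SL(2,Z)\<close>

definition mk :: "int \<Rightarrow> int \<Rightarrow> int \<Rightarrow> int \<Rightarrow> mat2" where
  "mk a b c d = vector [vector [a, b], vector [c, d]]"

lemma mk_sel [simp]:
  "mk a b c d $ 1 $ 1 = a" "mk a b c d $ 1 $ 2 = b" "mk a b c d $ 2 $ 1 = c" "mk a b c d $ 2 $ 2 = d"
  by (simp_all add: mk_def)

lemma mat2_eq_iff:
  "(A :: mat2) = B \<longleftrightarrow> A $ 1 $ 1 = B $ 1 $ 1 \<and> A $ 1 $ 2 = B $ 1 $ 2 \<and> A $ 2 $ 1 = B $ 2 $ 1 \<and> A $ 2 $ 2 = B $ 2 $ 2"
  by (auto simp: vec_eq_iff forall_2)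

lemma mult_sel [simp]: "((A :: mat2) ** B) $ i $ j = A $ i $ 1 * B $ 1 $ j + A $ i $ 2 * B $ 2 $ j"
  by (simp add: matrix_matrix_mult_def sum_2)

lemma one_sel [simp]:
  "(mat 1 :: mat2) $ 1 $ 1 = 1" "(mat 1 :: mat2) $ 1 $ 2 = 0" "(mat 1 :: mat2) $ 2 $ 1 = 0" "(mat 1 :: mat2) $ 2 $ 2 = 1"
  by (simp_all add: mat_def)

lemma SL2Z_iff: "A \<in> SL2Z \<longleftrightarrow> A $ 1 $ 1 * A $ 2 $ 2 - A $ 1 $ 2 * A $ 2 $ 1 = 1"
  by (simp add: SL2Z_def det_2)

lemma mk_SL2Z: "mk a b c d \<in> SL2Z \<longleftrightarrow> a * d - b * c = 1"
  by (simp add: SL2Z_iff)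

lemma mult_SL2Z: "A \<in> SL2Z \<Longrightarrow> B \<in> SL2Z \<Longrightarrow> A ** B \<in> SL2Z"
  by (simp add: SL2Z_def det_mul)

lemma one_SL2Z: "mat 1 \<in> SL2Z"
  by (simp add: SL2Z_def)

text \<open>The adjugate is the inverse on \<open>SL2Z\<close> and reverses products of arbitrary
  matrices.\<close>

definition adj :: "mat2 \<Rightarrow> mat2" where
  "adj A = mk (A $ 2 $ 2) (- A $ 1 $ 2) (- A $ 2 $ 1) (A $ 1 $ 1)"

lemma adj_SL2Z: "A \<in> SL2Z \<Longrightarrow> adj A \<in> SL2Z"
  by (simp add: SL2Z_iff adj_def algebra_simps)

lemma adj_mult_self: "A \<in> SL2Z \<Longrightarrow> adj A ** A = mat 1"
  by (simp add: SL2Z_iff adj_def mat2_eq_iff algebra_simps)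

lemma mult_adj_self: "A \<in> SL2Z \<Longrightarrow> A ** adj A = mat 1"
  by (simp add: SL2Z_iff adj_def mat2_eq_iff algebra_simps)

lemma adj_mult: "adj (A ** B) = adj B ** adj A"
  by (simp add: adj_def mat2_eq_iff algebra_simps)

lemma adj_adj [simp]: "adj (adj A) = A"
  by (simp add: adj_def mat2_eq_iff)

lemma adj_mult_cancel: "A \<in> SL2Z \<Longrightarrow> adj A ** (A ** B) = B"
  by (simp add: matrix_mul_assoc adj_mult_self)

lemma mult_adj_cancel: "A \<in> SL2Z \<Longrightarrow> A ** (adj A ** B) = B"
  by (simp add: matrix_mul_assoc mult_adj_self)

lemma matprod_Nil [simp]: "matprod [] = mat 1"
  by (simp add: matprod_def)

lemma matprod_Cons [simp]: "matprod (A # As) = A ** matprod As"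
  by (simp add: matprod_def)

lemma matprod_append: "matprod (As @ Bs) = matprod As ** matprod Bs"
  by (induction As) (auto simp: matrix_mul_assoc)

lemma matprod_SL2Z: "set As \<subseteq> SL2Z \<Longrightarrow> matprod As \<in> SL2Z"
  by (induction As) (auto simp: one_SL2Z mult_SL2Z)


section \<open>A tree metric on SL(2,Z)\<close>

text \<open>
  SL(2,Z) acts on the tree dual to the Farey tessellation. Identify \<open>g\<close> with the triangle with
  corners \<open>g\<infinity>\<close>, \<open>g0\<close>, \<open>g1\<close>; then \<open>half\<close> consists of the triangles on one side of the Farey edge
  from 0 to \<open>\<infinity>\<close>, and the distance of two triangles is the number of edges separating them
  (each counted twice, as \<open>k\<close> and \<open>-k\<close>).
\<close>

definition half :: "mat2 set" where
  "half = {m. 0 \<le> m $ 1 $ 1 * m $ 2 $ 1 \<and> 0 \<le> m $ 1 $ 2 * m $ 2 $ 2 \<and>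
     0 \<le> (m $ 1 $ 1 + m $ 1 $ 2) * (m $ 2 $ 1 + m $ 2 $ 2)}"

definition sep :: "mat2 \<Rightarrow> mat2 \<Rightarrow> mat2 set" where
  "sep g h = {k \<in> SL2Z. adj k ** g \<in> half \<and> adj k ** h \<notin> half}"

definition tdist :: "mat2 \<Rightarrow> mat2 \<Rightarrow> nat" where
  "tdist g h = card (sep g h)"

text \<open>Rearranged, this is \<open>(a * d) * (b * c)\<close>, a product of two consecutive
  integers.\<close>

lemma same_signs:
  fixes a b c d :: int
  assumes "a * d - b * c = 1"
  shows "0 \<le> (a * c) * (b * d)"
proof -
  have "0 \<le> x * (x - 1)" for x :: int
    by (cases "x \<le> 0") (auto simp: mult_nonpos_nonpos)
  moreover have "b * c = a * d - 1" using assms by simp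
  ultimately have "0 \<le> (a * d) * (b * c)" by metis
  then show ?thesis by (simp add: mult_ac)
qed

text \<open>A Farey triangle never crosses the edge from 0 to \<infinity>: the three products belong
  to its corners, and by \<open>same_signs\<close>, applied to its three sides, no two of them have
  opposite signs.\<close>

lemma not_half:
  assumes "m \<in> SL2Z"
  shows "m \<notin> half \<longleftrightarrow> m $ 1 $ 1 * m $ 2 $ 1 \<le> 0 \<and> m $ 1 $ 2 * m $ 2 $ 2 \<le> 0 \<and>
     (m $ 1 $ 1 + m $ 1 $ 2) * (m $ 2 $ 1 + m $ 2 $ 2) \<le> 0"
proof -
  define a b c d where abcd: "a = m $ 1 $ 1" "b = m $ 1 $ 2" "c = m $ 2 $ 1" "d = m $ 2 $ 2"
  have det: "a * d - b * c = 1" using assms by (simp add: SL2Z_iff abcd)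
  let ?p = "a * c" and ?q = "b * d" and ?r = "(a + b) * (c + d)"
  have 1: "0 \<le> ?p * ?q" using same_signs[OF det] .
  have "a * (c + d) - (a + b) * c = 1" "(a + b) * d - b * (c + d) = 1"
    using det by (simp_all add: algebra_simps)
  from this[THEN same_signs] have 2: "0 \<le> ?p * ?r" and 3: "0 \<le> ?r * ?q" .
  \<comment> \<open>A product vanishes if its corner is 0 or \<infinity>, and three distinct corners
    cannot all be among these two.\<close>
  have 7: "\<not> (?p = 0 \<and> ?q = 0 \<and> ?r = 0)"
  proof
    assume *: "?p = 0 \<and> ?q = 0 \<and> ?r = 0"
    show False
    proof (cases "a = 0")
      case True
      then have "d = 0" using * det by auto
      then show False using * det True by auto
    next
      case False
      then have "c = 0" using * by simp
      then have "d \<noteq> 0" "b = 0" using * det by auto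
      then show False using * False \<open>c = 0\<close> by simp
    qed
  qed
  have "m \<in> half \<longleftrightarrow> 0 \<le> ?p \<and> 0 \<le> ?q \<and> 0 \<le> ?r" by (simp add: half_def abcd)
  moreover have "\<not> (0 \<le> ?p \<and> 0 \<le> ?q \<and> 0 \<le> ?r) \<longleftrightarrow> ?p \<le> 0 \<and> ?q \<le> 0 \<and> ?r \<le> 0"
    using 1[unfolded zero_le_mult_iff[of ?p ?q]] 2[unfolded zero_le_mult_iff[of ?p ?r]]
      3[unfolded zero_le_mult_iff[of ?r ?q]] 7 by linarith
  ultimately show ?thesis by (simp add: abcd)
qed

definition rot :: mat2 where
  "rot = mk 0 (-1) 1 0"

lemma rot_SL2Z: "rot \<in> SL2Z"
  by (simp add: rot_def mk_SL2Z)

lemma minus_add_mult: "(- a - b) * c = - ((a + b) * c)" for a b c :: int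
  by (simp add: algebra_simps)

text \<open>\<open>rot\<close> acts as the half-turn about the edge from 0 to \<infinity>,
  exchanging its two sides.\<close>

lemma half_rot:
  assumes "m \<in> SL2Z"
  shows "adj rot ** m \<in> half \<longleftrightarrow> m \<notin> half"
  unfolding not_half[OF assms]
  using minus_add_mult[of "m $ 1 $ 1" "m $ 1 $ 2" "m $ 2 $ 1 + m $ 2 $ 2"]
  by (simp add: half_def rot_def adj_def mult_ac)

text \<open>The half-turn reverses the orientation of a separating edge. Since \<open>rot\<close>
  has order 4, each \<open>k\<close> is the image of \<open>k\<close> times the cube of
  \<open>rot\<close>.\<close>

lemma sep_sym:
  assumes "g \<in> SL2Z" "h \<in> SL2Z"
  shows "sep h g = (\<lambda>k. k ** rot) ` sep g h"
proof -
  have 1: "k ** rot \<in> sep h g" if "k \<in> sep g h" "g \<in> SL2Z" "h \<in> SL2Z" for k g h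
    using that half_rot[of "adj k ** g"] half_rot[of "adj k ** h"]
    by (auto simp: sep_def adj_mult mult_SL2Z rot_SL2Z adj_SL2Z matrix_mul_assoc)
  have 2: "k = (k ** rot ** rot ** rot) ** rot" for k :: mat2
    by (simp add: mat2_eq_iff rot_def)
  have "k \<in> (\<lambda>k. k ** rot) ` sep g h" if "k \<in> sep h g" for k
    using 1[OF 1[OF 1[OF that assms(2,1)] assms] assms(2,1)] 2[of k] by blast
  with 1[OF _ assms] show ?thesis by blast
qed

lemma inj_mult_right: "B \<in> SL2Z \<Longrightarrow> inj_on (\<lambda>k. k ** B) X"
  by (rule inj_on_inverseI[of _ "\<lambda>k. k ** adj B"])
    (simp add: matrix_mul_assoc[symmetric] mult_adj_self)

lemma inj_mult_left: "B \<in> SL2Z \<Longrightarrow> inj_on ((**) B) X"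
  by (rule inj_on_inverseI[of _ "(**) (adj B)"]) (simp add: adj_mult_cancel)

lemma tdist_sym: "g \<in> SL2Z \<Longrightarrow> h \<in> SL2Z \<Longrightarrow> tdist h g = tdist g h"
  unfolding tdist_def by (simp add: sep_sym[of g h] card_image inj_mult_right rot_SL2Z)

lemma sep_translate:
  assumes "x \<in> SL2Z" shows "sep (x ** g) (x ** h) = (**) x ` sep g h"
proof -
  have "x ** k \<in> sep (x ** g) (x ** h)" if "k \<in> sep g h" for k
    using that assms by (auto simp: sep_def adj_mult mult_SL2Z matrix_mul_assoc[symmetric] adj_mult_cancel)
  moreover have "k \<in> (**) x ` sep g h" if "k \<in> sep (x ** g) (x ** h)" for k
    using that assms
    by (intro image_eqI[of _ _ "adj x ** k"])
      (auto simp: sep_def adj_mult mult_SL2Z adj_SL2Z matrix_mul_assoc mult_adj_self)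
  ultimately show ?thesis by blast
qed

lemma tdist_translate: "x \<in> SL2Z \<Longrightarrow> tdist (x ** g) (x ** h) = tdist g h"
  unfolding tdist_def by (simp add: sep_translate card_image inj_mult_left)

abbreviation tlen :: "mat2 \<Rightarrow> nat" where
  "tlen g \<equiv> tdist (mat 1) g"

lemma sep_triangle: "sep g h \<subseteq> sep g x \<union> sep x h"
  by (auto simp: sep_def)


subsection \<open>The four-point condition\<close>

text \<open>Two half-trees are nested up to complementation, so they never form four corners.\<close>

lemma half_nested:
  assumes "k \<in> SL2Z" "x \<in> SL2Z" "y \<in> SL2Z" "z \<in> SL2Z" "w \<in> SL2Z"
    and "x \<in> half" "y \<in> half" "z \<notin> half" "w \<notin> half"
    and "k ** x \<in> half" "k ** y \<notin> half" "k ** z \<in> half" "k ** w \<notin> half"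
  shows False
proof -
  define a b c d where abcd: "a = k $ 1 $ 1" "b = k $ 1 $ 2" "c = k $ 2 $ 1" "d = k $ 2 $ 2"
  have det: "a * d - b * c = 1" using assms(1) by (simp add: SL2Z_iff abcd)
  \<comment> \<open>At a corner \<open>p / q\<close>, membership after applying \<open>k\<close>
    depends on the sign of this quadratic form, whose outer coefficients do not have opposite signs;
    membership before depends on the sign of \<open>p * q\<close>.\<close>
  have form: "(a * p + b * q) * (c * p + d * q) = a * c * p\<^sup>2 + (a * d + b * c) * (p * q) + b * d * q\<^sup>2"
    for p q :: int by (simp add: algebra_simps power2_eq_square)
  have form_pos: "0 \<le> (a * p + b * q) * (c * p + d * q)"
    if "0 \<le> a * c" "0 \<le> b * d" "0 \<le> (a * d + b * c) * (p * q)" for p q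
    using that unfolding form by (intro add_nonneg_nonneg) (simp_all add: mult_nonneg_nonneg)
  have form_neg: "(a * p + b * q) * (c * p + d * q) \<le> 0"
    if "a * c \<le> 0" "b * d \<le> 0" "(a * d + b * c) * (p * q) \<le> 0" for p q
    using that unfolding form by (intro add_nonpos_nonpos) (simp_all add: mult_nonpos_nonneg)
  have in_half: "k ** m \<in> half"
    if "\<And>p q. (p, q) \<in> {(m $ 1 $ 1, m $ 2 $ 1), (m $ 1 $ 2, m $ 2 $ 2),
        (m $ 1 $ 1 + m $ 1 $ 2, m $ 2 $ 1 + m $ 2 $ 2)} \<Longrightarrow> 0 \<le> (a * p + b * q) * (c * p + d * q)" for m
    using that[of "m $ 1 $ 1" "m $ 2 $ 1"] that[of "m $ 1 $ 2" "m $ 2 $ 2"]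
      that[of "m $ 1 $ 1 + m $ 1 $ 2" "m $ 2 $ 1 + m $ 2 $ 2"]
    by (simp add: half_def abcd algebra_simps)
  have notin_half: "k ** m \<notin> half"
    if "m \<in> SL2Z" "\<And>p q. (p, q) \<in> {(m $ 1 $ 1, m $ 2 $ 1), (m $ 1 $ 2, m $ 2 $ 2),
        (m $ 1 $ 1 + m $ 1 $ 2, m $ 2 $ 1 + m $ 2 $ 2)} \<Longrightarrow> (a * p + b * q) * (c * p + d * q) \<le> 0" for m
    using that(2)[of "m $ 1 $ 1" "m $ 2 $ 1"] that(2)[of "m $ 1 $ 2" "m $ 2 $ 2"]
      that(2)[of "m $ 1 $ 1 + m $ 1 $ 2" "m $ 2 $ 1 + m $ 2 $ 2"] that(1) assms(1)
    by (simp add: not_half mult_SL2Z abcd algebra_simps)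
  have pos: "0 \<le> p * q" if "m \<in> half" "(p, q) \<in> {(m $ 1 $ 1, m $ 2 $ 1), (m $ 1 $ 2, m $ 2 $ 2),
        (m $ 1 $ 1 + m $ 1 $ 2, m $ 2 $ 1 + m $ 2 $ 2)}" for m p q
    using that by (auto simp: half_def)
  have neg: "p * q \<le> 0" if "m \<in> SL2Z" "m \<notin> half" "(p, q) \<in> {(m $ 1 $ 1, m $ 2 $ 1), (m $ 1 $ 2, m $ 2 $ 2),
        (m $ 1 $ 1 + m $ 1 $ 2, m $ 2 $ 1 + m $ 2 $ 2)}" for m p q
    using that by (auto simp: not_half)
  have "(0 \<le> a * c \<and> 0 \<le> b * d) \<or> (a * c \<le> 0 \<and> b * d \<le> 0)"
    using same_signs[OF det, unfolded zero_le_mult_iff[of "a * c" "b * d"]] by linarith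
  moreover have "0 \<le> a * d + b * c \<or> a * d + b * c \<le> 0" by linarith
  \<comment> \<open>The signs of the outer coefficients and of the middle one determine which of the
    four corners is empty.\<close>
  ultimately consider
      "0 \<le> a * c" "0 \<le> b * d" "0 \<le> a * d + b * c" | "0 \<le> a * c" "0 \<le> b * d" "a * d + b * c \<le> 0"
    | "a * c \<le> 0" "b * d \<le> 0" "0 \<le> a * d + b * c" | "a * c \<le> 0" "b * d \<le> 0" "a * d + b * c \<le> 0"
    by blast
  then show False
  proof cases
    case 1
    have "k ** y \<in> half"
      by (rule in_half, rule form_pos[OF 1(1,2)], rule mult_nonneg_nonneg[OF 1(3)], rule pos[OF assms(7)])
    then show False using assms by blast
  next
    case 2
    have "k ** w \<in> half"
      by (rule in_half, rule form_pos[OF 2(1,2)], rule mult_nonpos_nonpos[OF 2(3)], rule neg[OF assms(5,9)])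
    then show False using assms by blast
  next
    case 3
    have "k ** z \<notin> half"
      by (rule notin_half[OF assms(4)], rule form_neg[OF 3(1,2)], rule mult_nonneg_nonpos[OF 3(3)],
          rule neg[OF assms(4,8)])
    then show False using assms by blast
  next
    case 4
    have "k ** x \<notin> half"
      by (rule notin_half[OF assms(2)], rule form_neg[OF 4(1,2)], rule mult_nonpos_nonneg[OF 4(3)],
          rule pos[OF assms(6)])
    then show False using assms by blast
  qed
qed

lemma sep_nested:
  assumes "k \<in> SL2Z" "l \<in> SL2Z" "x \<in> SL2Z" "y \<in> SL2Z" "z \<in> SL2Z" "w \<in> SL2Z"
    and "adj k ** x \<in> half" "adj k ** y \<in> half" "adj k ** z \<notin> half" "adj k ** w \<notin> half"
    and "adj l ** x \<in> half" "adj l ** y \<notin> half" "adj l ** z \<in> half" "adj l ** w \<notin> half"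
  shows False
proof -
  have *: "(adj l ** k) ** (adj k ** g) = adj l ** g" for g
    using assms(1) by (simp add: matrix_mul_assoc[symmetric] mult_adj_cancel)
  show False
    by (rule half_nested[of "adj l ** k" "adj k ** x" "adj k ** y" "adj k ** z" "adj k ** w"])
      (use assms in \<open>simp_all add: * mult_SL2Z adj_SL2Z\<close>)
qed

text \<open>Counting with multiplicity: every element is counted on the right at least as often as
  on the left.\<close>

lemma card_add_le:
  assumes "A \<union> B \<subseteq> C \<union> D" "A \<inter> B \<subseteq> C \<inter> D" "finite C" "finite D"
  shows "card A + card B \<le> card C + card D"
proof -
  have "finite A" "finite B" using assms finite_subset[of _ "C \<union> D"] by auto
  then have "card A + card B = card (A \<union> B) + card (A \<inter> B)" by (rule card_Un_Int)
  also have "\<dots> \<le> card (C \<union> D) + card (C \<inter> D)" using assms by (intro add_mono card_mono) auto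
  also have "\<dots> = card C + card D" using card_Un_Int[OF assms(3,4)] by simp
  finally show ?thesis .
qed

text \<open>Edges that split \<open>x\<close>, \<open>z\<close> from \<open>y\<close>,
  \<open>w\<close> and edges that split \<open>x\<close>, \<open>y\<close> from \<open>z\<close>,
  \<open>w\<close> cannot coexist, by nestedness. The absence of either kind gives one of the
  inequalities, edge by edge. Finiteness of \<open>sep\<close> is established only later, hence the
  hypothesis.\<close>

lemma four_point:
  assumes "x \<in> SL2Z" "y \<in> SL2Z" "z \<in> SL2Z" "w \<in> SL2Z"
    and fin: "\<And>g h. g \<in> SL2Z \<Longrightarrow> h \<in> SL2Z \<Longrightarrow> finite (sep g h)"
  shows "tdist x w + tdist y z \<le> tdist x z + tdist y w \<or> tdist x w + tdist y z \<le> tdist x y + tdist z w"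
proof -
  let ?i = "\<lambda>k g. adj k ** g \<in> half"
  have *: "\<not> (k \<in> SL2Z \<and> l \<in> SL2Z \<and> ((?i k x \<and> ?i k z \<and> \<not> ?i k y \<and> \<not> ?i k w) \<or> (?i k y \<and> ?i k w \<and> \<not> ?i k x \<and> \<not> ?i k z)) \<and>
      ((?i l x \<and> ?i l y \<and> \<not> ?i l z \<and> \<not> ?i l w) \<or> (?i l z \<and> ?i l w \<and> \<not> ?i l x \<and> \<not> ?i l y)))" for k l
    using sep_nested[of k l x z y w] sep_nested[of k l z x w y] sep_nested[of k l y w x z]
      sep_nested[of k l w y z x] assms(1-4) by blast
  show ?thesis
  proof (cases "\<exists>k\<in>SL2Z. (?i k x \<and> ?i k z \<and> \<not> ?i k y \<and> \<not> ?i k w) \<or> (?i k y \<and> ?i k w \<and> \<not> ?i k x \<and> \<not> ?i k z)")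
    case False
    have "card (sep x w) + card (sep y z) \<le> card (sep x z) + card (sep y w)"
      by (rule card_add_le) (use False fin assms in \<open>auto simp: sep_def\<close>)
    then show ?thesis by (simp add: tdist_def)
  next
    case True
    have "card (sep x w) + card (sep z y) \<le> card (sep x y) + card (sep z w)"
      by (rule card_add_le) (use True * fin assms in \<open>auto simp: sep_def\<close>)
    then show ?thesis using tdist_sym[of y z] assms by (simp add: tdist_def)
  qed
qed


subsection \<open>Properness\<close>

definition up :: mat2 where "up = mk 1 1 0 1"
definition low :: mat2 where "low = mk 1 0 1 1"

text \<open>The stabilizer of the edge from 0 to \<infinity>, the cyclic group of order 4 generated
  by \<open>rot\<close>.\<close>

definition axis :: "mat2 set" where
  "axis = {mk 1 0 0 1, mk (-1) 0 0 (-1), mk 0 1 (-1) 0, mk 0 (-1) 1 0}"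

lemma axis_iff:
  assumes "m \<in> SL2Z" "m $ 1 $ 1 * m $ 2 $ 1 = 0" "m $ 1 $ 2 * m $ 2 $ 2 = 0"
  shows "m \<in> axis"
proof -
  define a b c d where abcd: "a = m $ 1 $ 1" "b = m $ 1 $ 2" "c = m $ 2 $ 1" "d = m $ 2 $ 2"
  have det: "a * d - b * c = 1" using assms(1) by (simp add: SL2Z_iff abcd)
  have m: "m = mk a b c d" by (simp add: mat2_eq_iff abcd)
  have "a = 0 \<or> c = 0" "b = 0 \<or> d = 0" using assms(2,3) by (auto simp: abcd)
  then consider "a = 0" "d = 0" "b * (- c) = 1" | "b = 0" "c = 0" "a * d = 1"
    using det by fastforce
  then show ?thesis
  proof cases
    case 1
    then have "b = 1 \<and> c = -1 \<or> b = -1 \<and> c = 1" using zmult_eq_1_iff[of b "- c"] by auto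
    then show ?thesis using 1 by (auto simp: m axis_def)
  next
    case 2
    then have "a = 1 \<and> d = 1 \<or> a = -1 \<and> d = -1" using zmult_eq_1_iff[of a d] by auto
    then show ?thesis using 2 by (auto simp: m axis_def)
  qed
qed

text \<open>The triangles of \<open>mat 1\<close> and \<open>B\<close> share an edge, and this edge
  alone separates them; it corresponds to at most the 4 elements of a coset of
  \<open>axis\<close>.\<close>

lemma sep_generator:
  assumes "B \<in> {rot, up, low}"
  shows "finite (sep (mat 1) B) \<and> tlen B \<le> 4"
proof -
  have B: "B \<in> SL2Z" using assms by (auto simp: rot_SL2Z up_def low_def mk_SL2Z)
  define X where "X = (if B = rot then axis else (\<lambda>m. m ** adj B) ` axis)"
  have ax: "finite axis" "card axis \<le> 4"
    by (simp_all add: axis_def card_insert_if)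
  then have X: "finite X" "card X \<le> 4"
    by (auto simp: X_def intro: order_trans[OF card_image_le])
  have "m \<in> X" if "m \<in> SL2Z" "m \<in> half" "m ** B \<notin> half" for m
  proof -
    have mB: "m ** B \<in> SL2Z" using that B by (simp add: mult_SL2Z)
    note nh = that(3)[unfolded not_half[OF mB]]
    show ?thesis
    proof (cases "B = rot")
      case True
      then show ?thesis using nh that(1,2)
        by (auto simp: X_def rot_def half_def intro!: axis_iff)
    next
      case False
      then have "m ** B \<in> axis" using nh that(1,2) mB assms
        by (auto simp: up_def low_def half_def add.commute intro!: axis_iff)
      moreover have "m = (m ** B) ** adj B"
        using B by (simp add: matrix_mul_assoc[symmetric] mult_adj_self)
      ultimately show ?thesis using False by (auto simp: X_def)
    qed
  qed
  then have "sep (mat 1) B \<subseteq> adj ` X"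
    by (auto simp: sep_def adj_SL2Z intro!: image_eqI[of _ adj, OF adj_adj[symmetric]])
  then show ?thesis using X unfolding tdist_def
    by (meson card_image_le card_mono finite_imageI finite_subset order_trans)
qed

lemma sep_finite_mult:
  assumes "g \<in> SL2Z" "finite (sep (mat 1) g)" "finite (sep (mat 1) h)"
  shows "finite (sep (mat 1) (g ** h)) \<and> tlen (g ** h) \<le> tlen g + tlen h"
proof -
  have eq: "sep g (g ** h) = (**) g ` sep (mat 1) h" using sep_translate[OF assms(1), of "mat 1" h] by simp
  have sub: "sep (mat 1) (g ** h) \<subseteq> sep (mat 1) g \<union> (**) g ` sep (mat 1) h"
    using sep_triangle[of "mat 1" "g ** h" g] by (simp add: eq)
  have fin: "finite (sep (mat 1) g \<union> (**) g ` sep (mat 1) h)" using assms by simp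
  have "card (sep (mat 1) (g ** h)) \<le> card (sep (mat 1) g) + card ((**) g ` sep (mat 1) h)"
    using card_mono[OF fin sub] card_Un_le le_trans by blast
  also have "card ((**) g ` sep (mat 1) h) \<le> card (sep (mat 1) h)" using assms by (intro card_image_le)
  finally show ?thesis using finite_subset[OF sub fin] by (simp add: tdist_def)
qed

lemma tlen_word:
  assumes "set ws \<subseteq> {rot, up, low}"
  shows "finite (sep (mat 1) (matprod ws)) \<and> tlen (matprod ws) \<le> 4 * length ws"
  using assms
proof (induction ws)
  case Nil
  have "sep (mat 1) (mat 1) = {}" by (auto simp: sep_def)
  then show ?case by (simp add: tdist_def)
next
  case (Cons B ws)
  moreover have "B \<in> SL2Z" using Cons.prems by (auto simp: rot_SL2Z up_def low_def mk_SL2Z)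
  ultimately show ?case
    using sep_finite_mult[of B "matprod ws"] sep_generator[of B] by force
qed

section \<open>Positive words and the size of entries\<close>

definition mnorm :: "mat2 \<Rightarrow> nat" where
  "mnorm A = nat (\<bar>A $ 1 $ 1\<bar> + \<bar>A $ 1 $ 2\<bar> + \<bar>A $ 2 $ 1\<bar> + \<bar>A $ 2 $ 2\<bar>)"

definition nonneg :: "mat2 \<Rightarrow> bool" where
  "nonneg A \<longleftrightarrow> 0 \<le> A $ 1 $ 1 \<and> 0 \<le> A $ 1 $ 2 \<and> 0 \<le> A $ 2 $ 1 \<and> 0 \<le> A $ 2 $ 2"

lemma nonneg_pos:
  fixes a b c d :: int
  assumes "a * d - b * c = 1" "0 \<le> a" "0 \<le> b" "0 \<le> c" "0 \<le> d"
  shows "0 < a + b" "0 < c + d" "0 < a + c" "0 < b + d"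
proof -
  have "\<not> (a = 0 \<and> b = 0)" "\<not> (c = 0 \<and> d = 0)" "\<not> (a = 0 \<and> c = 0)" "\<not> (b = 0 \<and> d = 0)"
    using assms(1) by auto
  then show "0 < a + b" "0 < c + d" "0 < a + c" "0 < b + d" using assms by linarith+
qed

text \<open>If neither row dominates, one diagonal strictly exceeds the other; then
  \<open>a * d\<close> and \<open>b * c\<close> cannot differ by exactly 1 in the right direction
  unless the matrix is the identity.\<close>

lemma nonneg_rows:
  fixes a b c d :: int
  assumes "a * d - b * c = 1" "0 \<le> a" "0 \<le> b" "0 \<le> c" "0 \<le> d" "\<not> (a = 1 \<and> b = 0 \<and> c = 0 \<and> d = 1)"
  shows "(c \<le> a \<and> d \<le> b) \<or> (a \<le> c \<and> b \<le> d)"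
proof (rule ccontr)
  assume "\<not> ?thesis"
  then consider "c + 1 \<le> a" "b + 1 \<le> d" | "a + 1 \<le> c" "d + 1 \<le> b" by linarith
  then show False
  proof cases
    case 1
    then have "(c + 1) * (b + 1) \<le> a * d" using assms by (intro mult_mono) auto
    then have "b + c \<le> 0" using assms(1) by (simp add: algebra_simps)
    then have "b = 0" "c = 0" using assms by auto
    then have "a * d = 1" using assms by simp
    then show False using zmult_eq_1_iff[of a d] assms \<open>b = 0\<close> \<open>c = 0\<close> by auto
  next
    case 2
    then have "(a + 1) * (d + 1) \<le> c * b" using assms by (intro mult_mono) auto
    then show False using assms by (simp add: algebra_simps)
  qed
qed

text \<open>The Euclidean algorithm on the rows: subtracting the smaller row from the larger strips
  off a factor \<open>up\<close> or \<open>low\<close> and decreases the norm.\<close>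

lemma nonneg_word:
  assumes "A \<in> SL2Z" "nonneg A"
  shows "\<exists>ws. set ws \<subseteq> {up, low} \<and> A = matprod ws \<and> length ws \<le> mnorm A"
  using assms
proof (induction "mnorm A" arbitrary: A rule: less_induct)
  case less
  define a b c d where abcd: "a = A $ 1 $ 1" "b = A $ 1 $ 2" "c = A $ 2 $ 1" "d = A $ 2 $ 2"
  have det: "a * d - b * c = 1" using less.prems by (simp add: SL2Z_iff abcd)
  have nn: "0 \<le> a" "0 \<le> b" "0 \<le> c" "0 \<le> d" using less.prems by (auto simp: nonneg_def abcd)
  have A: "A = mk a b c d" by (simp add: mat2_eq_iff abcd)
  have norm: "mnorm A = nat (a + b + c + d)" using nn by (simp add: mnorm_def A)
  show ?case
  proof (cases "a = 1 \<and> b = 0 \<and> c = 0 \<and> d = 1")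
    case True
    then have "A = matprod []" by (simp add: A mat2_eq_iff)
    then show ?thesis by (intro exI[of _ "[]"]) auto
  next
    case False
    have step: ?thesis if st: "A = B ** A'" "B \<in> {up, low}" "A' \<in> SL2Z" "nonneg A'" "mnorm A' < mnorm A" for A' B
    proof -
      obtain ws where "set ws \<subseteq> {up, low}" "A' = matprod ws" "length ws \<le> mnorm A'"
        using less.hyps[OF st(5,3,4)] by blast
      then show ?thesis using st by (intro exI[of _ "B # ws"]) auto
    qed
    have pos: "0 < a + b" "0 < c + d" using nonneg_pos[OF det nn] by auto
    show ?thesis
    proof (cases "c \<le> a \<and> d \<le> b")
      case True
      show ?thesis
        by (rule step[of up "mk (a - c) (b - d) c d"])
          (use True det nn pos in \<open>auto simp: A up_def mat2_eq_iff mk_SL2Z nonneg_def mnorm_def algebra_simps\<close>)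
    next
      case F: False
      then have "a \<le> c \<and> b \<le> d" using nonneg_rows[OF det nn False] by blast
      then show ?thesis
        by (intro step[of low "mk a b (c - a) (d - b)"])
          (use det nn pos in \<open>auto simp: A low_def mat2_eq_iff mk_SL2Z nonneg_def mnorm_def algebra_simps\<close>)
    qed
  qed
qed

text \<open>Each factor adds one row to the other, so the norm grows by at least 1 and at most
  doubles. The upper bound later turns a bound on lengths of words into one on entries.\<close>

lemma word_nonneg:
  assumes "set ws \<subseteq> {up, low}"
  shows "matprod ws \<in> SL2Z \<and> nonneg (matprod ws) \<and> length ws + 2 \<le> mnorm (matprod ws) \<and>
    mnorm (matprod ws) \<le> 2 ^ (length ws + 1)"
  using assms
proof (induction ws)
  case Nil
  then show ?case by (simp add: one_SL2Z nonneg_def mnorm_def)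
next
  case (Cons B ws)
  define A where "A = matprod ws"
  define a b c d where abcd: "a = A $ 1 $ 1" "b = A $ 1 $ 2" "c = A $ 2 $ 1" "d = A $ 2 $ 2"
  have IH: "A \<in> SL2Z" "nonneg A" "length ws + 2 \<le> mnorm A" "mnorm A \<le> 2 ^ (length ws + 1)"
    using Cons by (auto simp: A_def)
  have det: "a * d - b * c = 1" using IH by (simp add: SL2Z_iff abcd)
  have nn: "0 \<le> a" "0 \<le> b" "0 \<le> c" "0 \<le> d" using IH by (auto simp: nonneg_def abcd)
  have A: "A = mk a b c d" by (simp add: mat2_eq_iff abcd)
  have norm: "mnorm A = nat (a + b + c + d)" using nn by (simp add: mnorm_def A)
  have pos: "0 < a + b" "0 < c + d" using nonneg_pos[OF det nn] by auto
  have B: "B = up \<or> B = low" "B \<in> SL2Z" using Cons.prems by (auto simp: up_def low_def mk_SL2Z)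
  then have "nonneg (B ** A) \<and> mnorm A + 1 \<le> mnorm (B ** A) \<and> mnorm (B ** A) \<le> 2 * mnorm A"
    using nn pos unfolding norm by (auto simp: A up_def low_def nonneg_def mnorm_def)
  then show ?case using IH B by (auto simp: A_def mult_SL2Z)
qed

lemma adj_nonneg_not_half:
  assumes "A \<in> SL2Z" "nonneg A" "A \<noteq> mat 1"
  shows "adj A \<notin> half"
proof
  assume h: "adj A \<in> half"
  define a b c d where abcd: "a = A $ 1 $ 1" "b = A $ 1 $ 2" "c = A $ 2 $ 1" "d = A $ 2 $ 2"
  have det: "a * d - b * c = 1" using assms by (simp add: SL2Z_iff abcd)
  have nn: "0 \<le> a" "0 \<le> b" "0 \<le> c" "0 \<le> d" using assms by (auto simp: nonneg_def abcd)
  have "d * c \<le> 0" "b * a \<le> 0" using h by (auto simp: half_def adj_def abcd)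
  moreover have "0 \<le> d * c" "0 \<le> b * a" using nn by simp_all
  ultimately have 0: "d * c = 0" "b * a = 0" by linarith+
  have "0 \<le> b * c" using nn by simp
  then have "d \<noteq> 0" "a \<noteq> 0" using det by auto
  then have "c = 0" "b = 0" using 0 by auto
  then have "a = 1" "d = 1" using det zmult_eq_1_iff[of a d] nn by auto
  then show False using assms(3) \<open>c = 0\<close> \<open>b = 0\<close> by (simp add: mat2_eq_iff abcd)
qed

text \<open>A positive word is a geodesic: each of its nonempty prefixes gives an edge between
  \<open>mat 1\<close> and the product, and the prefixes are distinct because the norm
  increases.\<close>

lemma word_length_le:
  assumes "set ws \<subseteq> {up, low}"
  shows "length ws \<le> tlen (matprod ws)"
proof -
  let ?p = "\<lambda>j. matprod (take j ws)"
  have sub: "set (take j ws) \<subseteq> {up, low}" "set (drop j ws) \<subseteq> {up, low}" for j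
    using assms set_take_subset set_drop_subset by (metis subset_trans)+
  have A: "matprod ws \<in> SL2Z" using word_nonneg[OF assms] by blast
  have inc: "mnorm (?p i) < mnorm (?p j)" if "i < j" "j \<le> length ws" for i j
  proof -
    have mono: "mnorm (A ** matprod vs) \<ge> mnorm A + length vs" if "set vs \<subseteq> {up, low}" "nonneg A" "A \<in> SL2Z" for A vs
      using that
    proof (induction vs arbitrary: A)
      case (Cons B vs)
      define a b c d where abcd: "a = A $ 1 $ 1" "b = A $ 1 $ 2" "c = A $ 2 $ 1" "d = A $ 2 $ 2"
      have det: "a * d - b * c = 1" using Cons.prems by (simp add: SL2Z_iff abcd)
      have nn: "0 \<le> a" "0 \<le> b" "0 \<le> c" "0 \<le> d" using Cons.prems by (auto simp: nonneg_def abcd)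
      have A: "A = mk a b c d" by (simp add: mat2_eq_iff abcd)
      have norm: "mnorm A = nat (a + b + c + d)" using nn by (simp add: mnorm_def A)
      have pos: "0 < a + c" "0 < b + d" using nonneg_pos[OF det nn] by auto
      have "B = up \<or> B = low" "B \<in> SL2Z" using Cons.prems by (auto simp: up_def low_def mk_SL2Z)
      then have "nonneg (A ** B) \<and> mnorm A + 1 \<le> mnorm (A ** B) \<and> A ** B \<in> SL2Z"
        using nn pos Cons.prems(3) unfolding norm
        by (auto simp: A up_def low_def nonneg_def mnorm_def intro: mult_SL2Z)
      then show ?case using Cons.IH[of "A ** B"] Cons.prems(1) by (auto simp: matrix_mul_assoc)
    qed auto
    have "take j ws = take i ws @ drop i (take j ws)" using that by (metis append_take_drop_id min.absorb1 take_take less_imp_le)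
    then have "?p j = ?p i ** matprod (drop i (take j ws))" by (metis matprod_append)
    moreover have "set (drop i (take j ws)) \<subseteq> {up, low}" using sub set_drop_subset by (metis subset_trans)
    ultimately show ?thesis
      using mono[of "drop i (take j ws)" "?p i"] word_nonneg[OF sub(1)[of i]] that by auto
  qed
  have "?p ` {1..length ws} \<subseteq> sep (matprod ws) (mat 1)"
  proof
    fix k assume "k \<in> ?p ` {1..length ws}"
    then obtain j where j: "1 \<le> j" "j \<le> length ws" "k = ?p j" by auto
    note w = word_nonneg[OF sub(1)[of j]] word_nonneg[OF sub(2)[of j]]
    have "mnorm (?p 0) < mnorm k" using inc[of 0 j] j by simp
    then have "k \<noteq> mat 1" by auto
    then have "adj k \<notin> half" using adj_nonneg_not_half[of k] w j by blast
    moreover have "adj k ** matprod ws = matprod (drop j ws)"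
      using w(1) j adj_mult_cancel[of k "matprod (drop j ws)"]
      by (metis append_take_drop_id matprod_append)
    moreover have "matprod (drop j ws) \<in> half" using w(2) by (auto simp: half_def nonneg_def)
    ultimately show "k \<in> sep (matprod ws) (mat 1)" using w j by (simp add: sep_def)
  qed
  moreover have fin: "finite (sep (matprod ws) (mat 1))"
    using sep_sym[OF one_SL2Z A] tlen_word[of ws] assms by auto
  moreover have "inj_on ?p {1..length ws}"
    by (rule linorder_inj_onI) (use inc in \<open>force\<close>)+
  ultimately have "length ws \<le> card (sep (matprod ws) (mat 1))"
    by (metis card_atLeastAtMost card_image card_mono diff_Suc_1)
  then show ?thesis using tdist_sym[OF one_SL2Z A] by (simp add: tdist_def)
qed


section \<open>Comparison of tree length and norm on the whole group\<close>

abbreviation rotp :: "nat \<Rightarrow> mat2" where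
  "rotp i \<equiv> matprod (replicate i rot)"

lemma mnorm_rot: "mnorm (rot ** A) = mnorm A" "mnorm (A ** rot) = mnorm A"
  by (simp_all add: mnorm_def rot_def add_ac)

lemma mnorm_rotp: "mnorm (rotp i ** A) = mnorm A" "mnorm (A ** rotp i) = mnorm A"
proof -
  show "mnorm (rotp i ** A) = mnorm A"
    by (induction i) (simp_all add: mnorm_rot flip: matrix_mul_assoc)
  show "mnorm (A ** rotp i) = mnorm A"
    by (induction i arbitrary: A) (simp_all add: mnorm_rot matrix_mul_assoc)
qed

lemma rotp_add: "rotp i ** rotp j = rotp (i + j)"
  by (simp add: replicate_add matprod_append)

lemma rotp_4: "rotp 4 = mat 1"
  by (simp add: numeral_eq_Suc mat2_eq_iff rot_def)

lemma rotp_SL2Z: "rotp i \<in> SL2Z"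
  by (rule matprod_SL2Z) (auto simp: rot_SL2Z)

text \<open>A left factor \<open>rot\<close> moves \<open>g\<close>, if necessary, to where each
  column has entries of like sign; right factors then bring both columns into the first
  quadrant.\<close>

lemma to_nonneg:
  assumes "g \<in> SL2Z"
  shows "\<exists>i\<le>3. \<exists>j\<le>3. nonneg (rotp i ** g ** rotp j)"
proof -
  have cols: "\<exists>j\<le>3. nonneg (g ** rotp j)" if "0 \<le> g $ 1 $ 1 * g $ 2 $ 1" "0 \<le> g $ 1 $ 2 * g $ 2 $ 2" for g
  proof -
    define a b c d where abcd: "a = g $ 1 $ 1" "b = g $ 1 $ 2" "c = g $ 2 $ 1" "d = g $ 2 $ 2"
    have "(0 \<le> a \<and> 0 \<le> c) \<or> (a \<le> 0 \<and> c \<le> 0)" "(0 \<le> b \<and> 0 \<le> d) \<or> (b \<le> 0 \<and> d \<le> 0)"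
      using that by (simp_all add: zero_le_mult_iff abcd)
    then consider "0 \<le> a" "0 \<le> c" "0 \<le> b" "0 \<le> d" | "a \<le> 0" "c \<le> 0" "0 \<le> b" "0 \<le> d"
      | "a \<le> 0" "c \<le> 0" "b \<le> 0" "d \<le> 0" | "0 \<le> a" "0 \<le> c" "b \<le> 0" "d \<le> 0" by blast
    then show ?thesis
    proof cases
      case 1 then show ?thesis by (intro exI[of _ 0]) (simp add: nonneg_def abcd)
    next
      case 2 then show ?thesis by (intro exI[of _ 1]) (simp add: nonneg_def abcd rot_def)
    next
      case 3 then show ?thesis by (intro exI[of _ 2]) (simp add: nonneg_def abcd rot_def numeral_2_eq_2)
    next
      case 4 then show ?thesis by (intro exI[of _ 3]) (simp add: nonneg_def abcd rot_def numeral_3_eq_3)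
    qed
  qed
  show ?thesis
  proof (cases "0 \<le> g $ 1 $ 1 * g $ 2 $ 1 \<and> 0 \<le> g $ 1 $ 2 * g $ 2 $ 2")
    case True
    then obtain j where "j \<le> 3" "nonneg (g ** rotp j)" using cols by blast
    then show ?thesis by (intro exI[of _ 0]) auto
  next
    case False
    have "0 \<le> (g $ 1 $ 1 * g $ 2 $ 1) * (g $ 1 $ 2 * g $ 2 $ 2)"
      using same_signs assms by (simp add: SL2Z_iff)
    then have "g $ 1 $ 1 * g $ 2 $ 1 \<le> 0 \<and> g $ 1 $ 2 * g $ 2 $ 2 \<le> 0"
      using False zero_le_mult_iff[of "g $ 1 $ 1 * g $ 2 $ 1" "g $ 1 $ 2 * g $ 2 $ 2"] by linarith
    then have "0 \<le> (rotp 1 ** g) $ 1 $ 1 * (rotp 1 ** g) $ 2 $ 1" "0 \<le> (rotp 1 ** g) $ 1 $ 2 * (rotp 1 ** g) $ 2 $ 2"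
      by (simp_all add: rot_def mult.commute)
    from cols[OF this] show ?thesis by (intro exI[of _ 1]) auto
  qed
qed

text \<open>Up to powers of \<open>rot\<close>, \<open>g\<close> is a positive word. The 32 is 4
  times the at most 8 rotations that recover \<open>g\<close> from it. The 25 consists of 12 for
  each of the two powers of \<open>rot\<close> and of the 1 in the exponent of
  \<open>word_nonneg\<close>.\<close>

lemma tlen_bounds:
  assumes g: "g \<in> SL2Z"
  shows "finite (sep (mat 1) g)" "mnorm g \<le> 2 ^ (tlen g + 25)" "tlen g \<le> 4 * mnorm g + 32"
proof -
  obtain i j where ij: "i \<le> 3" "j \<le> 3" "nonneg (rotp i ** g ** rotp j)" using to_nonneg[OF g] by blast
  define A where "A = rotp i ** g ** rotp j"
  have A: "A \<in> SL2Z" "nonneg A" "mnorm A = mnorm g"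
    using ij g by (auto simp: A_def mult_SL2Z rotp_SL2Z mnorm_rotp)
  obtain ws where ws: "set ws \<subseteq> {up, low}" "A = matprod ws" "length ws \<le> mnorm g"
    using nonneg_word[OF A(1,2)] A(3) by auto
  let ?vs = "replicate (4 - i) rot @ ws @ replicate (4 - j) rot"
  have "rotp (4 - i) ** rotp i = mat 1" "rotp j ** rotp (4 - j) = mat 1"
    using ij by (simp_all add: rotp_add rotp_4)
  then have "rotp (4 - i) ** A ** rotp (4 - j) = g"
    unfolding A_def by (simp add: matrix_mul_assoc) (simp flip: matrix_mul_assoc)
  then have "matprod ?vs = g" by (simp add: matprod_append ws(2) matrix_mul_assoc)
  moreover have "set ?vs \<subseteq> {rot, up, low}" using ws by auto
  ultimately have *: "finite (sep (mat 1) g)" "tlen g \<le> 4 * length ?vs" using tlen_word[of ?vs] by auto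
  then show "finite (sep (mat 1) g)" "tlen g \<le> 4 * mnorm g + 32" using ws(3) by auto
  have r: "finite (sep (mat 1) (rotp i)) \<and> tlen (rotp i) \<le> 4 * i" for i
    using tlen_word[of "replicate i rot"] set_replicate_conv_if[of i rot] by (auto split: if_splits)
  have 1: "finite (sep (mat 1) (rotp i ** g)) \<and> tlen (rotp i ** g) \<le> tlen (rotp i) + tlen g"
    by (rule sep_finite_mult) (use r * rotp_SL2Z in auto)
  have "tlen A \<le> tlen (rotp i ** g) + tlen (rotp j)" unfolding A_def
    using sep_finite_mult[of "rotp i ** g" "rotp j"] 1 r g by (auto simp: mult_SL2Z rotp_SL2Z)
  then have "length ws \<le> tlen g + 24"
    using word_length_le[OF ws(1), folded ws(2)] 1 r[of i] r[of j] ij by linarith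
  then have "length ws + 1 \<le> tlen g + 25" by simp
  then have "(2 :: nat) ^ (length ws + 1) \<le> 2 ^ (tlen g + 25)" by (rule power_increasing) simp
  then show "mnorm g \<le> 2 ^ (tlen g + 25)" using word_nonneg[OF ws(1)] A ws(2) by auto
qed

lemma sep_finite: "g \<in> SL2Z \<Longrightarrow> h \<in> SL2Z \<Longrightarrow> finite (sep g h)"
  using sep_translate[of g "mat 1" "adj g ** h"] tlen_bounds(1)[of "adj g ** h"]
  by (simp add: mult_adj_cancel mult_SL2Z adj_SL2Z)

lemma tdist_triangle:
  assumes "g \<in> SL2Z" "h \<in> SL2Z" "x \<in> SL2Z"
  shows "tdist g h \<le> tdist g x + tdist x h"
  unfolding tdist_def
  by (rule order_trans[OF card_mono[OF _ sep_triangle] card_Un_le]) (simp add: sep_finite assms)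

section \<open>Balls in the tree metric\<close>

definition tball :: "nat \<Rightarrow> mat2 set" where
  "tball R = {g \<in> SL2Z. tlen g \<le> R}"

lemma tball_card: "finite (tball R) \<and> card (tball R) \<le> (2 * 2 ^ (R + 25) + 1) ^ 4"
proof -
  define E :: int where "E = 2 ^ (R + 25)"
  let ?f = "\<lambda>g :: mat2. (g $ 1 $ 1, g $ 1 $ 2, g $ 2 $ 1, g $ 2 $ 2)"
  have inj: "inj_on ?f (tball R)" by (auto simp: inj_on_def mat2_eq_iff)
  have "?f g \<in> {-E..E} \<times> {-E..E} \<times> {-E..E} \<times> {-E..E}" if "g \<in> tball R" for g
  proof -
    have "mnorm g \<le> 2 ^ (tlen g + 25)" "tlen g + 25 \<le> R + 25" using that tlen_bounds by (auto simp: tball_def)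
    then have "mnorm g \<le> 2 ^ (R + 25)" by (meson le_trans one_le_numeral power_increasing)
    then have "int (mnorm g) \<le> E" unfolding E_def by (metis of_nat_le_iff of_nat_numeral of_nat_power)
    then show ?thesis by (auto simp: mnorm_def)
  qed
  then have sub: "?f ` tball R \<subseteq> {-E..E} \<times> {-E..E} \<times> {-E..E} \<times> {-E..E}" by blast
  have fin: "finite ({-E..E} \<times> {-E..E} \<times> {-E..E} \<times> {-E..E})" by simp
  have "nat (2 * E + 1) = 2 * 2 ^ (R + 25) + 1"
    by (simp add: E_def nat_add_distrib nat_mult_distrib nat_power_eq)
  moreover have "card {-E..E} = nat (2 * E + 1)" by (simp add: algebra_simps)
  ultimately have "card ({-E..E} \<times> {-E..E} \<times> {-E..E} \<times> {-E..E}) = (2 * 2 ^ (R + 25) + 1) ^ 4"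
    by (simp only: card_cartesian_product) (simp add: power4_eq_xxxx mult.assoc)
  then show ?thesis
    using card_mono[OF fin sub] card_image[OF inj] finite_imageD[OF finite_subset[OF sub fin] inj] by simp
qed

lemma tball_finite: "finite (tball R)"
  using tball_card by blast

section \<open>Pumping factorizations\<close>

lemma first_crossing:
  fixes n :: nat
  assumes "P 0" "\<not> P n"
  shows "\<exists>i<n. P i \<and> \<not> P (Suc i)"
  using assms
proof (induction n)
  case (Suc n)
  show ?case
  proof (cases "P n")
    case True
    then show ?thesis using Suc.prems by (intro exI[of _ n]) simp
  next
    case False
    then obtain i where "i < n" "P i" "\<not> P (Suc i)" using Suc by blast
    then show ?thesis by (intro exI[of _ i]) simp
  qed
qed simp

text \<open>The prefixes form a walk with steps of length at most \<open>R\<close>. At a step where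
  it ceases to be nearer to the start than to the end, the four-point condition bounds the distance
  from the start after the step plus the distance to the end before it by \<open>2 * R\<close>. One
  of the two is at most \<open>R\<close>; splitting there works, as the opposite distance at the
  same point is no larger.\<close>

lemma tball_split:
  assumes ws: "set ws \<subseteq> tball R" "matprod ws \<in> tball R" "2 \<le> length ws"
  shows "\<exists>us vs. ws = us @ vs \<and> us \<noteq> [] \<and> vs \<noteq> [] \<and> matprod us \<in> tball R \<and> matprod vs \<in> tball R"
proof -
  define n where "n = length ws"
  define p where "p i = matprod (take i ws)" for i
  define q where "q i = matprod (drop i ws)" for i
  have wsS: "set ws \<subseteq> SL2Z" using ws by (auto simp: tball_def)
  have S: "p i \<in> SL2Z" "q i \<in> SL2Z" for i
    unfolding p_def q_def using wsS set_take_subset set_drop_subset by (metis matprod_SL2Z subset_trans)+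
  have pq: "p i ** q i = p n" for i unfolding p_def q_def n_def by (simp flip: matprod_append)
  have ends: "p 0 = mat 1" "q 0 = p n" "q n = mat 1" by (simp_all add: p_def q_def n_def)
  have b: "tdist (p i) (p n) = tlen (q i)" for i
    using tdist_translate[OF S(1), of i "mat 1" "q i"] pq by simp
  have st: "tdist (p i) (p (Suc i)) \<le> R" if "i < n" for i
  proof -
    have "p (Suc i) = p i ** ws ! i" using that
      by (simp add: p_def n_def take_Suc_conv_app_nth matprod_append)
    then have "tdist (p i) (p (Suc i)) = tlen (ws ! i)"
      using tdist_translate[OF S(1), of i "mat 1" "ws ! i"] by simp
    moreover have "ws ! i \<in> tball R" using ws(1) that by (auto simp: n_def)
    ultimately show ?thesis by (simp add: tball_def)
  qed
  have D: "tlen (p n) \<le> R" using ws(2) by (simp add: p_def n_def tball_def)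
  have "\<exists>i. 0 < i \<and> i < n \<and> tlen (p i) \<le> R \<and> tlen (q i) \<le> R"
  \<comment> \<open>If start and end have distance 0 there need not be a crossing, but the first
    factor can be split off.\<close>
  proof (cases "tlen (p n) = 0")
    case True
    have "tdist (p 1) (p n) \<le> tdist (p 1) (p 0) + tdist (p 0) (p n)"
      using S by (intro tdist_triangle) auto
    moreover have "tdist (p 1) (p 0) = tdist (p 0) (p 1)" using tdist_sym S by blast
    moreover have "tdist (p 0) (p 1) \<le> R" using st[of 0] ws(3) by (force simp: n_def)
    ultimately show ?thesis using True ws(3) b ends by (intro exI[of _ 1]) (simp add: n_def)
  next
    case False
    obtain i where i: "i < n" "tlen (p i) < tlen (q i)" "\<not> tlen (p (Suc i)) < tlen (q (Suc i))"
      using first_crossing[of "\<lambda>i. tlen (p i) < tlen (q i)" n] False ends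
      by (auto simp: tdist_def sep_def)
    \<comment> \<open>The second alternative contradicts the choice of \<open>i\<close>: the point
      \<open>i\<close> is strictly nearer to the start and the point \<open>Suc i\<close> is
      not.\<close>
    have four: "tdist (p 0) (p (Suc i)) + tdist (p i) (p n) \<le> tdist (p 0) (p n) + tdist (p i) (p (Suc i)) \<or>
      tdist (p 0) (p (Suc i)) + tdist (p i) (p n) \<le> tdist (p 0) (p i) + tdist (p n) (p (Suc i))"
      using S by (intro four_point sep_finite)
    moreover have "tdist (p n) (p (Suc i)) = tlen (q (Suc i))" using b tdist_sym S by metis
    ultimately have *: "tlen (p (Suc i)) + tlen (q i) \<le> tlen (p n) + tdist (p i) (p (Suc i))"
      using i b ends by auto
    show ?thesis
    proof (cases "0 < i \<and> tlen (q i) \<le> R")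
      case True
      then show ?thesis using i by (intro exI[of _ i]) auto
    next
      case F: False
      have "tlen (p (Suc i)) \<le> R"
      proof (cases "i = 0")
        case True
        then show ?thesis using st[of 0] i ends by simp
      next
        case False
        then show ?thesis using F * D st[OF i(1)] by linarith
      qed
      moreover have "Suc i < n"
      proof (rule ccontr)
        assume "\<not> Suc i < n"
        then have "Suc i = n" using i by simp
        then have "tlen (q i) \<le> R" using * st[OF i(1)] by simp
        then show False using F ws(3) \<open>Suc i = n\<close> by (auto simp: n_def)
      qed
      ultimately show ?thesis using i by (intro exI[of _ "Suc i"]) auto
    qed
  qed
  then obtain i where i: "0 < i" "i < n" "tlen (p i) \<le> R" "tlen (q i) \<le> R" by blast
  then show ?thesis using S
    by (intro exI[of _ "take i ws"] exI[of _ "drop i ws"]) (auto simp: tball_def p_def q_def n_def)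
qed

text \<open>\<open>A\<close> consists of the values of the factors that enclose \<open>ws\<close>; the ball leaves room for \<open>j\<close> more.\<close>

lemma tball_nested:
  assumes "A \<subseteq> tball R" "card (tball R - A) \<le> j" "ws \<noteq> []" "set ws \<subseteq> tball R" "matprod ws \<in> tball R" "2 ^ j \<le> length ws"
  shows "(\<exists>u v x. ws = u @ v @ x \<and> v \<noteq> [] \<and> matprod v \<in> A) \<or>
    (\<exists>u v w x y. ws = u @ v @ w @ x @ y \<and> w \<noteq> [] \<and> v @ x \<noteq> [] \<and> matprod (v @ w @ x) = matprod w)"
  using assms
proof (induction j arbitrary: A ws)
  case 0
  then have "tball R \<subseteq> A" using tball_finite[of R] by auto
  then show ?case using 0 by (intro disjI1 exI[of _ "[]"] exI[of _ ws] exI[of _ "[]"]) simp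
next
  case (Suc j)
  show ?case
  proof (cases "matprod ws \<in> A")
    case True
    then show ?thesis using Suc.prems(3) by (intro disjI1 exI[of _ "[]"] exI[of _ ws] exI[of _ "[]"]) simp
  next
    case False
    let ?A = "insert (matprod ws) A"
    have "tball R - ?A \<subset> tball R - A" using False Suc.prems(5) by blast
    then have "card (tball R - ?A) < card (tball R - A)" using tball_finite[of R] by (intro psubset_card_mono) auto
    then have card: "card (tball R - ?A) \<le> j" using Suc.prems(2) by simp
    have "1 \<le> (2 :: nat) ^ j" by simp
    then have "2 \<le> length ws" using Suc.prems(6) unfolding power_Suc by linarith
    then obtain us vs where split: "ws = us @ vs" "us \<noteq> []" "vs \<noteq> []" "matprod us \<in> tball R" "matprod vs \<in> tball R"
      using tball_split[OF Suc.prems(4,5)] by blast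
    have "2 ^ j \<le> length us \<or> 2 ^ j \<le> length vs" using Suc.prems(6) split(1) by auto
    then have "\<exists>a zs b. ws = a @ zs @ b \<and> zs \<noteq> [] \<and> matprod zs \<in> tball R \<and> 2 ^ j \<le> length zs \<and> a @ b \<noteq> []"
    proof
      assume "2 ^ j \<le> length us"
      then show ?thesis using split by (intro exI[of _ "[]"] exI[of _ us] exI[of _ vs] conjI) simp_all
    next
      assume "2 ^ j \<le> length vs"
      then show ?thesis using split by (intro exI[of _ us] exI[of _ vs] exI[of _ "[]"] conjI) simp_all
    qed
    then obtain a zs b where zs: "ws = a @ zs @ b" "zs \<noteq> []" "matprod zs \<in> tball R" "2 ^ j \<le> length zs" "a @ b \<noteq> []"
      by blast
    then have "set zs \<subseteq> tball R" using Suc.prems(4) by auto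
    moreover have "?A \<subseteq> tball R" using Suc.prems(1,5) by simp
    ultimately have "(\<exists>u v x. zs = u @ v @ x \<and> v \<noteq> [] \<and> matprod v \<in> ?A) \<or>
        (\<exists>u v w x y. zs = u @ v @ w @ x @ y \<and> w \<noteq> [] \<and> v @ x \<noteq> [] \<and> matprod (v @ w @ x) = matprod w)"
      using Suc.IH[OF _ card zs(2) _ zs(3,4)] by blast
    then show ?thesis
    proof (elim disjE exE conjE)
      fix u v x assume v: "zs = u @ v @ x" "v \<noteq> []" "matprod v \<in> ?A"
      show ?thesis
      proof (cases "matprod v \<in> A")
        case True
        then show ?thesis using v zs(1) by (intro disjI1 exI[of _ "a @ u"] exI[of _ v] exI[of _ "x @ b"]) simp
      next
        \<comment> \<open>Now \<open>v\<close> is a proper infix with the same value as the whole of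
          \<open>ws\<close>, so the factors around it can be pumped.\<close>
        case False
        then have "ws = [] @ (a @ u) @ v @ (x @ b) @ [] \<and> v \<noteq> [] \<and> (a @ u) @ (x @ b) \<noteq> [] \<and>
            matprod ((a @ u) @ v @ (x @ b)) = matprod v" using zs(1,5) v by auto
        then show ?thesis by blast
      qed
    next
      fix u v w x y assume "zs = u @ v @ w @ x @ y" "w \<noteq> []" "v @ x \<noteq> []" "matprod (v @ w @ x) = matprod w"
      then have "ws = (a @ u) @ v @ w @ x @ (y @ b) \<and> w \<noteq> [] \<and> v @ x \<noteq> [] \<and> matprod (v @ w @ x) = matprod w"
        using zs(1) by simp
      then show ?thesis by blast
    qed
  qed
qed

text \<open>Descend into a part that still has \<open>K\<close> factors until fewer than
  \<open>2 * K\<close> remain. This keeps the pumped factors few, so that pumping down a long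
  factorization does not jump below the search interval.\<close>

lemma tball_shrink:
  assumes "1 \<le> K" "set ws \<subseteq> tball R" "matprod ws \<in> tball R" "K \<le> length ws"
  shows "\<exists>a zs b. ws = a @ zs @ b \<and> matprod zs \<in> tball R \<and> K \<le> length zs \<and> length zs < 2 * K"
  using assms(2-)
proof (induction "length ws" arbitrary: ws rule: less_induct)
  case less
  show ?case
  proof (cases "length ws < 2 * K")
    case True
    then show ?thesis using less.prems by (intro exI[of _ "[]"] exI[of _ ws] exI[of _ "[]"]) simp
  next
    case False
    then have "2 \<le> length ws" using assms(1) by simp
    then obtain us vs where split: "ws = us @ vs" "us \<noteq> []" "vs \<noteq> []" "matprod us \<in> tball R" "matprod vs \<in> tball R"
      using tball_split[OF less.prems(1,2)] by blast
    have "K \<le> length us \<or> K \<le> length vs" using False split(1) by auto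
    then have "\<exists>a zs b. ws = a @ zs @ b \<and> matprod zs \<in> tball R \<and> K \<le> length zs \<and> a @ b \<noteq> []"
    proof
      assume "K \<le> length us"
      then show ?thesis using split by (intro exI[of _ "[]"] exI[of _ us] exI[of _ vs] conjI) simp_all
    next
      assume "K \<le> length vs"
      then show ?thesis using split by (intro exI[of _ us] exI[of _ vs] exI[of _ "[]"] conjI) simp_all
    qed
    then obtain a zs b where zs: "ws = a @ zs @ b" "matprod zs \<in> tball R" "K \<le> length zs" "a @ b \<noteq> []"
      by blast
    moreover have "length zs < length ws" "set zs \<subseteq> tball R" using zs less.prems by auto
    ultimately obtain a' zs' b' where "zs = a' @ zs' @ b'" "matprod zs' \<in> tball R" "K \<le> length zs'" "length zs' < 2 * K"
      using less.hyps[of zs] by blast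
    then show ?thesis using zs(1) by (intro exI[of _ "a @ a'"] exI[of _ zs'] exI[of _ "b' @ b"]) auto
  qed
qed

lemma pump:
  assumes "2 ^ card (tball R) \<le> B" "set ws \<subseteq> tball R" "matprod ws \<in> tball R" "B \<le> length ws"
  shows "\<exists>u v w x y. ws = u @ v @ w @ x @ y \<and> w \<noteq> [] \<and> v @ x \<noteq> [] \<and> length (v @ x) < 2 * B \<and>
    matprod (v @ w @ x) = matprod w"
proof -
  have B: "1 \<le> B" using assms(1) by (meson le_trans one_le_numeral one_le_power)
  then obtain a zs b where zs: "ws = a @ zs @ b" "matprod zs \<in> tball R" "B \<le> length zs" "length zs < 2 * B"
    using tball_shrink[OF B assms(2-)] by blast
  then have "zs \<noteq> []" "set zs \<subseteq> tball R" "2 ^ card (tball R - {}) \<le> length zs" using B assms by auto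
  from tball_nested[OF _ order_refl this(1,2) zs(2) this(3)] obtain u v w x y where
    z: "zs = u @ v @ w @ x @ y" "w \<noteq> []" "v @ x \<noteq> []" "matprod (v @ w @ x) = matprod w" by auto
  have "ws = (a @ u) @ v @ w @ x @ (y @ b)" "length (v @ x) < 2 * B" using zs by (auto simp: z(1))
  with z(2-) show ?thesis by blast
qed

lemma matprod_replace: "matprod v = matprod w \<Longrightarrow> matprod (u @ v @ y) = matprod (u @ w @ y)"
  by (simp add: matprod_append)

text \<open>A shortest factorization among those of length at least \<open>B\<close> is shorter than
  \<open>3 * B\<close>: otherwise pumping down would remove fewer than \<open>2 * B\<close> factors
  and leave a shorter one of length at least \<open>B\<close>.\<close>

theorem infinite_factorizations_iff:
  assumes G: "finite G" "G \<subseteq> tball R" "M \<in> tball R" and B: "2 ^ card (tball R) \<le> B"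
  shows "infinite (factorizations G M) \<longleftrightarrow> (\<exists>ws\<in>factorizations G M. B \<le> length ws \<and> length ws < 3 * B)"
proof
  assume inf: "infinite (factorizations G M)"
  have "\<exists>ws\<in>factorizations G M. B \<le> length ws"
  proof (rule ccontr)
    assume "\<not> ?thesis"
    then have "factorizations G M \<subseteq> {ws. set ws \<subseteq> G \<and> length ws \<le> B}"
      by (auto simp: factorizations_def not_le intro: less_imp_le)
    then show False using inf finite_lists_length_le[OF G(1)] finite_subset by blast
  qed
  then obtain ws where ws: "ws \<in> factorizations G M \<and> B \<le> length ws"
    and min: "\<And>vs. vs \<in> factorizations G M \<and> B \<le> length vs \<Longrightarrow> length ws \<le> length vs"
    using ex_has_least_nat[of "\<lambda>ws. ws \<in> factorizations G M \<and> B \<le> length ws" _ length] by blast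
  have "length ws < 3 * B"
  proof (rule ccontr)
    assume long: "\<not> length ws < 3 * B"
    have sub: "set ws \<subseteq> tball R" "matprod ws \<in> tball R" "B \<le> length ws"
      using ws G by (auto simp: factorizations_def)
    then obtain u v w x y where z: "ws = u @ v @ w @ x @ y" "w \<noteq> []" "v @ x \<noteq> []" "length (v @ x) < 2 * B"
      "matprod (v @ w @ x) = matprod w" using pump[OF B sub] by (elim exE conjE) (rule that)
    have "matprod (u @ w @ y) = matprod ws"
      using matprod_replace[OF z(5), of u y] by (simp add: z(1))
    then have "u @ w @ y \<in> factorizations G M" using ws z by (auto simp: factorizations_def)
    moreover have "B \<le> length (u @ w @ y)" using long z by auto
    ultimately have "length ws \<le> length (u @ w @ y)" using min by blast
    then show False using z by auto
  qed
  then show "\<exists>ws\<in>factorizations G M. B \<le> length ws \<and> length ws < 3 * B" using ws by blast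
next
  assume "\<exists>ws\<in>factorizations G M. B \<le> length ws \<and> length ws < 3 * B"
  then obtain ws where ws: "ws \<in> factorizations G M" "B \<le> length ws" by blast
  have sub: "set ws \<subseteq> tball R" "matprod ws \<in> tball R" "B \<le> length ws"
      using ws G by (auto simp: factorizations_def)
  then obtain u v w x y where z: "ws = u @ v @ w @ x @ y" "w \<noteq> []" "v @ x \<noteq> []"
    "matprod (v @ w @ x) = matprod w" using pump[OF B sub] by (elim exE conjE) (rule that)
  define f where "f n = u @ concat (replicate n v) @ w @ concat (replicate n x) @ y" for n
  have mid: "matprod (concat (replicate n v) @ w @ concat (replicate n x)) = matprod w" for n
  proof (induction n)
    case (Suc n)
    have "concat (replicate (Suc n) x) = concat (replicate n x) @ x"
      by (induction n) auto
    then have "concat (replicate (Suc n) v) @ w @ concat (replicate (Suc n) x) =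
        v @ (concat (replicate n v) @ w @ concat (replicate n x)) @ x" by simp
    then have "matprod (concat (replicate (Suc n) v) @ w @ concat (replicate (Suc n) x)) = matprod (v @ w @ x)"
      using matprod_replace[OF Suc, of v x] by metis
    then show ?case using z(4) by simp
  qed simp
  have "f n \<in> factorizations G M" for n
  proof -
    have "matprod (f n) = matprod (u @ w @ y)"
      using matprod_replace[OF mid[of n], of u y] by (simp add: f_def)
    also have "\<dots> = matprod ws"
      using matprod_replace[OF z(4), of u y] by (simp add: z(1))
    finally show ?thesis using ws z by (auto simp: factorizations_def f_def)
  qed
  moreover have "inj f"
  proof (rule injI)
    fix m n assume "f m = f n"
    then have "length (f m) = length (f n)" by simp
    moreover have "length (f n) = n * length (v @ x) + length (u @ w @ y)" for n
      by (simp add: f_def length_concat sum_list_replicate algebra_simps)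
    ultimately have "m * length (v @ x) = n * length (v @ x)" by simp
    then show "m = n" using z(3) by auto
  qed
  ultimately have "range f \<subseteq> factorizations G M" "infinite (range f)"
    by (auto dest: range_inj_infinite)
  then show "infinite (factorizations G M)" using finite_subset by metis
qed

section \<open>Telescoping products\<close>

text \<open>\<open>edge a s b\<close> is the product of the unipotent matrices (1 a; 0 1), (1 0; s 1) and (1 b; 0 1).\<close>

definition edge :: "int \<Rightarrow> int \<Rightarrow> int \<Rightarrow> mat2" where
  "edge a s b = mk (1 + a * s) (a + b + a * s * b) s (1 + s * b)"

lemma edge_SL2Z: "edge a s b \<in> SL2Z"
  by (simp add: edge_def mk_SL2Z algebra_simps)

lemma edge_merge: "edge a s b ** edge (- b) t c = edge a (s + t) c"
  by (simp add: edge_def mat2_eq_iff algebra_simps)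

lemma edge_act:
  "(edge a s b ** A) $ 2 $ 1 = A $ 2 $ 1 + s * (A $ 1 $ 1 + b * A $ 2 $ 1)"
  "(edge a s b ** A) $ 1 $ 1 = A $ 1 $ 1 + b * A $ 2 $ 1 + a * (A $ 2 $ 1 + s * (A $ 1 $ 1 + b * A $ 2 $ 1))"
  by (simp_all add: edge_def algebra_simps)

text \<open>
  An arrow at stage \<open>j\<close> with sign \<open>e\<close> cancels against its successor exactly if that is an arrow
  at stage \<open>j + 1\<close> with the opposite sign. The two signs give two disjoint copies of the same
  path, whose complete products with vanishing sum are mutually inverse.
\<close>

definition arrow :: "int \<times> nat \<times> nat \<Rightarrow> mat2" where
  "arrow = (\<lambda>(e, j, s). edge (e * 2 ^ (j + 1)) (e * int s) (e * 2 ^ (j + 2)))"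

definition arrows :: "nat \<Rightarrow> (nat \<Rightarrow> nat set) \<Rightarrow> (int \<times> nat \<times> nat) set" where
  "arrows N opt = {1, -1} \<times> (SIGMA j : {..<N}. opt j)"

definition chain_sum :: "(nat \<Rightarrow> nat) \<Rightarrow> nat \<Rightarrow> nat \<Rightarrow> int" where
  "chain_sum s j k = (\<Sum>i=j..<k. (-1) ^ i * int (s i))"

text \<open>The right exponent \<open>2 ^ (j + 2)\<close> of stage \<open>j\<close> meets the left
  exponent of stage \<open>j + 1\<close>, of equal size and opposite sign, so inner upper powers
  cancel and the lower exponents add up.\<close>

lemma arrow_path:
  assumes "e \<in> {1, -1}" "0 < k"
  shows "matprod (map (\<lambda>j. arrow (e * (-1) ^ j, j, s j)) [0..<k]) =
    edge (e * 2) (e * chain_sum s 0 k) (- e * (-1) ^ k * 2 ^ (k + 1))"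
  using assms(2)
proof (induction k)
  case (Suc k)
  show ?case
  proof (cases "k = 0")
    case True
    then show ?thesis by (simp add: arrow_def chain_sum_def)
  next
    case False
    have "matprod (map (\<lambda>j. arrow (e * (-1) ^ j, j, s j)) [0..<Suc k]) =
        edge (e * 2) (e * chain_sum s 0 k) (- e * (-1) ^ k * 2 ^ (k + 1)) ** arrow (e * (-1) ^ k, k, s k)"
      using Suc False by (simp add: matprod_append)
    also have "arrow (e * (-1) ^ k, k, s k) =
        edge (- (- e * (-1) ^ k * 2 ^ (k + 1))) (e * (-1) ^ k * int (s k)) (e * (-1) ^ k * 2 ^ (k + 2))"
      by (simp add: arrow_def)
    also note edge_merge
    finally show ?thesis by (simp add: chain_sum_def algebra_simps)
  qed
qed simp

lemma arrows_identity:
  assumes N: "0 < N" and s: "\<And>j. j < N \<Longrightarrow> s j \<in> opt j" "chain_sum s 0 N = 0"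
  shows "\<exists>z. z \<noteq> [] \<and> set z \<subseteq> arrow ` arrows N opt \<and> matprod z = mat 1"
proof -
  define z where "z e = map (\<lambda>j. arrow (e * (-1) ^ j, j, s j)) [0..<N]" for e
  have "matprod (z 1 @ z (-1)) = mat 1"
    using arrow_path[of 1 N s] arrow_path[of "-1" N s] N s(2)
    by (simp add: z_def matprod_append edge_def mat2_eq_iff)
  moreover have "(e * (-1) ^ j, j, s j) \<in> arrows N opt" if "e \<in> {1, -1}" "j < N" for e j
    using that s(1) by (cases "even j") (auto simp: arrows_def)
  then have "set (z e) \<subseteq> arrow ` arrows N opt" if "e \<in> {1, -1}" for e
    using that by (fastforce simp: z_def)
  then have "set (z 1 @ z (-1)) \<subseteq> arrow ` arrows N opt" by (simp only: set_append Un_subset_iff) simp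
  moreover have "z 1 @ z (-1) \<noteq> []" using N by (simp add: z_def)
  ultimately show ?thesis by blast
qed

lemma identity_infinite:
  assumes "z \<noteq> []" "set z \<subseteq> G" "matprod z = mat 1" "M \<in> semigroup_gen G"
  shows "infinite (factorizations G M)"
proof -
  obtain w where w: "w \<noteq> []" "set w \<subseteq> G" "M = matprod w" using assms(4) by (auto simp: semigroup_gen_def)
  define f where "f n = concat (replicate n z) @ w" for n
  have one: "matprod (concat (replicate n z)) = mat 1" for n
    by (induction n) (simp_all add: matprod_append assms(3))
  have "f n \<in> factorizations G M" for n
    using one[of n] w assms(2) by (auto simp: f_def factorizations_def matprod_append)
  moreover have "inj f"
  proof (rule injI)
    fix m n assume "f m = f n"
    then have "length (f m) = length (f n)" by simp
    then show "m = n" using assms(1) by (simp add: f_def length_concat sum_list_replicate)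
  qed
  ultimately have "range f \<subseteq> factorizations G M" "infinite (range f)"
    by (auto dest: range_inj_infinite)
  then show ?thesis using finite_subset by metis
qed

lemma even_nonzero_abs: "even x \<Longrightarrow> x \<noteq> 0 \<Longrightarrow> 2 \<le> \<bar>x\<bar>" for x :: int
  by presburger

text \<open>
  If no chain sum vanishes, then the maximal chains of a product act on the vector (1, 0) by
  ping-pong, so that the lower left entry bounds their number.
\<close>

lemma arrows_growth:
  assumes nz: "\<forall>j k s. j < k \<and> k \<le> N \<and> (\<forall>i. j \<le> i \<and> i < k \<longrightarrow> s i \<in> opt i) \<longrightarrow> chain_sum s j k \<noteq> 0"
    and ev: "\<forall>j<N. \<forall>s\<in>opt j. even s"
    and w: "set w \<subseteq> arrows N opt" "w = (e, j, s0) # w'"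
  shows "\<exists>k s p q. j < k \<and> k \<le> N \<and> (\<forall>i. j \<le> i \<and> i < k \<longrightarrow> s i \<in> opt i) \<and> \<bar>q\<bar> < \<bar>p\<bar> \<and>
     int (length w) \<le> int N * (\<bar>p\<bar> - 1) + int (k - j) \<and>
     matprod (map arrow w) $ 2 $ 1 = q + e * (-1) ^ j * chain_sum s j k * p \<and>
     matprod (map arrow w) $ 1 $ 1 = p + e * 2 ^ (j + 1) * (q + e * (-1) ^ j * chain_sum s j k * p)"
  using w
proof (induction w arbitrary: e j s0 w')
  case (Cons g w)
  have g: "g = (e, j, s0)" "w = w'" using Cons.prems by auto
  have e: "e = 1 \<or> e = -1" "j < N" "s0 \<in> opt j" using Cons.prems by (auto simp: arrows_def)
  have sq: "(-1) ^ j * (-1) ^ j = (1 :: int)" by (simp flip: power_mult_distrib)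
  show ?case
  proof (cases w)
    case Nil
    \<comment> \<open>The witnesses 1 and 0 for \<open>p\<close> and \<open>q\<close> are the vector
      (1, 0) before the single arrow acts.\<close>
    show ?thesis
      by (rule exI[of _ "Suc j"], rule exI[of _ "\<lambda>_. s0"], rule exI[of _ 1], rule exI[of _ 0])
        (use e Nil sq in \<open>auto simp: g arrow_def edge_def chain_sum_def le_less_Suc_eq\<close>)
  next
    case (Cons g' w'')
    obtain e' j' s' where g': "g' = (e', j', s')" by (cases g')
    have e': "e' = 1 \<or> e' = -1" "j' < N" using Cons.prems Cons g' by (auto simp: arrows_def)
    have "set w \<subseteq> arrows N opt" "w = (e', j', s') # w''" using Cons.prems Cons g' by auto
    from Cons.IH[OF this] obtain k s p q where
      IH: "j' < k" "k \<le> N" "\<forall>i. j' \<le> i \<and> i < k \<longrightarrow> s i \<in> opt i" "\<bar>q\<bar> < \<bar>p\<bar>"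
        "int (length w) \<le> int N * (\<bar>p\<bar> - 1) + int (k - j')"
      and lo: "matprod (map arrow w) $ 2 $ 1 = q + e' * (-1) ^ j' * chain_sum s j' k * p"
      and up: "matprod (map arrow w) $ 1 $ 1 = p + e' * 2 ^ (j' + 1) * (q + e' * (-1) ^ j' * chain_sum s j' k * p)"
      by blast
    define S where "S = e' * (-1) ^ j' * chain_sum s j' k"
    define y where "y = q + S * p"
    define d where "d = e * 2 ^ (j + 2) + e' * 2 ^ (j' + 1)"
    define x where "x = p + d * y"
    have "matprod (map arrow w) $ 1 $ 1 + e * 2 ^ (j + 2) * matprod (map arrow w) $ 2 $ 1 = x"
      unfolding up lo x_def y_def d_def S_def by (simp add: algebra_simps)
    moreover have "matprod (map arrow w) $ 2 $ 1 = y" unfolding lo y_def S_def by simp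
    ultimately have low: "matprod (map arrow (g # w)) $ 2 $ 1 = y + e * int s0 * x"
      and upp: "matprod (map arrow (g # w)) $ 1 $ 1 = x + e * 2 ^ (j + 1) * (y + e * int s0 * x)"
      unfolding g(1) list.map matprod_Cons arrow_def prod.case edge_act by simp_all
    show ?thesis
    \<comment> \<open>\<open>d\<close> is the exponent of the upper unipotent matrix between the two
      arrows; it vanishes exactly if the second arrow continues the chain of the first.\<close>
    proof (cases "d = 0")
      case True
      define P Q :: int where "P = 2 ^ (j + 2)" and "Q = 2 ^ (j' + 1)"
      have PQ: "0 < P" "0 < Q" "e * P + e' * Q = 0" using True by (simp_all add: P_def Q_def d_def)
      have "\<not> (e = 1 \<and> e' = 1)" "\<not> (e = -1 \<and> e' = -1)" using PQ by auto
      then have "e' = - e" using e(1) e'(1) by auto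
      moreover have "P = Q" using PQ(3) e(1) calculation by auto
      then have "j + 2 = j' + 1"
        unfolding P_def Q_def by (intro iffD1[OF power_inject_exp, of "2 :: int"]) simp_all
      then have "j' = Suc j" by simp
      ultimately have S: "S = e * (-1) ^ j * chain_sum s (Suc j) k" by (simp add: S_def)
      define s1 where "s1 = s(j := s0)"
      have "chain_sum s1 j k = (-1) ^ j * int s0 + chain_sum s1 (Suc j) k"
        using IH(1) \<open>j' = Suc j\<close> by (simp add: chain_sum_def s1_def sum.atLeast_Suc_lessThan)
      also have "chain_sum s1 (Suc j) k = chain_sum s (Suc j) k"
        unfolding chain_sum_def by (intro sum.cong) (auto simp: s1_def)
      finally have "e * (-1) ^ j * chain_sum s1 j k = e * ((-1) ^ j * (-1) ^ j) * int s0 + S"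
        by (simp add: S algebra_simps)
      then have sum: "e * (-1) ^ j * chain_sum s1 j k = e * int s0 + S" by (simp only: sq mult_1_right)
      have "x = p" using True by (simp add: x_def)
      show ?thesis
      proof (rule exI[of _ k], rule exI[of _ s1], rule exI[of _ p], rule exI[of _ q], intro conjI)
        show "j < k" "k \<le> N" "\<bar>q\<bar> < \<bar>p\<bar>" using IH \<open>j' = Suc j\<close> by auto
        show "\<forall>i. j \<le> i \<and> i < k \<longrightarrow> s1 i \<in> opt i" using IH(3) e \<open>j' = Suc j\<close> by (auto simp: s1_def)
        show "int (length (g # w)) \<le> int N * (\<bar>p\<bar> - 1) + int (k - j)" using IH(1,5) \<open>j' = Suc j\<close> by simp
        show "matprod (map arrow (g # w)) $ 2 $ 1 = q + e * (-1) ^ j * chain_sum s1 j k * p"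
          unfolding low sum by (simp add: y_def \<open>x = p\<close> algebra_simps)
        show "matprod (map arrow (g # w)) $ 1 $ 1 = p + e * 2 ^ (j + 1) * (q + e * (-1) ^ j * chain_sum s1 j k * p)"
          unfolding upp sum by (simp add: y_def \<open>x = p\<close> algebra_simps)
      qed
    next
      case False
      have "chain_sum s j' k \<noteq> 0" using nz[THEN spec, of j', THEN spec, of k, THEN spec, of s] IH(1-3) by simp
      moreover have "even (s i)" if "j' \<le> i" "i < k" for i
        using ev[rule_format, of i "s i"] IH(2,3) that by simp
      then have "even (chain_sum s j' k)"
        unfolding chain_sum_def by (intro dvd_sum) simp
      ultimately have "S \<noteq> 0" "even S" using e' by (auto simp: S_def)
      \<comment> \<open>A nonzero even number is at least 2 in absolute value, which makes both
        ping-pong inequalities strict.\<close>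
      then have S2: "2 \<le> \<bar>S\<bar>" by presburger
      have "even d" by (simp add: d_def)
      then have d2: "2 \<le> \<bar>d\<bar>" using False by presburger
      have "2 * \<bar>p\<bar> \<le> \<bar>S * p\<bar>" using S2 by (simp add: abs_mult mult_right_mono)
      then have y: "\<bar>p\<bar> < \<bar>y\<bar>" using IH(4) unfolding y_def by linarith
      have "2 * \<bar>y\<bar> \<le> \<bar>d * y\<bar>" using d2 by (simp add: abs_mult mult_right_mono)
      then have x: "\<bar>y\<bar> < \<bar>x\<bar>" using y unfolding x_def by linarith
      \<comment> \<open>A chain has at most \<open>N\<close> arrows, and each new chain raises the
        leading coordinate by at least 1.\<close>
      have "int (length w) \<le> int N * (\<bar>p\<bar> - 1) + int N" using IH by simp
      also have "\<dots> = int N * \<bar>p\<bar>" by (simp add: algebra_simps)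
      also have "\<dots> \<le> int N * (\<bar>x\<bar> - 1)" using x y by (intro mult_left_mono) auto
      finally have len: "int (length (g # w)) \<le> int N * (\<bar>x\<bar> - 1) + 1" by simp
      have sum: "e * (-1) ^ j * chain_sum (\<lambda>_. s0) j (Suc j) = e * int s0"
        using sq by (simp add: chain_sum_def mult.assoc[symmetric])
      show ?thesis
      proof (rule exI[of _ "Suc j"], rule exI[of _ "\<lambda>_. s0"], rule exI[of _ x], rule exI[of _ y], intro conjI)
        show "j < Suc j" "Suc j \<le> N" "\<bar>y\<bar> < \<bar>x\<bar>" using e x by auto
        show "\<forall>i. j \<le> i \<and> i < Suc j \<longrightarrow> s0 \<in> opt i" using e by (auto simp: le_less_Suc_eq)
        show "int (length (g # w)) \<le> int N * (\<bar>x\<bar> - 1) + int (Suc j - j)" using len by simp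
        show "matprod (map arrow (g # w)) $ 2 $ 1 = y + e * (-1) ^ j * chain_sum (\<lambda>_. s0) j (Suc j) * x"
          unfolding low sum by simp
        show "matprod (map arrow (g # w)) $ 1 $ 1 =
            x + e * 2 ^ (j + 1) * (y + e * (-1) ^ j * chain_sum (\<lambda>_. s0) j (Suc j) * x)"
          unfolding upp sum by simp
      qed
    qed
  qed
qed simp

text \<open>The nonzero even exponent of the leading chain makes the lower left entry at least as
  large as \<open>p\<close>, and \<open>p\<close> bounds the length of the product.\<close>

lemma arrows_finite:
  assumes nz: "\<forall>j k s. j < k \<and> k \<le> N \<and> (\<forall>i. j \<le> i \<and> i < k \<longrightarrow> s i \<in> opt i) \<longrightarrow> chain_sum s j k \<noteq> 0"
    and ev: "\<forall>j<N. \<forall>s\<in>opt j. even s"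
    and fin: "\<And>j. j < N \<Longrightarrow> finite (opt j)"
  shows "finite (factorizations (arrow ` arrows N opt) M)"
proof -
  have "length As \<le> nat (int N * \<bar>M $ 2 $ 1\<bar>)" if As: "As \<in> factorizations (arrow ` arrows N opt) M" for As
  proof -
    have "As \<noteq> []" "set As \<subseteq> arrow ` arrows N opt" "matprod As = M" using As by (auto simp: factorizations_def)
    then have "As \<in> map arrow ` lists (arrows N opt)"
      unfolding lists_image[symmetric] by (intro in_listsI) blast
    then obtain w where w: "set w \<subseteq> arrows N opt" "As = map arrow w" by auto
    then obtain e j s0 w' where "w = (e, j, s0) # w'" using \<open>As \<noteq> []\<close> by (cases w) auto
    note grow = arrows_growth[OF nz ev w(1) this]
    obtain k s p q where
      *: "j < k" "k \<le> N" "\<forall>i. j \<le> i \<and> i < k \<longrightarrow> s i \<in> opt i" "\<bar>q\<bar> < \<bar>p\<bar>"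
        "int (length w) \<le> int N * (\<bar>p\<bar> - 1) + int (k - j)"
        "matprod (map arrow w) $ 2 $ 1 = q + e * (-1) ^ j * chain_sum s j k * p"
      using grow by (elim exE conjE) (rule that)
    define S where "S = e * (-1) ^ j * chain_sum s j k"
    have "chain_sum s j k \<noteq> 0" using nz[THEN spec, of j, THEN spec, of k, THEN spec, of s] *(1-3) by simp
    moreover have "even (s i)" if "j \<le> i" "i < k" for i
      using ev[rule_format, of i "s i"] *(2,3) that by simp
    then have "even (chain_sum s j k)"
      unfolding chain_sum_def by (intro dvd_sum) simp
    moreover have "e \<noteq> 0" using w(1) \<open>w = _\<close> by (auto simp: arrows_def)
    ultimately have "even S" "S \<noteq> 0" by (auto simp: S_def)
    then have "2 * \<bar>p\<bar> \<le> \<bar>S\<bar> * \<bar>p\<bar>" by (intro mult_right_mono even_nonzero_abs) auto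
    moreover have "M $ 2 $ 1 = q + S * p" using *(6) w(2) \<open>matprod As = M\<close> by (simp add: S_def)
    ultimately have "\<bar>p\<bar> \<le> \<bar>M $ 2 $ 1\<bar>" using *(4) by (simp flip: abs_mult)
    then have "int N * \<bar>p\<bar> \<le> int N * \<bar>M $ 2 $ 1\<bar>" by (intro mult_left_mono) auto
    moreover have "int N * (\<bar>p\<bar> - 1) + int (k - j) \<le> int N * \<bar>p\<bar>" using *(2) by (simp add: algebra_simps)
    ultimately show ?thesis using *(5) w(2) by simp
  qed
  then have sub: "factorizations (arrow ` arrows N opt) M \<subseteq>
      {As. set As \<subseteq> arrow ` arrows N opt \<and> length As \<le> nat (int N * \<bar>M $ 2 $ 1\<bar>)}"
    unfolding factorizations_def by blast
  have "finite (arrow ` arrows N opt)" using fin unfolding arrows_def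
    by (intro finite_imageI finite_cartesian_product finite_SigmaI) simp_all
  from finite_subset[OF sub finite_lists_length_le[OF this]] show ?thesis .
qed


section \<open>Tilings as vanishing chain sums\<close>

text \<open>
  A tile \<open>(d, u, l, r)\<close> at stage \<open>j\<close> of a helix of width \<open>W\<close> must match the tile at stage
  \<open>j + 1\<close> (\<open>r\<close> with \<open>l\<close>) and the one at stage \<open>j + W\<close> (\<open>u\<close> with \<open>d\<close>). The code 0 marks open ends.
\<close>

type_synonym tile = "nat \<times> nat \<times> nat \<times> nat"

definition tiling :: "nat \<Rightarrow> nat \<Rightarrow> (nat \<Rightarrow> tile set) \<Rightarrow> (nat \<Rightarrow> tile) \<Rightarrow> bool" where
  "tiling N W tab z \<longleftrightarrow> (\<forall>j<N. z j \<in> tab j) \<and>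
     (\<forall>j<N. case z j of (d, u, l, r) \<Rightarrow>
        (if j = 0 then l = 0 else l = snd (snd (snd (z (j - 1))))) \<and>
        (if Suc j = N then r = 0 else True) \<and>
        (if j < W then d = 0 else d = fst (snd (z (j - W)))) \<and>
        (if N \<le> j + W then u = 0 else True))"

text \<open>In base \<open>X\<close>, the digits below \<open>N + W\<close> hold vertical codes,
  those from \<open>N + W\<close> to \<open>2 * N + W\<close> horizontal ones. The code
  \<open>u\<close> shares its digit with \<open>d\<close> of stage \<open>j + W\<close>, and
  \<open>r\<close> shares its digit with \<open>l\<close> of stage \<open>j + 1\<close>. The
  constant top digit keeps weights positive and fixes the length of their binary notation; the
  factor 2 makes them even, as the ping-pong requires.\<close>

definition weight :: "nat \<Rightarrow> nat \<Rightarrow> nat \<Rightarrow> nat \<Rightarrow> tile \<Rightarrow> nat" where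
  "weight b N W j = (\<lambda>(d, u, l, r). let X = 2 ^ b in
     2 * (d * X ^ j + u * X ^ (j + W) + l * X ^ (N + W + j) + r * X ^ (N + W + j + 1) + X ^ (2 * N + W + 1)))"

text \<open>The lowest digit is divisible by the base but smaller in absolute value, hence zero;
  then divide by the base and repeat.\<close>

lemma signed_digits:
  fixes X :: int
  assumes "\<And>c. c < n \<Longrightarrow> \<bar>f c\<bar> < X" "(\<Sum>c<n. f c * X ^ c) = 0" "c < n"
  shows "f c = 0"
  using assms
proof (induction n arbitrary: f c)
  case (Suc n)
  have X: "0 < X" using Suc.prems(1)[of 0] by linarith
  have split: "(\<Sum>c<Suc n. f c * X ^ c) = f 0 + X * (\<Sum>c<n. f (Suc c) * X ^ c)"
    by (simp add: sum.lessThan_Suc_shift sum_distrib_left algebra_simps del: sum.lessThan_Suc)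
  then have "X dvd f 0" using Suc.prems(2) by (metis add.commute dvd_add_right_iff dvd_0_right dvd_triv_left)
  then have "f 0 = 0" using Suc.prems(1)[of 0] by (metis dvd_imp_le_int not_less zero_less_Suc abs_of_pos X)
  then have "(\<Sum>c<n. f (Suc c) * X ^ c) = 0" using split Suc.prems(2) X by simp
  then show ?case
    using Suc.IH[of "\<lambda>c. f (Suc c)" "c - 1"] Suc.prems(1,3) \<open>f 0 = 0\<close> by (cases c) auto
qed simp

text \<open>The signed digit \<open>c\<close> of half the chain sum, before any carries.\<close>

definition column :: "nat \<Rightarrow> nat \<Rightarrow> (nat \<Rightarrow> tile) \<Rightarrow> nat \<Rightarrow> nat \<Rightarrow> nat \<Rightarrow> int" where
  "column N W z j k c = (\<Sum>i=j..<k. (-1) ^ i * (case z i of (d, u, l, r) \<Rightarrow>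
     (if c = i then int d else 0) + (if c = i + W then int u else 0) + (if c = N + W + i then int l else 0) +
     (if c = N + W + i + 1 then int r else 0) + (if c = 2 * N + W + 1 then 1 else 0)))"

lemma chain_sum_columns:
  assumes "k \<le> N"
  shows "chain_sum (\<lambda>i. weight b N W i (z i)) j k = 2 * (\<Sum>c<2 * N + W + 2. column N W z j k c * (2 ^ b) ^ c)"
proof -
  have "int (weight b N W i (z i)) = 2 * (\<Sum>c<2 * N + W + 2. (case z i of (d, u, l, r) \<Rightarrow>
     (if c = i then int d else 0) + (if c = i + W then int u else 0) + (if c = N + W + i then int l else 0) +
     (if c = N + W + i + 1 then int r else 0) + (if c = 2 * N + W + 1 then 1 else 0)) * (2 ^ b) ^ c)"
    if "i < k" for i
  proof -
    obtain d u l r where z: "z i = (d, u, l, r)" by (cases "z i")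
    have d: "(if c = m then x else 0) * y c = (if c = m then x * y m else 0)" for c m x and y :: "nat \<Rightarrow> int"
      by simp
    have "i < N" using that assms by simp
    then show ?thesis
      by (simp add: z weight_def Let_def distrib_right sum.distrib d)
  qed
  then have "chain_sum (\<lambda>i. weight b N W i (z i)) j k = (\<Sum>i=j..<k. (-1) ^ i * (2 * (\<Sum>c<2 * N + W + 2. (case z i of (d, u, l, r) \<Rightarrow>
     (if c = i then int d else 0) + (if c = i + W then int u else 0) + (if c = N + W + i then int l else 0) +
     (if c = N + W + i + 1 then int r else 0) + (if c = 2 * N + W + 1 then 1 else 0)) * (2 ^ b) ^ c)))"
    unfolding chain_sum_def by (intro sum.cong) auto
  also have "\<dots> = 2 * (\<Sum>c<2 * N + W + 2. column N W z j k c * (2 ^ b) ^ c)"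
    unfolding column_def sum_distrib_left sum_distrib_right
    by (subst sum.swap) (intro sum.cong refl, simp only: mult_ac)
  finally show ?thesis .
qed

text \<open>Below the constant digit, each digit gets at most two contributions, from the two stages
  that have to match there.\<close>

lemma column_eq:
  assumes "k \<le> N" "0 < W"
  shows "c < N + W \<Longrightarrow> column N W z j k c =
      (if j \<le> c \<and> c < k then (-1) ^ c * int (fst (z c)) else 0) +
      (if j + W \<le> c \<and> c < k + W then (-1) ^ (c - W) * int (fst (snd (z (c - W)))) else 0)"
    and "m \<le> N \<Longrightarrow> column N W z j k (N + W + m) =
      (if j \<le> m \<and> m < k then (-1) ^ m * int (fst (snd (snd (z m)))) else 0) +
      (if j < m \<and> m \<le> k then (-1) ^ (m - 1) * int (snd (snd (snd (z (m - 1))))) else 0)"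
    and "column N W z j k (2 * N + W + 1) = (\<Sum>i=j..<k. (-1) ^ i)"
proof -
  have trm: "column N W z j k c = (\<Sum>i=j..<k. if c = i then (-1) ^ i * int (fst (z i)) else 0) +
      (\<Sum>i=j..<k. if c = i + W then (-1) ^ i * int (fst (snd (z i))) else 0) +
      (\<Sum>i=j..<k. if c = N + W + i then (-1) ^ i * int (fst (snd (snd (z i)))) else 0) +
      (\<Sum>i=j..<k. if c = N + W + i + 1 then (-1) ^ i * int (snd (snd (snd (z i)))) else 0) +
      (\<Sum>i=j..<k. if c = 2 * N + W + 1 then (-1) ^ i else 0)" for c
    unfolding column_def sum.distrib[symmetric]
    by (intro sum.cong refl) (auto split: prod.splits simp: algebra_simps)
  have delta: "(\<Sum>i=j..<k. if c = i + m then f i else 0) = (if j + m \<le> c \<and> c < k + m then f (c - m) else 0)"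
    for c m and f :: "nat \<Rightarrow> int"
  proof (cases "m \<le> c")
    case True
    then have "c = i + m \<longleftrightarrow> i = c - m" for i by auto
    then show ?thesis using True by (auto simp: sum.delta)
  next
    case False
    then show ?thesis by auto
  qed
  have zero: "(\<Sum>i=j..<k. if c = i + m then f i else 0) = 0" if "c < m \<or> k + m \<le> c" for c m and f :: "nat \<Rightarrow> int"
    unfolding delta using that by auto
  have trm': "column N W z j k c = (\<Sum>i=j..<k. if c = i + 0 then (-1) ^ i * int (fst (z i)) else 0) +
      (\<Sum>i=j..<k. if c = i + W then (-1) ^ i * int (fst (snd (z i))) else 0) +
      (\<Sum>i=j..<k. if c = i + (N + W) then (-1) ^ i * int (fst (snd (snd (z i)))) else 0) +
      (\<Sum>i=j..<k. if c = i + (N + W + 1) then (-1) ^ i * int (snd (snd (snd (z i)))) else 0) +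
      (\<Sum>i=j..<k. if c = 2 * N + W + 1 then (-1) ^ i else 0)" for c
    unfolding trm by (simp add: add_ac)
  show "c < N + W \<Longrightarrow> column N W z j k c =
      (if j \<le> c \<and> c < k then (-1) ^ c * int (fst (z c)) else 0) +
      (if j + W \<le> c \<and> c < k + W then (-1) ^ (c - W) * int (fst (snd (z (c - W)))) else 0)"
    unfolding trm' delta using assms by auto
  show "m \<le> N \<Longrightarrow> column N W z j k (N + W + m) =
      (if j \<le> m \<and> m < k then (-1) ^ m * int (fst (snd (snd (z m)))) else 0) +
      (if j < m \<and> m \<le> k then (-1) ^ (m - 1) * int (snd (snd (snd (z (m - 1))))) else 0)"
    unfolding trm' delta using assms by (auto simp: less_Suc_eq_le)
  show "column N W z j k (2 * N + W + 1) = (\<Sum>i=j..<k. (-1) ^ i)"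
    unfolding trm' delta using assms by auto
qed

lemma alt_sum: "(\<Sum>i=j..<j + n. (-1) ^ i) = (if even n then 0 else (-1) ^ j :: int)"
  by (induction n) (auto simp: power_add)

lemma alt_sum_bound: "\<bar>\<Sum>i=j..<k. (-1) ^ i :: int\<bar> \<le> 1"
  using alt_sum[of j "k - j"] by (cases "j \<le> k") (auto simp: power_abs split: if_splits)


lemma minus_one_odd_shift: "odd W \<Longrightarrow> W \<le> c \<Longrightarrow> (-1) ^ (c - W) = - ((-1) ^ c :: int)"
  by (simp add: minus_one_power_iff even_diff_nat)

text \<open>Matching codes meet in one digit with opposite signs because the distances 1 and
  \<open>W\<close> are odd; the constant digit cancels because \<open>N\<close> is even.\<close>

lemma tiling_chain_sum:
  assumes "odd W" "even N" "tiling N W tab z"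
  shows "chain_sum (\<lambda>i. weight b N W i (z i)) 0 N = 0"
proof -
  have W: "0 < W" using assms(1) by (rule odd_pos)
  have z: "j < N \<Longrightarrow> (if j = 0 then fst (snd (snd (z j))) = 0 else fst (snd (snd (z j))) = snd (snd (snd (z (j - 1)))))"
    "j < N \<Longrightarrow> Suc j = N \<Longrightarrow> snd (snd (snd (z j))) = 0"
    "j < N \<Longrightarrow> (if j < W then fst (z j) = 0 else fst (z j) = fst (snd (z (j - W))))"
    "j < N \<Longrightarrow> N \<le> j + W \<Longrightarrow> fst (snd (z j)) = 0" for j
    using assms(3) unfolding tiling_def by (auto simp: case_prod_beta)
  have "column N W z 0 N c = 0" if "c < 2 * N + W + 2" for c
  proof -
    consider "c < N + W" | "N + W \<le> c" "c \<le> N + W + N" | "c = 2 * N + W + 1"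
      using \<open>c < 2 * N + W + 2\<close> by linarith
    then show ?thesis
    proof cases
      case 1
      consider "c < W" | "W \<le> c" "c < N" | "W \<le> c" "N \<le> c" by linarith
      then show ?thesis
      proof cases
        case 1 then show ?thesis using column_eq(1)[OF order_refl W, of c N z 0] z(3)[of c] by auto
      next
        case 2
        then show ?thesis using column_eq(1)[OF order_refl W, of c N z 0] z(3)[of c] minus_one_odd_shift[OF assms(1), of c]
          by auto
      next
        case 3
        then show ?thesis using column_eq(1)[OF order_refl W, of c N z 0] z(4)[of "c - W"] \<open>c < N + W\<close> by auto
      qed
    next
      case c: 2
      define m where "m = c - (N + W)"
      have 2: "m \<le> N" "c = N + W + m" using c by (auto simp: m_def)
      consider "m = 0" | "0 < m" "m < N" | "m = N" "0 < m" using 2(1) by linarith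
      then show ?thesis
      proof cases
        case 1 then show ?thesis using column_eq(2)[OF order_refl W, of m N z 0] z(1)[of 0] 2 by auto
      next
        case 2
        then show ?thesis using column_eq(2)[OF order_refl W, of m N z 0] z(1)[of m] minus_one_odd_shift[of 1 m]
            \<open>c = N + W + m\<close> by auto
      next
        case 3
        then show ?thesis using column_eq(2)[OF order_refl W, of m N z 0] z(2)[of "N - 1"] \<open>c = N + W + m\<close> by auto
      qed
    next
      case 3
      then show ?thesis using column_eq(3)[OF order_refl W] alt_sum[of 0 N] assms(2) by simp
    qed
  qed
  then show ?thesis by (simp add: chain_sum_columns)
qed

text \<open>A difference of two codes is smaller than the base, so every digit of a vanishing sum
  vanishes. A chain that began or ended inside the helix would leave a nonzero horizontal code alone
  in its digit; hence only the full chain can vanish, and then all codes match.\<close>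

lemma chain_sum_tiling:
  assumes "odd W" "0 < b" "j < k" "k \<le> N"
    and z: "\<And>i. j \<le> i \<Longrightarrow> i < k \<Longrightarrow> z i \<in> tab i"
    and codes: "\<And>i d u l r. i < N \<Longrightarrow> (d, u, l, r) \<in> tab i \<Longrightarrow>
      d < 2 ^ b \<and> u < 2 ^ b \<and> l < 2 ^ b \<and> r < 2 ^ b \<and> (0 < i \<longrightarrow> l \<noteq> 0) \<and> (Suc i < N \<longrightarrow> r \<noteq> 0)"
    and zero: "chain_sum (\<lambda>i. weight b N W i (z i)) j k = 0"
  shows "tiling N W tab z"
proof -
  have W: "0 < W" using assms(1) by (rule odd_pos)
  note ceq = column_eq[OF \<open>k \<le> N\<close> W]
  have zc: "fst (z i) < 2 ^ b \<and> fst (snd (z i)) < 2 ^ b \<and> fst (snd (snd (z i))) < 2 ^ b \<and> snd (snd (snd (z i))) < 2 ^ b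
      \<and> (0 < i \<longrightarrow> fst (snd (snd (z i))) \<noteq> 0) \<and> (Suc i < N \<longrightarrow> snd (snd (snd (z i))) \<noteq> 0)" if "j \<le> i" "i < k" for i
    using codes[of i "fst (z i)" "fst (snd (z i))" "fst (snd (snd (z i)))" "snd (snd (snd (z i)))"] z[OF that] that \<open>k \<le> N\<close> by simp
  have diff: "\<bar>e * int x + - e * int y\<bar> < 2 ^ b" if "x < 2 ^ b" "y < 2 ^ b" "e = 1 \<or> e = -1" for x y and e :: int
  proof -
    have "int x < int (2 ^ b)" "int y < int (2 ^ b)"
      using that(1,2) by (simp_all only: of_nat_less_iff)
    moreover have "\<bar>e * x + - e * y\<bar> < B" if "0 \<le> x" "x < B" "0 \<le> y" "y < B" for x y B :: int
      using \<open>e = 1 \<or> e = -1\<close> that by auto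
    ultimately show ?thesis by (metis of_nat_0_le_iff of_nat_numeral of_nat_power)
  qed
  have pm: "(-1) ^ i = (1 :: int) \<or> (-1) ^ i = (-1 :: int)" for i by (simp add: minus_one_power_iff)
  have bound: "\<bar>column N W z j k c\<bar> < 2 ^ b" if "c < 2 * N + W + 2" for c
  proof -
    consider "c < N + W" | "N + W \<le> c" "c \<le> N + W + N" | "c = 2 * N + W + 1"
      using \<open>c < 2 * N + W + 2\<close> by linarith
    then show ?thesis
    proof cases
      case 1
      let ?x = "if j \<le> c \<and> c < k then fst (z c) else 0"
      let ?y = "if j + W \<le> c \<and> c < k + W then fst (snd (z (c - W))) else 0"
      have eq: "column N W z j k c = (-1) ^ c * int ?x + - ((-1) ^ c) * int ?y"
        unfolding ceq(1)[OF 1] using minus_one_odd_shift[OF assms(1), of c] by auto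
      have "?x < 2 ^ b" "?y < 2 ^ b" using zc[of c] zc[of "c - W"] by auto
      from diff[OF this pm[of c]] show ?thesis unfolding eq .
    next
      case 2
      define m where "m = c - (N + W)"
      have m: "m \<le> N" "c = N + W + m" using 2 by (auto simp: m_def)
      let ?x = "if j \<le> m \<and> m < k then fst (snd (snd (z m))) else 0"
      let ?y = "if j < m \<and> m \<le> k then snd (snd (snd (z (m - 1)))) else 0"
      have eq: "column N W z j k c = (-1) ^ m * int ?x + - ((-1) ^ m) * int ?y"
        unfolding m(2) ceq(2)[OF m(1)] using minus_one_odd_shift[of 1 m] by auto
      have "?x < 2 ^ b" "?y < 2 ^ b" using zc[of m] zc[of "m - 1"] by auto
      from diff[OF this pm[of m]] show ?thesis unfolding eq .
    next
      case 3
      have "(2 :: int) ^ 1 \<le> 2 ^ b" using assms(2) by (intro power_increasing) auto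
      then show ?thesis unfolding 3 ceq(3) using alt_sum_bound[of j k] by simp
    qed
  qed
  have "(\<Sum>c<2 * N + W + 2. column N W z j k c * (2 ^ b) ^ c) = 0"
    using zero unfolding chain_sum_columns[OF \<open>k \<le> N\<close>] by simp
  from signed_digits[OF bound this] have col: "column N W z j k c = 0" if "c < 2 * N + W + 2" for c
    using that by blast
  have "j = 0"
  proof (rule ccontr)
    assume "j \<noteq> 0"
    have "column N W z j k (N + W + j) = 0" using assms(3,4) by (intro col) simp
    moreover have "j \<le> N" using assms(3,4) by simp
    ultimately show False using ceq(2)[of j z j] zc[of j] assms(3) \<open>j \<noteq> 0\<close> by auto
  qed
  moreover have "k = N"
  proof (rule ccontr)
    assume "k \<noteq> N"
    have "column N W z j k (N + W + k) = 0" using assms(3,4) by (intro col) simp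
    moreover have "j \<le> k - 1" using assms(3) by linarith
    ultimately show False using ceq(2)[of k z j] zc[of "k - 1"] assms(3,4) \<open>k \<noteq> N\<close> by auto
  qed
  ultimately have jk: "j = 0" "k = N" by auto
  have l0: "fst (snd (snd (z 0))) = 0" using col[of "N + W"] ceq(2)[of 0 z 0] assms(3) jk by simp
  have l: "fst (snd (snd (z i))) = snd (snd (snd (z (i - 1))))" if "i \<noteq> 0" "i < N" for i
    using col[of "N + W + i"] ceq(2)[of i z 0] minus_one_odd_shift[of 1 i] pm[of i] that jk by auto
  have r: "snd (snd (snd (z i))) = 0" if "Suc i = N" for i
    using col[of "N + W + N"] ceq(2)[of N z 0] assms(3) jk that by auto
  have d0: "fst (z i) = 0" if "i < W" "i < N" for i
    using col[of i] ceq(1)[of i z 0] that jk by simp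
  have d: "fst (z i) = fst (snd (z (i - W)))" if "\<not> i < W" "i < N" for i
    using col[of i] ceq(1)[of i z 0] minus_one_odd_shift[OF assms(1), of i] pm[of i] that jk by auto
  have u: "fst (snd (z i)) = 0" if "i < N" "N \<le> i + W" for i
    using col[of "i + W"] ceq(1)[of "i + W" z 0] that jk by simp
  have "z i \<in> tab i" if "i < N" for i using z that jk by simp
  then show ?thesis
    unfolding tiling_def case_prod_beta using l0 l r d0 d u by simp
qed

definition options :: "nat \<Rightarrow> nat \<Rightarrow> nat \<Rightarrow> (nat \<Rightarrow> tile set) \<Rightarrow> nat \<Rightarrow> nat set" where
  "options b N W tab j = weight b N W j ` tab j"

theorem tiling_factorizations:
  fixes b N W :: nat and tab :: "nat \<Rightarrow> tile set"
  defines "G \<equiv> arrow ` arrows N (options b N W tab)"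
  assumes "odd W" "even N" "0 < N" "0 < b" "\<And>j. j < N \<Longrightarrow> finite (tab j)"
    and codes: "\<And>i d u l r. i < N \<Longrightarrow> (d, u, l, r) \<in> tab i \<Longrightarrow>
      d < 2 ^ b \<and> u < 2 ^ b \<and> l < 2 ^ b \<and> r < 2 ^ b \<and> (0 < i \<longrightarrow> l \<noteq> 0) \<and> (Suc i < N \<longrightarrow> r \<noteq> 0)"
    and M: "M \<in> semigroup_gen G"
  shows "infinite (factorizations G M) \<longleftrightarrow> (\<exists>z. tiling N W tab z)"
proof
  assume "\<exists>z. tiling N W tab z"
  then obtain z where z: "tiling N W tab z" by blast
  have "\<exists>y. y \<noteq> [] \<and> set y \<subseteq> G \<and> matprod y = mat 1" unfolding G_def
  proof (rule arrows_identity[OF \<open>0 < N\<close>])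
    show "chain_sum (\<lambda>i. weight b N W i (z i)) 0 N = 0" using tiling_chain_sum z assms by blast
  qed (use z in \<open>auto simp: options_def tiling_def\<close>)
  then show "infinite (factorizations G M)" using identity_infinite M by blast
next
  assume inf: "infinite (factorizations G M)"
  show "\<exists>z. tiling N W tab z"
  proof (rule ccontr)
    assume no: "\<not> (\<exists>z. tiling N W tab z)"
    have "finite (factorizations G M)" unfolding G_def
    proof (rule arrows_finite)
      show "\<forall>j k s. j < k \<and> k \<le> N \<and> (\<forall>i. j \<le> i \<and> i < k \<longrightarrow> s i \<in> options b N W tab i) \<longrightarrow> chain_sum s j k \<noteq> 0"
      proof (intro allI impI notI)
        fix j k s
        assume *: "j < k \<and> k \<le> N \<and> (\<forall>i. j \<le> i \<and> i < k \<longrightarrow> s i \<in> options b N W tab i)" and 0: "chain_sum s j k = 0"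
        then have "\<forall>i. \<exists>y. j \<le> i \<and> i < k \<longrightarrow> y \<in> tab i \<and> s i = weight b N W i y"
          unfolding options_def by blast
        then obtain z where z: "\<And>i. j \<le> i \<and> i < k \<Longrightarrow> z i \<in> tab i \<and> s i = weight b N W i (z i)" by metis
        then have "chain_sum s j k = chain_sum (\<lambda>i. weight b N W i (z i)) j k"
          unfolding chain_sum_def by (intro sum.cong) auto
        then have "tiling N W tab z"
          using chain_sum_tiling[OF \<open>odd W\<close> \<open>0 < b\<close>, of j k N z tab] * 0 z codes by auto
        then show False using no by blast
      qed
      show "\<forall>j<N. \<forall>s\<in>options b N W tab j. even s"
        by (auto simp: options_def weight_def Let_def)
      show "\<And>j. j < N \<Longrightarrow> finite (options b N W tab j)" using assms by (auto simp: options_def)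
    qed
    then show False using inf by blast
  qed
qed

section \<open>Computations as tilings\<close>

text \<open>
  A row of the tableau consists of the cell \<open>End\<close> followed by the tape cells of one configuration;
  a cell records the state, the symbols of all tapes and whether it is the scanned one. A tile
  \<open>(g, l, c, r)\<close> carries the scanned cell \<open>g\<close> of its row and the cell \<open>c\<close> with its neighbours.
\<close>

datatype cell = End | Cell nat "nat list" bool

fun sym :: "cell \<Rightarrow> nat \<Rightarrow> nat" where
  "sym End i = 0"
| "sym (Cell q ss f) i = ss ! i"

fun scanned :: "cell \<Rightarrow> bool" where
  "scanned End = False"
| "scanned (Cell q ss f) = f"

text \<open>The scanned cell \<open>g\<close> of the row determines the transition. Heads stay in
  place and contents shift, so each tape takes its new symbol from the neighbour given by its own
  move; where that neighbour is the scanned cell, the written symbol is taken.\<close>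

fun next_cell :: "tm \<Rightarrow> cell \<Rightarrow> cell \<Rightarrow> cell \<Rightarrow> cell \<Rightarrow> cell" where
  "next_cell V (Cell q ss g) l (Cell p us f) r = (if q = 1 then Cell q us f else
     Cell (fst (delta V q ss)) (map (\<lambda>i. let a = snd (delta V q ss) ! i;
        x = (if snd a = -1 then l else if snd a = 1 then r else Cell p us f) in
        if scanned x then fst a else sym x i) [0..<num_tapes V]) f)"
| "next_cell V g l c r = End"

definition cells :: "tm \<Rightarrow> cell set" where
  "cells V = insert End {Cell q ss f | q ss f.
     q < num_states V \<and> length ss = num_tapes V \<and> set ss \<subseteq> {..<num_symbols V}}"

lemma finite_cells: "finite (cells V)"
proof -
  let ?S = "{ss. set ss \<subseteq> {..<num_symbols V} \<and> length ss = num_tapes V}"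
  have "cells V \<subseteq> insert End ((\<lambda>(q, ss, f). Cell q ss f) ` ({..<num_states V} \<times> ?S \<times> UNIV))"
    by (force simp: cells_def)
  moreover have "finite ?S" by (rule finite_lists_length_eq) simp
  then have "finite (insert End ((\<lambda>(q, ss, f). Cell q ss f) ` ({..<num_states V} \<times> ?S \<times> (UNIV :: bool set))))"
    by (intro finite_insert[THEN iffD2] finite_imageI finite_cartesian_product) auto
  ultimately show ?thesis by (rule finite_subset)
qed

definition cell_of :: "nat \<times> tape list \<Rightarrow> int \<Rightarrow> cell" where
  "cell_of c p = Cell (fst c) (map (\<lambda>t. t p) (snd c)) (p = 0)"

definition ok_config :: "tm \<Rightarrow> nat \<times> tape list \<Rightarrow> bool" where
  "ok_config V c \<longleftrightarrow> fst c < num_states V \<and> length (snd c) = num_tapes V \<and>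
     (\<forall>t\<in>set (snd c). \<forall>p. t p < num_symbols V)"

lemma cell_of_cells: "ok_config V c \<Longrightarrow> cell_of c p \<in> cells V"
  by (auto simp: ok_config_def cells_def cell_of_def)

lemma delta_range:
  assumes "wf_tm V" "q < num_states V" "length ss = num_tapes V" "set ss \<subseteq> {..<num_symbols V}"
  shows "fst (delta V q ss) < num_states V" "length (snd (delta V q ss)) = num_tapes V"
    "i < num_tapes V \<Longrightarrow> fst (snd (delta V q ss) ! i) < num_symbols V"
    "i < num_tapes V \<Longrightarrow> snd (snd (delta V q ss) ! i) \<in> {-1, 0, 1}"
proof -
  have *: "fst (delta V q ss) < num_states V \<and> length (snd (delta V q ss)) = num_tapes V \<and>
      set (snd (delta V q ss)) \<subseteq> {..<num_symbols V} \<times> {-1, 0, 1}"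
    using assms unfolding wf_tm_def by blast
  then show "fst (delta V q ss) < num_states V" "length (snd (delta V q ss)) = num_tapes V" by auto
  have "snd (delta V q ss) ! i \<in> {..<num_symbols V} \<times> {-1, 0, 1}" if "i < num_tapes V"
    using * that by (auto simp: subset_eq)
  then show "i < num_tapes V \<Longrightarrow> fst (snd (delta V q ss) ! i) < num_symbols V"
    "i < num_tapes V \<Longrightarrow> snd (snd (delta V q ss) ! i) \<in> {-1, 0, 1}" by (auto simp: mem_Times_iff)
qed

lemma next_cell_cells:
  assumes "wf_tm V" "g \<in> cells V" "l \<in> cells V" "c \<in> cells V" "r \<in> cells V"
  shows "next_cell V g l c r \<in> cells V"
proof (cases g)
  case g: (Cell q ss f)
  show ?thesis
  proof (cases c)
    case c: (Cell p us h)
    have sy: "sym x i < num_symbols V" if "x \<in> cells V" "i < num_tapes V" for x i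
      using that assms(1) nth_mem[of i] by (cases x) (auto simp: cells_def wf_tm_def subset_eq)
    have "q < num_states V" "length ss = num_tapes V" "set ss \<subseteq> {..<num_symbols V}"
      using assms(2) by (auto simp: g cells_def)
    note d = delta_range[OF assms(1) this]
    show ?thesis
    proof (cases "q = 1")
      case True
      then show ?thesis using assms(2,4) by (auto simp: g c cells_def)
    next
      case False
      let ?f = "\<lambda>i. let a = snd (delta V q ss) ! i;
        x = (if snd a = -1 then l else if snd a = 1 then r else Cell p us h) in
        if scanned x then fst a else sym x i"
      have "?f i < num_symbols V" if "i < num_tapes V" for i
        using d(3)[OF that] sy[OF assms(3) that] sy[OF assms(5) that] sy[OF assms(4) that] unfolding c Let_def by simp
      then have "set (map ?f [0..<num_tapes V]) \<subseteq> {..<num_symbols V}" by auto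
      then show ?thesis using False d(1) unfolding g c next_cell.simps cells_def by auto
    qed
  qed (simp add: cells_def g)
qed (simp add: cells_def)

text \<open>The border \<open>End\<close> may stand in for an unscanned blank cell outside the
  tableau, since it yields blanks and is not scanned.\<close>

definition sees :: "nat \<times> tape list \<Rightarrow> cell \<Rightarrow> int \<Rightarrow> bool" where
  "sees c X p \<longleftrightarrow> X = cell_of c p \<or> (X = End \<and> p \<noteq> 0 \<and> (\<forall>t\<in>set (snd c). t p = 0))"

lemma sees_sym: "sees c X p \<Longrightarrow> i < length (snd c) \<Longrightarrow> sym X i = (snd c ! i) p"
  by (auto simp: sees_def cell_of_def)

lemma sees_scanned: "sees c X p \<Longrightarrow> scanned X \<longleftrightarrow> p = 0"
  by (auto simp: sees_def cell_of_def)

lemma step_cell: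
  assumes "wf_tm V" "ok_config V c" "sees c L (p - 1)" "sees c R (p + 1)"
  shows "cell_of (step V c) p = next_cell V (cell_of c 0) L (cell_of c p) R"
proof -
  obtain q ts where c: "c = (q, ts)" by (cases c)
  let ?ss = "map (\<lambda>t. t 0) ts"
  show ?thesis
  proof (cases "q = 1")
    case True
    then show ?thesis by (simp add: step_def c cell_of_def)
  next
    case False
    have "q < num_states V" "length ?ss = num_tapes V" "set ?ss \<subseteq> {..<num_symbols V}"
      using assms(2) by (auto simp: ok_config_def c)
    note d = delta_range[OF assms(1) this]
    obtain q' as where del: "delta V q ?ss = (q', as)" by (cases "delta V q ?ss")
    have len: "length ts = num_tapes V" "length as = num_tapes V" using assms(2) d(2) del by (auto simp: ok_config_def c)
    define F where "F i = (let a = as ! i;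
        x = (if snd a = -1 then L else if snd a = 1 then R else Cell q (map (\<lambda>t. t p) ts) (p = 0)) in
        if scanned x then fst a else sym x i)" for i
    have F: "act (ts ! i) (as ! i) p = F i" if "i < num_tapes V" for i
    proof -
      have "snd (as ! i) \<in> {-1, 0, 1}" using d(4)[OF that] del by simp
      then show ?thesis
        using that len sees_sym[OF assms(3), of i] sees_sym[OF assms(4), of i] sees_scanned[OF assms(3)]
          sees_scanned[OF assms(4)] by (auto simp: F_def act_def c cell_of_def Let_def)
    qed
    have "map (\<lambda>t. t p) (map2 act ts as) = map F [0..<num_tapes V]"
      using len F by (intro nth_equalityI) simp_all
    then show ?thesis using False del by (simp add: step_def c cell_of_def F_def)
  qed
qed

lemma step_ok:
  assumes "wf_tm V" "ok_config V c"
  shows "ok_config V (step V c)"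
proof -
  obtain q ts where c: "c = (q, ts)" by (cases c)
  let ?ss = "map (\<lambda>t. t 0) ts"
  show ?thesis
  proof (cases "q = 1")
    case True
    then show ?thesis using assms by (simp add: step_def c)
  next
    case False
    have "q < num_states V" "length ?ss = num_tapes V" "set ?ss \<subseteq> {..<num_symbols V}"
      using assms(2) by (auto simp: ok_config_def c)
    note d = delta_range[OF assms(1) this]
    obtain q' as where del: "delta V q ?ss = (q', as)" by (cases "delta V q ?ss")
    have len: "length ts = num_tapes V" "length as = num_tapes V" using assms(2) d(2) del by (auto simp: ok_config_def c)
    have "act (ts ! i) (as ! i) p < num_symbols V" if "i < num_tapes V" for i p
      using d(3)[OF that] assms(2) len that nth_mem[of i ts] by (auto simp: act_def ok_config_def c del)
    then have "\<forall>t\<in>set (map2 act ts as). \<forall>p. t p < num_symbols V"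
      using len by (auto simp: set_zip)
    then show ?thesis using False d(1) len by (simp add: step_def c del ok_config_def)
  qed
qed

definition config :: "tm \<Rightarrow> bool list \<Rightarrow> bool list \<Rightarrow> nat \<Rightarrow> nat \<times> tape list" where
  "config V x w t = (step V ^^ t) (init V [x, w])"

lemma config_ok: "wf_tm V \<Longrightarrow> 2 \<le> num_tapes V \<Longrightarrow> ok_config V (config V x w t)"
proof (induction t)
  case 0
  then show ?case by (auto simp: config_def init_def ok_config_def wf_tm_def tape_of_def)
next
  case (Suc t)
  then show ?case using step_ok by (simp add: config_def)
qed

text \<open>Contents start within the lengths of the two inputs and spread by at most one cell per
  step. This justifies rows of finite width.\<close>

lemma config_blank:
  assumes "wf_tm V" "2 \<le> num_tapes V" "int (t + length x + length w) < \<bar>p\<bar>" "T \<in> set (snd (config V x w t))"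
  shows "T p = 0"
  using assms(3,4)
proof (induction t arbitrary: p T)
  case 0
  then show ?case by (auto simp: config_def init_def tape_of_def)
next
  case (Suc t)
  obtain q ts where c: "config V x w t = (q, ts)" by (cases "config V x w t")
  have ok: "ok_config V (q, ts)" using config_ok[OF assms(1,2)] c by metis
  have next_c: "config V x w (Suc t) = step V (q, ts)" using c by (simp add: config_def)
  show ?case
  proof (cases "q = 1")
    case True
    then show ?thesis using Suc next_c c by (auto simp: step_def)
  next
    case False
    let ?ss = "map (\<lambda>t. t 0) ts"
    have "q < num_states V" "length ?ss = num_tapes V" "set ?ss \<subseteq> {..<num_symbols V}"
      using ok by (auto simp: ok_config_def)
    note d = delta_range[OF assms(1) this]
    obtain q' as where del: "delta V q ?ss = (q', as)" by (cases "delta V q ?ss")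
    have len: "length ts = num_tapes V" "length as = num_tapes V" using ok d(2) del by (auto simp: ok_config_def)
    have "T \<in> set (map2 act ts as)" using Suc.prems(2) False by (simp add: next_c step_def del)
    then obtain i where i: "i < num_tapes V" "T = act (ts ! i) (as ! i)" using len by (auto simp: set_zip)
    have m: "snd (as ! i) \<in> {-1, 0, 1}" using d(4)[OF i(1)] del by simp
    then have "int (t + length x + length w) < \<bar>p + snd (as ! i)\<bar>" using Suc.prems(1) by auto
    moreover have "ts ! i \<in> set (snd (config V x w t))" using i len c by simp
    ultimately have "(ts ! i) (p + snd (as ! i)) = 0" using Suc.IH by blast
    moreover have "p + snd (as ! i) \<noteq> 0" using m Suc.prems(1) by auto
    ultimately show ?thesis by (simp add: i act_def)
  qed
qed


subsection \<open>The tile sets\<close>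

text \<open>
  \<open>Row0 a v f\<close> is a cell of the initial row with input symbol \<open>a\<close>; \<open>v\<close> tells whether the cell
  may be occupied by the witness and \<open>f\<close> whether it is the scanned one.
\<close>

datatype kind = Start | Mid | Last | LastCell | Row0 nat bool bool

definition ok_tile :: "tm \<Rightarrow> cell \<times> cell \<times> cell \<times> cell \<Rightarrow> bool" where
  "ok_tile V = (\<lambda>(g, l, c, r). g \<in> cells V \<and> l \<in> cells V \<and> c \<in> cells V \<and> r \<in> cells V \<and>
     (scanned c \<longrightarrow> g = c))"

text \<open>Acceptance is read off the scanned cell alone: state 1 and, on the first tape, the
  symbol 2 for \<open>True\<close>.\<close>

definition accepting :: "cell \<Rightarrow> bool" where
  "accepting c \<longleftrightarrow> (case c of Cell q ss True \<Rightarrow> q = 1 \<and> ss ! 0 = 2 | _ \<Rightarrow> True)"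

text \<open>The tiling guesses the witness: where \<open>v\<close> holds, the second tape may carry
  any symbol up to 2, provided that a blank is followed by a blank.\<close>

definition initial :: "nat \<Rightarrow> bool \<Rightarrow> bool \<Rightarrow> cell \<Rightarrow> cell \<Rightarrow> bool" where
  "initial a v f c r \<longleftrightarrow> (\<exists>ss. c = Cell 0 ss f \<and> ss ! 0 = a \<and> (\<forall>i. 2 \<le> i \<and> i < length ss \<longrightarrow> ss ! i = 0) \<and>
     (if v then ss ! 1 \<le> 2 \<and> (ss ! 1 = 0 \<longrightarrow> sym r 1 = 0) else ss ! 1 = 0))"

locale tableau =
  fixes V :: tm and hc :: "cell \<times> cell \<times> cell \<Rightarrow> nat" and vc :: "cell \<Rightarrow> nat" and b :: nat
  assumes wf: "wf_tm V" and two: "2 \<le> num_tapes V"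
    and hc: "inj_on hc (cells V \<times> cells V \<times> cells V)" "hc ` (cells V \<times> cells V \<times> cells V) \<subseteq> {1..<2 ^ b}"
    and vc: "inj_on vc (cells V)" "vc ` cells V \<subseteq> {1..<2 ^ b}"
begin

text \<open>The code on the boundary between the cells \<open>l\<close> and \<open>c\<close>. The
  \<open>End\<close> tile that opens a row still carries the scanned cell of the row before; the
  boundary behind it forgets that cell, so that each row can have its own.\<close>

definition lc :: "cell \<Rightarrow> cell \<Rightarrow> cell \<Rightarrow> nat" where
  "lc g l c = hc (if l = End then End else g, l, c)"

definition tab :: "kind \<Rightarrow> tile set" where
  "tab k = (case k of
     Start \<Rightarrow> {(0, vc End, 0, lc g End r) | g l r. ok_tile V (g, l, End, r)}
   | Row0 a v f \<Rightarrow> {(0, vc (next_cell V g l c r), lc g l c, lc g c r) | g l c r.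
       ok_tile V (g, l, c, r) \<and> initial a v f c r}
   | Mid \<Rightarrow> {(vc c, vc (next_cell V g l c r), lc g l c, lc g c r) | g l c r. ok_tile V (g, l, c, r)}
   | Last \<Rightarrow> {(vc c, 0, lc g l c, lc g c r) | g l c r. ok_tile V (g, l, c, r) \<and> accepting c}
   | LastCell \<Rightarrow> {(vc c, 0, lc g l c, 0) | g l c r. ok_tile V (g, l, c, r) \<and> accepting c})"

lemma End_cells: "End \<in> cells V"
  by (simp add: cells_def)

lemma lc_range: "g \<in> cells V \<Longrightarrow> l \<in> cells V \<Longrightarrow> c \<in> cells V \<Longrightarrow> 0 < lc g l c \<and> lc g l c < 2 ^ b"
  using hc(2) End_cells by (auto simp: lc_def image_subset_iff Suc_le_eq)

lemma lc_inj:
  assumes "lc g l c = lc g' l' c'" "{g, l, c, g', l', c'} \<subseteq> cells V"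
  shows "l = l' \<and> c = c' \<and> (l \<noteq> End \<longrightarrow> g = g')"
proof -
  have "(if l = End then End else g, l, c) = (if l' = End then End else g', l', c')"
    using assms End_cells by (intro inj_onD[OF hc(1)]) (auto simp: lc_def)
  then show ?thesis by (auto split: if_splits)
qed

lemma vc_range: "c \<in> cells V \<Longrightarrow> 0 < vc c \<and> vc c < 2 ^ b"
  using vc(2) by (auto simp: image_subset_iff Suc_le_eq)

lemma vc_inj: "vc c = vc c' \<Longrightarrow> c \<in> cells V \<Longrightarrow> c' \<in> cells V \<Longrightarrow> c = c'"
  using vc(1) by (rule inj_onD)

lemma tab_codes:
  assumes "(d, u, l, r) \<in> tab k"
  shows "d < 2 ^ b \<and> u < 2 ^ b \<and> l < 2 ^ b \<and> r < 2 ^ b \<and> (k \<noteq> Start \<longrightarrow> l \<noteq> 0) \<and> (k \<noteq> LastCell \<longrightarrow> r \<noteq> 0)"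
  using assms lc_range vc_range next_cell_cells[OF wf] End_cells
  by (cases k) (fastforce simp: tab_def ok_tile_def)+

lemma tab_finite: "finite (tab k)"
proof (rule finite_subset)
  show "tab k \<subseteq> {..<2 ^ b} \<times> {..<2 ^ b} \<times> {..<2 ^ b} \<times> {..<2 ^ b}" using tab_codes by auto
qed simp

lemma tab_Start: "tab Start \<noteq> {}"
  using End_cells by (fastforce simp: tab_def ok_tile_def)

text \<open>The tableau for input \<open>x\<close>, witnesses of length at most \<open>P\<close> and \<open>T\<close> steps.\<close>

definition kind_of :: "bool list \<Rightarrow> nat \<Rightarrow> nat \<Rightarrow> nat \<Rightarrow> nat \<Rightarrow> nat \<Rightarrow> kind" where
  "kind_of x P E T t i = (if t = 0 then if i = 0 then Start else
       let p = int i - int (E + 1) in Row0 (tape_of x p) (0 \<le> p \<and> p < int P) (p = 0)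
     else if t < T then Mid else if i = 2 * E + 2 then LastCell else Last)"

text \<open>In rows of width \<open>2 * E + 3\<close>, column 0 is the border and the others show
  the positions from \<open>- E\<close> to \<open>E + 1\<close>. The extra position on the right
  makes the width odd.\<close>

definition content :: "bool list \<Rightarrow> bool list \<Rightarrow> nat \<Rightarrow> nat \<Rightarrow> nat \<Rightarrow> cell" where
  "content x w E t i = (if i = 0 then End else cell_of (config V x w t) (int i - int (E + 1)))"

lemma content_cells: "content x w E t i \<in> cells V"
  using cell_of_cells config_ok[OF wf two] End_cells by (simp add: content_def)

lemma content_step:
  assumes "0 < i" "i < 2 * E + 3" "t + length x + length w \<le> E"
    and "r = (if i = 2 * E + 2 then End else content x w E t (Suc i))"
  shows "content x w E (Suc t) i =
     next_cell V (cell_of (config V x w t) 0) (content x w E t (i - 1)) (content x w E t i) r"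
proof -
  let ?c = "config V x w t" and ?p = "int i - int (E + 1)"
  have "sees ?c (content x w E t (i - 1)) (?p - 1)"
  proof (cases "i = 1")
    case True
    then have "\<forall>T\<in>set (snd ?c). T (?p - 1) = 0"
      using config_blank[OF wf two, of t x w "?p - 1"] assms(3) by simp
    then show ?thesis using True by (auto simp: sees_def content_def)
  next
    case False
    then have "int (i - 1) - int (E + 1) = ?p - 1" using assms(1) by linarith
    then show ?thesis using False assms(1) by (auto simp: sees_def content_def)
  qed
  moreover have "sees ?c r (?p + 1)"
  proof (cases "i = 2 * E + 2")
    case True
    then have "\<forall>T\<in>set (snd ?c). T (?p + 1) = 0"
      using config_blank[OF wf two, of t x w "?p + 1"] assms(3) by simp
    then show ?thesis using True assms(4) by (auto simp: sees_def)
  next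
    case False
    have "int (Suc i) - int (E + 1) = ?p + 1" by linarith
    then show ?thesis using False assms(4) by (auto simp: sees_def content_def)
  qed
  ultimately show ?thesis
    using step_cell[OF wf config_ok[OF wf two]] assms(1) by (simp add: content_def config_def)
qed

lemma content_0:
  "content x w E 0 i = (if i = 0 then End else let p = int i - int (E + 1) in
     Cell 0 (tape_of x p # tape_of w p # replicate (num_tapes V - 2) 0) (p = 0))"
  by (simp add: content_def cell_of_def config_def init_def Let_def map_replicate numeral_2_eq_2)

lemma tableau_complete:
  assumes T: "0 < T" "T + length x + length w \<le> E" and P: "length w \<le> P"
    and acc: "fst (config V x w T) = 1" "hd (snd (config V x w T)) 0 = 2"
  defines "W \<equiv> 2 * E + 3"
  shows "\<exists>z. tiling (W * (T + 1)) W (\<lambda>j. tab (kind_of x P E T (j div W) (j mod W))) z"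
proof -
  define N where "N = W * (T + 1)"
  have W: "0 < W" by (simp add: W_def)
  define ch where "ch j = content x w E (j div W) (j mod W)" for j
  define sc where "sc t = cell_of (config V x w t) 0" for t
  \<comment> \<open>An \<open>End\<close> tile carries the scanned cell of the preceding row; at
    \<open>j = 0\<close> there is none, and \<open>End\<close> is the default.\<close>
  define g where "g j = (if j mod W = 0 then if j < W then End else sc (j div W - 1) else sc (j div W))" for j
  define k where "k j = kind_of x P E T (j div W) (j mod W)" for j
  define z where "z j = (if j < W then 0 else vc (ch j),
      if N \<le> j + W then 0 else vc (next_cell V (g j) (ch (j - 1)) (ch j) (ch (Suc j))),
      if j = 0 then 0 else lc (g j) (ch (j - 1)) (ch j),
      if Suc j = N then 0 else lc (g j) (ch j) (ch (Suc j)))" for j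
  have sc: "sc t \<in> cells V" for t using cell_of_cells config_ok[OF wf two] by (simp add: sc_def)
  have chc: "ch j \<in> cells V" for j using content_cells by (simp add: ch_def)
  have gc: "g j \<in> cells V" for j using sc End_cells by (simp add: g_def)
  have scan: "g j = ch j" if "scanned (ch j)" for j
    using that by (auto simp: ch_def content_def g_def sc_def cell_of_def split: if_splits)
  then have ok: "ok_tile V (g j, l, ch j, r)" if "l \<in> cells V" "r \<in> cells V" for j l r
    using gc chc that by (simp add: ok_tile_def)
  have ch_End: "ch j = End \<longleftrightarrow> j mod W = 0" for j by (simp add: ch_def content_def cell_of_def)
  have Suc_mod: "Suc j mod W = (if Suc (j mod W) = W then 0 else Suc (j mod W))"
    "Suc j div W = (if Suc (j mod W) = W then Suc (j div W) else j div W)" for j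
    by (simp_all add: mod_Suc div_Suc)
  have gS: "g (Suc j) = g j" if "j mod W \<noteq> 0" for j
  proof -
    have "W \<le> Suc j" if "Suc (j mod W) = W" using that by (metis Suc_le_mono mod_less_eq_dividend)
    then show ?thesis using that by (auto simp: g_def Suc_mod)
  qed
  have down: "next_cell V (g j) (ch (j - 1)) (ch j) (ch (Suc j)) = ch (j + W)" if "j + W < N" for j
  proof (cases "j mod W = 0")
    case True
    then have "ch j = End" "ch (j + W) = End" using ch_End[of j] ch_End[of "j + W"] by auto
    then show ?thesis by (cases "g j") simp_all
  next
    case False
    have div: "(j + W) div W = Suc (j div W)" "(j + W) mod W = j mod W" using W by simp_all
    have "j div W < T" using that W by (simp add: N_def div_less_iff_less_mult algebra_simps)
    then have E: "j div W + length x + length w \<le> E" using T by linarith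
    have "j mod W < 2 * E + 3" using W by (simp add: W_def)
    moreover have "ch (Suc j) = (if j mod W = 2 * E + 2 then End else content x w E (j div W) (Suc (j mod W)))"
      unfolding ch_def Suc_mod content_def by (simp add: W_def)
    ultimately have "content x w E (Suc (j div W)) (j mod W) =
      next_cell V (cell_of (config V x w (j div W)) 0) (content x w E (j div W) (j mod W - 1)) (content x w E (j div W) (j mod W)) (ch (Suc j))"
      using content_step[of "j mod W" E "j div W" x w "ch (Suc j)"] False E by blast
    moreover have "j > 0" using False by (cases j) auto
    then have "(j - 1) mod W = j mod W - 1" "(j - 1) div W = j div W"
      using False Suc_mod[of "j - 1"] by (auto split: if_splits)
    ultimately show ?thesis using False by (simp add: ch_def div g_def sc_def)
  qed
  have "z j \<in> tab (k j)" if j: "j < N" for j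
  proof -
    have less: "j div W \<le> T" using j W by (simp add: N_def div_less_iff_less_mult algebra_simps less_Suc_eq_le[symmetric])
    have jW: "j < W \<longleftrightarrow> j div W = 0" using W by (metis div_eq_0_iff not_less0)
    have NW: "N \<le> j + W \<longleftrightarrow> j div W = T"
    proof -
      have "N \<le> j + W \<longleftrightarrow> W * T \<le> j" by (simp add: N_def)
      also have "\<dots> \<longleftrightarrow> T \<le> j div W" using W by (simp add: less_eq_div_iff_mult_less_eq mult.commute)
      finally show ?thesis using less by auto
    qed
    have last: "Suc j = N \<longleftrightarrow> j div W = T \<and> j mod W = 2 * E + 2"
    proof -
      have jd: "j = W * (j div W) + j mod W" by simp
      have "j mod W < W" using W by simp
      show ?thesis
      proof
        assume "Suc j = N"
        then have "j = W * T + (2 * E + 2)" by (simp add: N_def W_def algebra_simps)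
        moreover have "(W * T + i) div W = T \<and> (W * T + i) mod W = i" if "i < W" for i using that by simp
        then have "(W * T + (2 * E + 2)) div W = T \<and> (W * T + (2 * E + 2)) mod W = 2 * E + 2"
          by (simp only: W_def)
        ultimately show "j div W = T \<and> j mod W = 2 * E + 2" by (simp only:)
      next
        assume "j div W = T \<and> j mod W = 2 * E + 2"
        then have "j = W * T + (2 * E + 2)" using jd by metis
        then show "Suc j = N" by (simp add: N_def W_def)
      qed
    qed
    show ?thesis
    proof (cases "j div W = 0")
      case row0: True
      have notlast: "\<not> N \<le> j + W" "Suc j \<noteq> N" using NW last T(1) row0 by auto
      show ?thesis
      proof (cases "j = 0")
        case True
        have "ch 0 = End" using ch_End by simp
        moreover have "next_cell V (g 0) (ch (0 - 1)) End (ch (Suc 0)) = End" by (cases "g 0") auto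
        ultimately show ?thesis using notlast ok[OF chc chc, of 0 0 "Suc 0"] W True
          by (auto simp: z_def k_def kind_of_def tab_def)
      next
        case False
        have i: "j mod W = j" "j < W" using row0 jW by auto
        define p where "p = int j - int (E + 1)"
        have c: "ch j = Cell 0 (tape_of x p # tape_of w p # replicate (num_tapes V - 2) 0) (p = 0)"
          using False row0 i by (simp add: ch_def content_0 p_def Let_def)
        have "initial (tape_of x p) (0 \<le> p \<and> p < int P) (p = 0) (ch j) (ch (Suc j))"
        proof -
          let ?ss = "tape_of x p # tape_of w p # replicate (num_tapes V - 2) 0"
          have rest: "\<forall>i. 2 \<le> i \<and> i < length ?ss \<longrightarrow> ?ss ! i = 0"
            by (auto simp: nth_Cons split: nat.splits)
          have w2: "tape_of w p \<le> 2" by (simp add: tape_of_def)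
          have wP: "tape_of w p = 0" if "\<not> (0 \<le> p \<and> p < int P)" using that P by (auto simp: tape_of_def)
          have "sym (ch (Suc j)) 1 = 0" if "0 \<le> p" "tape_of w p = 0"
          proof (cases "Suc j = W")
            case True
            then have "ch (Suc j) = End" using ch_End by simp
            then show ?thesis by simp
          next
            case F: False
            then have "Suc j < W" using i by simp
            then have "ch (Suc j) = Cell 0 (tape_of x (p + 1) # tape_of w (p + 1) # replicate (num_tapes V - 2) 0) (p + 1 = 0)"
              by (simp add: ch_def content_0 p_def Let_def algebra_simps)
            moreover have "tape_of w (p + 1) = 0" using that by (auto simp: tape_of_def split: if_splits)
            ultimately show ?thesis by simp
          qed
          then show ?thesis unfolding initial_def c using rest w2 wP
            by (intro exI[of _ ?ss]) auto
        qed
        moreover have "k j = Row0 (tape_of x p) (0 \<le> p \<and> p < int P) (p = 0)"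
          using False row0 i by (simp add: k_def kind_of_def p_def Let_def)
        ultimately show ?thesis using notlast ok[OF chc chc, of j "j - 1" "Suc j"] i(2) False
          by (auto simp: z_def tab_def)
      qed
    next
      case row: False
      then have "\<not> j < W" using jW by simp
      then have nj: "j \<noteq> 0" "\<not> j < W" using W by auto
      show ?thesis
      proof (cases "j div W = T")
        case False
        then have "k j = Mid" using row less by (simp add: k_def kind_of_def)
        moreover have "\<not> N \<le> j + W" "Suc j \<noteq> N" using NW last False by auto
        ultimately show ?thesis using nj ok[OF chc chc, of j "j - 1" "Suc j"] by (auto simp: z_def tab_def)
      next
        case True
        have "accepting (ch j)"
        proof (cases "scanned (ch j)")
          case s: True
          then have "j mod W \<noteq> 0" using ch_End[of j] by auto
          then have "ch j = cell_of (config V x w T) 0" using scan[OF s] True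
            by (simp add: g_def sc_def)
          moreover have "snd (config V x w T) \<noteq> []"
            using config_ok[OF wf two, of x w T] two by (auto simp: ok_config_def)
          ultimately show ?thesis using acc by (simp add: accepting_def cell_of_def hd_conv_nth)
        qed (auto simp: accepting_def split: cell.splits bool.splits)
        moreover have "N \<le> j + W" using NW True by simp
        moreover have "k j = (if Suc j = N then LastCell else Last)"
          using last True T(1) by (auto simp: k_def kind_of_def)
        ultimately show ?thesis using nj ok[OF chc chc, of j "j - 1" "Suc j"] by (auto simp: z_def tab_def)
      qed
    qed
  qed
  moreover have "fst (snd (snd (z j))) = snd (snd (snd (z (j - 1))))" if "j \<noteq> 0" "j < N" for j
  proof -
    have "Suc (j - 1) = j" using that by simp
    then have "ch (j - 1) \<noteq> End \<longrightarrow> g j = g (j - 1)" using gS[of "j - 1"] ch_End[of "j - 1"] by auto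
    then show ?thesis using that by (auto simp: z_def lc_def)
  qed
  moreover have "fst (z j) = fst (snd (z (j - W)))" if "\<not> j < W" "j < N" for j
    using down[of "j - W"] that by (simp add: z_def)
  ultimately have "tiling N W (\<lambda>j. tab (k j)) z"
    unfolding tiling_def case_prod_beta by (simp add: z_def)
  then show ?thesis by (auto simp: N_def k_def)
qed


lemma accept_iff:
  assumes "halts_with V [x, w] [R] T"
  shows "fst (config V x w T) = 1" "hd (snd (config V x w T)) 0 = 2 \<longleftrightarrow> R"
proof -
  obtain ts where "config V x w T = (1, ts)" "hd ts = tape_of [R]"
    using assms by (auto simp: halts_with_def config_def)
  then show "fst (config V x w T) = 1" "hd (snd (config V x w T)) 0 = 2 \<longleftrightarrow> R"
    by (auto simp: tape_of_def)
qed

text \<open>The horizontal codes make the tiles of a row agree on neighbours and scanned cell, the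
  vertical codes enforce \<open>next_cell\<close>, and the initial row yields a witness; by
  induction on rows the decoded cells are those of the run.\<close>

lemma tableau_sound:
  assumes T: "0 < T" "T + length x + P \<le> E"
  defines "W \<equiv> 2 * E + 3"
  assumes z: "tiling (W * (T + 1)) W (\<lambda>j. tab (kind_of x P E T (j div W) (j mod W))) z"
  shows "\<exists>w. length w \<le> P \<and> fst (config V x w T) = 1 \<and> hd (snd (config V x w T)) 0 = 2"
proof -
  define N where "N = W * (T + 1)"
  have W: "0 < W" by (simp add: W_def)
  define k where "k j = kind_of x P E T (j div W) (j mod W)" for j
  have z1: "z j \<in> tab (k j)" if "j < N" for j using z that by (simp add: tiling_def N_def k_def)
  have z2: "fst (snd (snd (z (Suc j)))) = snd (snd (snd (z j)))" if "Suc j < N" for j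
    using z that unfolding tiling_def case_prod_beta by (simp add: N_def)
  have z3: "fst (z (j + W)) = fst (snd (z j))" if "j + W < N" for j
    using z that unfolding tiling_def case_prod_beta by (simp add: N_def)
  \<comment> \<open>A tile shows its cells only through codes; \<open>good\<close> relates decoded
    cells to these codes and to the kind of the stage.\<close>
  define good where "good j y = (case y of (g, l, c, r) \<Rightarrow> ok_tile V (g, l, c, r) \<and>
     (k j \<noteq> Start \<longrightarrow> fst (snd (snd (z j))) = lc g l c) \<and>
     (k j \<noteq> LastCell \<longrightarrow> snd (snd (snd (z j))) = lc g c r) \<and>
     ((k j = Mid \<or> k j = Last \<or> k j = LastCell) \<longrightarrow> fst (z j) = vc c) \<and>
     ((k j = Last \<or> k j = LastCell) \<longrightarrow> accepting c) \<and>
     ((k j \<noteq> Last \<and> k j \<noteq> LastCell) \<longrightarrow> fst (snd (z j)) = vc (next_cell V g l c r)) \<and>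
     (k j = Start \<longrightarrow> c = End) \<and> (\<forall>a v f. k j = Row0 a v f \<longrightarrow> initial a v f c r))" for j y
  have "\<exists>y. good j y" if jN: "j < N" for j
  proof (cases "k j")
    case Start
    then obtain g l r where "ok_tile V (g, l, End, r)" "z j = (0, vc End, 0, lc g End r)"
      using z1[OF jN] by (auto simp: tab_def)
    moreover have "next_cell V g l End r = End" by (cases g) simp_all
    ultimately have "good j (g, l, End, r)" using Start by (simp add: good_def)
    then show ?thesis by blast
  next
    case Mid
    then obtain g l c r where "ok_tile V (g, l, c, r)" "z j = (vc c, vc (next_cell V g l c r), lc g l c, lc g c r)"
      using z1[OF jN] by (auto simp: tab_def)
    then have "good j (g, l, c, r)" using Mid by (simp add: good_def)
    then show ?thesis by blast
  next
    case Last
    then obtain g l c r where "ok_tile V (g, l, c, r)" "accepting c" "z j = (vc c, 0, lc g l c, lc g c r)"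
      using z1[OF jN] by (auto simp: tab_def)
    then have "good j (g, l, c, r)" using Last by (simp add: good_def)
    then show ?thesis by blast
  next
    case LastCell
    then obtain g l c r where "ok_tile V (g, l, c, r)" "accepting c" "z j = (vc c, 0, lc g l c, 0)"
      using z1[OF jN] by (auto simp: tab_def)
    then have "good j (g, l, c, r)" using LastCell by (simp add: good_def)
    then show ?thesis by blast
  next
    case (Row0 a v f)
    then obtain g l c r where "ok_tile V (g, l, c, r)" "initial a v f c r"
      "z j = (0, vc (next_cell V g l c r), lc g l c, lc g c r)"
      using z1[OF jN] by (auto simp: tab_def)
    then have "good j (g, l, c, r)" using Row0 by (simp add: good_def)
    then show ?thesis by blast
  qed
  then obtain y where y: "\<And>j. j < N \<Longrightarrow> good j (y j)" by metis
  define g where "g j = fst (y j)" for j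
  define l where "l j = fst (snd (y j))" for j
  define c where "c j = fst (snd (snd (y j)))" for j
  define r where "r j = snd (snd (snd (y j)))" for j
  have gd: "good j (g j, l j, c j, r j)" if "j < N" for j using y[OF that] by (simp add: g_def l_def c_def r_def)
  have ok: "g j \<in> cells V" "l j \<in> cells V" "c j \<in> cells V" "r j \<in> cells V" "scanned (c j) \<Longrightarrow> g j = c j"
    if "j < N" for j using gd[OF that] by (auto simp: good_def ok_tile_def)
  have kS: "k j = Start \<longleftrightarrow> j = 0" if "j < N" for j
  proof -
    have "j div W = 0 \<and> j mod W = 0 \<longleftrightarrow> j = 0" by (metis div_0 mod_0 mult_div_mod_eq mult_0_right add_0)
    then show ?thesis by (auto simp: k_def kind_of_def Let_def)
  qed
  have kL: "k j = LastCell \<Longrightarrow> Suc j = N" if "j < N" for j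
  proof -
    assume "k j = LastCell"
    then have "T \<le> j div W" "j mod W = 2 * E + 2" by (auto simp: k_def kind_of_def Let_def split: if_splits)
    moreover have "j div W \<le> T" using that W by (simp add: N_def div_less_iff_less_mult algebra_simps less_Suc_eq_le[symmetric])
    ultimately have "j = W * T + (2 * E + 2)" by (metis le_antisym mult_div_mod_eq)
    then show "Suc j = N" by (simp add: N_def W_def)
  qed
  have link: "l (Suc j) = c j \<and> r j = c (Suc j) \<and> (c j \<noteq> End \<longrightarrow> g (Suc j) = g j)" if "Suc j < N" for j
  proof -
    have "lc (g (Suc j)) (l (Suc j)) (c (Suc j)) = fst (snd (snd (z (Suc j))))"
      using gd[OF that] kS[OF that] by (simp add: good_def)
    also have "\<dots> = snd (snd (snd (z j)))" by (rule z2[OF that])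
    also have "\<dots> = lc (g j) (c j) (r j)"
      using gd[of j] kL[of j] that by (auto simp: good_def)
    finally show ?thesis using lc_inj[of "g (Suc j)" "l (Suc j)" "c (Suc j)" "g j" "c j" "r j"] ok[of j] ok[of "Suc j"] that by auto
  qed
  have idx: "(t * W + i) div W = t" "(t * W + i) mod W = i" if "i < W" for t i using that by simp_all
  have idx_less: "t * W + i < N" if "i < W" "t \<le> T" for t i
  proof -
    have "t * W \<le> T * W" using that(2) by (rule mult_le_mono1)
    then have "t * W + i < T * W + W" using that(1) by linarith
    also have "\<dots> = N" by (simp add: N_def algebra_simps)
    finally show ?thesis .
  qed
  have down: "c (Suc t * W + i) = next_cell V (g (t * W + i)) (l (t * W + i)) (c (t * W + i)) (r (t * W + i))"
    if "i < W" "t < T" for t i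
  proof -
    have j: "t * W + i + W < N" using idx_less[of i "Suc t"] that by (simp add: algebra_simps)
    then have j': "t * W + i < N" by simp
    have "k (t * W + i + W) \<in> {Mid, Last, LastCell}"
      using idx[of i "Suc t"] that by (auto simp: k_def kind_of_def algebra_simps)
    then have 1: "vc (c (t * W + i + W)) = fst (z (t * W + i + W))" using gd[OF j] by (auto simp: good_def)
    have "k (t * W + i) \<noteq> Last \<and> k (t * W + i) \<noteq> LastCell"
      using idx[of i t] that by (auto simp: k_def kind_of_def Let_def)
    then have 2: "fst (snd (z (t * W + i))) = vc (next_cell V (g (t * W + i)) (l (t * W + i)) (c (t * W + i)) (r (t * W + i)))"
      using gd[OF j'] by (simp add: good_def)
    have "c (t * W + i + W) = next_cell V (g (t * W + i)) (l (t * W + i)) (c (t * W + i)) (r (t * W + i))"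
      using 1 2 z3[OF j] ok(3)[OF j] next_cell_cells[OF wf ok(1-4)[OF j']] by (intro vc_inj) simp_all
    then show ?thesis by (simp add: algebra_simps)
  qed
  have col0: "c (t * W) = End" if "t \<le> T" for t
    using that
  proof (induction t)
    case 0
    then show ?case using gd[of 0] kS[of 0] W by (auto simp: good_def N_def)
  next
    case (Suc t)
    then show ?case using down[of 0 t] W by (cases "g (t * W)") simp_all
  qed
  define pos where "pos i = int i - int (E + 1)" for i
  have init: "initial (tape_of x (pos i)) (0 \<le> pos i \<and> pos i < int P) (pos i = 0) (c i) (c (Suc i))" if "0 < i" "i < W" for i
  proof -
    have "i < N" using idx_less[of i 0] that by simp
    moreover have "k i = Row0 (tape_of x (pos i)) (0 \<le> pos i \<and> pos i < int P) (pos i = 0)"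
      using that by (simp add: k_def kind_of_def pos_def Let_def)
    ultimately have "initial (tape_of x (pos i)) (0 \<le> pos i \<and> pos i < int P) (pos i = 0) (c i) (r i)"
      using gd[of i] by (simp add: good_def)
    moreover have "Suc i < N" using idx_less[of 0 1] idx_less[of "Suc i" 0] that T(1) W by (cases "Suc i = W") auto
    ultimately show ?thesis using link[of i] by simp
  qed
  define wt where "wt q = sym (c (q + E + 1)) 1" for q
  define m where "m = (LEAST q. wt q = 0)"
  have "wt P = 0"
    using init[of "P + E + 1"] T by (auto simp: initial_def wt_def pos_def W_def)
  then have m: "wt m = 0" "m \<le> P" "\<And>q. q < m \<Longrightarrow> wt q \<noteq> 0"
    unfolding m_def by (auto intro: LeastI Least_le dest: not_less_Least)
  have wt_le: "wt q \<le> 2" if "q \<le> P" for q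
    using init[of "q + E + 1"] T that by (auto simp: initial_def wt_def pos_def W_def split: if_splits)
  have wt_0: "wt q = 0" if "m \<le> q" "q \<le> E" for q
    using that
  proof (induction q rule: dec_induct)
    case (step q)
    show ?case
    proof (cases "q < P")
      case True
      then show ?thesis using init[of "q + E + 1"] step T by (auto simp: initial_def wt_def pos_def W_def)
    next
      case False
      then show ?thesis using init[of "Suc q + E + 1"] step by (auto simp: initial_def wt_def pos_def W_def)
    qed
  qed (rule m)
  define w where "w = map (\<lambda>q. wt q = 2) [0..<m]"
  have wtape: "tape_of w p = (if 0 \<le> p \<and> p < int m then wt (nat p) else 0)" for p
  proof (cases "0 \<le> p \<and> p < int m")
    case True
    then have "nat p < m" by linarith
    then have "wt (nat p) \<noteq> 0" "wt (nat p) \<le> 2" using m wt_le[of "nat p"] by auto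
    then have "wt (nat p) = 1 \<or> wt (nat p) = 2" by linarith
    then show ?thesis using True \<open>nat p < m\<close> by (auto simp: tape_of_def w_def)
  next
    case False
    then show ?thesis by (auto simp: tape_of_def w_def)
  qed
  have w: "length w \<le> P" using m by (simp add: w_def)
  have "\<forall>i<W. c (t * W + i) = content x w E t i" if "t \<le> T" for t
    using that
  proof (induction t)
    case 0
    show ?case
    proof (intro allI impI)
      fix i assume i: "i < W"
      show "c (0 * W + i) = content x w E 0 i"
      proof (cases "i = 0")
        case True
        then show ?thesis using col0[of 0] by (simp add: content_def)
      next
        case False
        obtain ss where ss: "c i = Cell 0 ss (pos i = 0)" "ss ! 0 = tape_of x (pos i)"
          "\<forall>i. 2 \<le> i \<and> i < length ss \<longrightarrow> ss ! i = 0"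
          and v: "if 0 \<le> pos i \<and> pos i < int P then True else ss ! 1 = 0"
          using init[of i] False i by (auto simp: initial_def split: if_splits)
        have "i < N" using idx_less[of i 0] i by simp
        then have len: "length ss = num_tapes V" using ok(3)[of i] ss(1) by (auto simp: cells_def)
        have "ss ! 1 = tape_of w (pos i)"
        proof (cases "0 \<le> pos i \<and> pos i < int m")
          case True
          then have "nat (pos i) + E + 1 = i" unfolding pos_def by linarith
          then show ?thesis using True ss(1) by (simp add: wtape wt_def)
        next
          case F: False
          show ?thesis
          proof (cases "0 \<le> pos i \<and> pos i < int P")
            case True
            then have "nat (pos i) + E + 1 = i" unfolding pos_def by linarith
            moreover have "wt (nat (pos i)) = 0" using F True T by (intro wt_0) auto
            ultimately show ?thesis using F ss(1) by (simp add: wtape wt_def)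
          next
            case False
            then show ?thesis using F v unfolding wtape by (metis (no_types, lifting))
          qed
        qed
        then have "ss = tape_of x (pos i) # tape_of w (pos i) # replicate (num_tapes V - 2) 0"
          using ss(2,3) len two by (intro nth_equalityI) (auto simp: nth_Cons numeral_2_eq_2 split: nat.splits)
        then show ?thesis using False ss(1) by (simp add: content_0 pos_def Let_def)
      qed
    qed
  next
    case (Suc t)
    then have IH: "\<And>i. i < W \<Longrightarrow> c (t * W + i) = content x w E t i" and t: "t < T" by auto
    have gsame: "i < W \<Longrightarrow> 0 < i \<Longrightarrow> g (t * W + i) = g (t * W + 1)" for i
    proof (induction i)
      case (Suc i)
      show ?case
      proof (cases "i = 0")
        case False
        have "c (t * W + i) \<noteq> End" using IH[of i] Suc.prems False by (simp add: content_def cell_of_def)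
        moreover have "Suc (t * W + i) < N" using idx_less[of "Suc i" t] Suc.prems t by simp
        ultimately show ?thesis using link[of "t * W + i"] Suc False by simp
      qed simp
    qed simp
    \<comment> \<open>All tiles of the row behind the border carry the same \<open>g\<close>, and in
      column \<open>E + 1\<close> the tile set forces it to be the scanned cell itself.\<close>
    have sc: "g (t * W + i) = cell_of (config V x w t) 0" if "i < W" "0 < i" for i
    proof -
      have c: "c (t * W + (E + 1)) = cell_of (config V x w t) 0"
        using IH[of "E + 1"] by (simp add: content_def W_def)
      then have "scanned (c (t * W + (E + 1)))" by (simp add: cell_of_def)
      then have "g (t * W + (E + 1)) = c (t * W + (E + 1))" using ok(5) idx_less[of "E + 1" t] t by (simp add: W_def)
      then show ?thesis using gsame[OF that] gsame[of "E + 1"] c by (simp add: W_def)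
    qed
    show ?case
    proof (intro allI impI)
      fix i assume i: "i < W"
      show "c (Suc t * W + i) = content x w E (Suc t) i"
      proof (cases "i = 0")
        case True
        then show ?thesis using col0[of "Suc t"] Suc.prems by (simp add: content_def)
      next
        case False
        have Si: "Suc (t * W + (i - 1)) = t * W + i" using False by simp
        have jN: "Suc (t * W + i) < N" using idx_less[of 0 "Suc t"] idx_less[of "Suc i" t] i t by (cases "Suc i = W") auto
        have "l (t * W + i) = content x w E t (i - 1)"
          using link[of "t * W + (i - 1)"] IH[of "i - 1"] jN i False unfolding Si by simp
        moreover have "r (t * W + i) = (if i = 2 * E + 2 then End else content x w E t (Suc i))"
        proof (cases "i = 2 * E + 2")
          case True
          then have "Suc (t * W + i) = Suc t * W" by (simp add: W_def)
          then have "c (Suc (t * W + i)) = End" using col0[OF Suc.prems] by (simp only:)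
          then show ?thesis using link[OF jN] True by simp
        next
          case False
          then have "Suc i < W" using i by (simp add: W_def)
          then show ?thesis using link[OF jN] IH[of "Suc i"] False by simp
        qed
        moreover have "t + length x + length w \<le> E" using t T w by simp
        ultimately show ?thesis
          using down[OF i t] content_step[of i E t x w "r (t * W + i)"] sc[OF i] IH[OF i] i False by (simp add: W_def)
      qed
    qed
  qed
  moreover have "E + 1 < W" by (simp add: W_def)
  ultimately have "c (T * W + (E + 1)) = content x w E T (E + 1)" by blast
  then have "c (T * W + (E + 1)) = cell_of (config V x w T) 0" by (simp add: content_def)
  moreover have "accepting (c (T * W + (E + 1)))"
  proof -
    have "T * W + (E + 1) < N" by (rule idx_less) (simp_all add: W_def)
    moreover have "k (T * W + (E + 1)) \<in> {Last, LastCell}"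
      using idx[of "E + 1" T] T(1) by (simp add: k_def kind_of_def W_def)
    ultimately show ?thesis using gd[of "T * W + (E + 1)"] by (auto simp: good_def)
  qed
  moreover have "snd (config V x w T) \<noteq> []"
    using config_ok[OF wf two, of x w T] two by (auto simp: ok_config_def)
  ultimately show ?thesis using w by (intro exI[of _ w]) (simp add: accepting_def cell_of_def hd_conv_nth)
qed

end

section \<open>The reduction as an expression\<close>

fun val :: "bool list \<Rightarrow> nat" where
  "val [] = 0"
| "val (b # bs) = (if b then 1 else 0) + 2 * val bs"

lemma val_append: "val (xs @ ys) = val xs + 2 ^ length xs * val ys"
  by (induction xs) (auto simp: algebra_simps)

lemma val_zeros [simp]: "val (replicate n False) = 0"
  by (induction n) auto

lemma digits_val: "bs = [] \<or> last bs \<Longrightarrow> digits (val bs) = bs"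
proof (induction bs)
  case (Cons b bs)
  have pos: "bs \<noteq> [] \<Longrightarrow> last bs \<Longrightarrow> 0 < val bs" for bs
    by (induction bs) (auto split: if_splits)
  have "0 < val (b # bs)" using pos[of "b # bs"] Cons.prems by simp
  moreover have "digits n = odd n # digits (n div 2)" if "0 < n" for n
    using that by (subst digits.simps) simp
  ultimately have "digits (val (b # bs)) = odd (val (b # bs)) # digits (val (b # bs) div 2)" by blast
  moreover have "odd (val (b # bs)) = b" "val (b # bs) div 2 = val bs" by auto
  moreover have "digits (val bs) = bs" using Cons by (cases bs) auto
  ultimately show ?case by simp
qed simp

lemma val_digits: "val (digits n) = n"
proof (induction n rule: less_induct)
  case (less n)
  show ?case
  proof (cases "n = 0")
    case False
    then have "val (digits n) = (if odd n then 1 else 0) + 2 * (n div 2)"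
      using less[of "n div 2"] by (simp add: digits.simps[of n])
    also have "\<dots> = n" by auto
    finally show ?thesis .
  qed simp
qed

fun bits :: "nat \<Rightarrow> nat \<Rightarrow> bool list" where
  "bits 0 v = []"
| "bits (Suc b) v = odd v # bits b (v div 2)"

lemma length_bits [simp]: "length (bits b v) = b"
  by (induction b arbitrary: v) auto

lemma val_bits: "v < 2 ^ b \<Longrightarrow> val (bits b v) = v"
  by (induction b arbitrary: v) auto

text \<open>The blocks of zeros are the gaps between the digits in base \<open>2 ^ b\<close> that
  carry the codes; the leading \<open>False\<close> is the factor 2 and the final
  \<open>True\<close> the constant digit.\<close>

definition weight_bits :: "nat \<Rightarrow> nat \<Rightarrow> nat \<Rightarrow> nat \<Rightarrow> tile \<Rightarrow> bool list" where
  "weight_bits b N W j = (\<lambda>(d, u, l, r). False # replicate (j * b) False @ bits b d @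
     replicate ((W - 1) * b) False @ bits b u @ replicate ((N - 1 - j) * b) False @
     replicate (j * b) False @ bits b l @ bits b r @ replicate ((N - 1 - j) * b) False @ [True])"

lemma val_weight_bits:
  assumes "d < 2 ^ b" "u < 2 ^ b" "l < 2 ^ b" "r < 2 ^ b" "j < N" "0 < W"
  shows "val (weight_bits b N W j (d, u, l, r)) = weight b N W j (d, u, l, r)"
proof -
  obtain m w where m: "N = Suc (j + m)" "W = Suc w" using assms(5,6) by (metis less_iff_Suc_add gr0_conv_Suc add_Suc_right)
  have mw: "N - 1 - j = m" "W - 1 = w" using m by auto
  define X :: nat where "X = 2 ^ b"
  have X: "(2 :: nat) ^ b = X" "(2 :: nat) ^ (n * b) = X ^ n" for n
    by (simp_all add: X_def mult.commute flip: power_mult)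
  have v: "val (bits b d) = d" "val (bits b u) = u" "val (bits b l) = l" "val (bits b r) = r"
    using assms(1-4) by (simp_all add: val_bits)
  have "val (weight_bits b N W j (d, u, l, r)) = 2 * (X ^ j * (d + X * (X ^ w * (u + X * (X ^ m * (X ^ j *
      (l + X * (r + X * X ^ m))))))))"
    unfolding weight_bits_def prod.case mw
    by (simp add: val_append v X)
  also have "\<dots> = 2 * (d * X ^ j + u * (X ^ j * X * X ^ w) + l * (X ^ j * X * X ^ w * X * X ^ m * X ^ j) +
      r * (X ^ j * X * X ^ w * X * X ^ m * X ^ j * X) + X ^ j * X * X ^ w * X * X ^ m * X ^ j * X * X * X ^ m)"
    by algebra
  also have "\<dots> = 2 * (d * X ^ j + u * X ^ (j + Suc w) + l * X ^ (Suc (j + m) + Suc w + j) +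
      r * X ^ (Suc (j + m) + Suc w + j + 1) + X ^ (2 * Suc (j + m) + Suc w + 1))"
  proof -
    have A: "X ^ (j + Suc w) = X ^ j * X * X ^ w" by (simp add: power_add)
    have B: "X ^ (Suc (j + m) + Suc w + j) = X ^ j * X * X ^ w * X * X ^ m * X ^ j"
      by (simp add: power_add mult_ac)
    have "2 * Suc (j + m) + Suc w + 1 = Suc (j + m) + Suc w + j + 1 + Suc m" by simp
    then have C: "X ^ (2 * Suc (j + m) + Suc w + 1) = X ^ (Suc (j + m) + Suc w + j) * X * X * X ^ m"
      by (simp only: power_add power_Suc power_one_right mult_ac)
    have D: "X ^ (Suc (j + m) + Suc w + j + 1) = X ^ (Suc (j + m) + Suc w + j) * X" by simp
    show ?thesis by (simp only: C D A B)
  qed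
  also have "\<dots> = weight b N W j (d, u, l, r)"
    unfolding weight_def Let_def prod.case X m ..
  finally show ?thesis .
qed

text \<open>Equal weights have equal digit strings, whose blocks lie at fixed positions. An instance
  lists its generators without repetition, so different tiles must give different matrices.\<close>

lemma weight_inj:
  assumes "weight b N W j q = weight b N W j q'" "j < N" "0 < W"
    "fst q < 2 ^ b" "fst (snd q) < 2 ^ b" "fst (snd (snd q)) < 2 ^ b" "snd (snd (snd q)) < 2 ^ b"
    "fst q' < 2 ^ b" "fst (snd q') < 2 ^ b" "fst (snd (snd q')) < 2 ^ b" "snd (snd (snd q')) < 2 ^ b"
  shows "q = q'"
proof -
  obtain d u l r d' u' l' r' where q: "q = (d, u, l, r)" "q' = (d', u', l', r')" by (cases q, cases q') auto
  note bq = assms(4-7)[unfolded q fst_conv snd_conv] and bq' = assms(8-11)[unfolded q fst_conv snd_conv]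
  have val: "val (weight_bits b N W j q) = val (weight_bits b N W j q')"
    using val_weight_bits[OF bq assms(2,3)] val_weight_bits[OF bq' assms(2,3)] assms(1)
    unfolding q by (simp only:)
  have dig: "digits (val (weight_bits b N W j y)) = weight_bits b N W j y" for y
    by (rule digits_val) (cases y, simp add: weight_bits_def)
  have "weight_bits b N W j q = weight_bits b N W j q'"
    using trans[OF sym[OF dig[of q]] trans[OF arg_cong[OF val, of digits] dig[of q']]] .
  then have "bits b d = bits b d' \<and> bits b u = bits b u' \<and> bits b l = bits b l' \<and> bits b r = bits b r'"
    unfolding q weight_bits_def prod.case
    by (simp only: list.inject same_append_eq append_eq_append_conv length_bits simp_thms)
  moreover have inj: "v = v'" if "bits b v = bits b v'" "v < 2 ^ b" "v' < 2 ^ b" for v v'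
    using arg_cong[OF that(1), of val] val_bits[OF that(2)] val_bits[OF that(3)] by (simp only:)
  ultimately have "d = d'" "u = u'" "l = l'" "r = r'"
    using bq bq' by blast+
  then show ?thesis by (simp add: q)
qed

lemma weight_pos: "0 < weight b N W j q"
  by (cases q) (simp add: weight_def Let_def)

definition mark :: "bool list \<Rightarrow> bool list" where
  "mark bs = concat (map (\<lambda>b. [True, b]) bs) @ [False]"

text \<open>Every entry of an arrow is, up to sign, a shift of the weight with at most two lower
  bits added and no carries, so its binary digits arise by concatenation, without
  arithmetic.\<close>

definition arrow_bits :: "bool \<Rightarrow> nat \<Rightarrow> bool list \<Rightarrow> bool list" where
  "arrow_bits s j bs = mark (False # True # replicate j False @ bs) @
     mark (s # replicate (j + 1) False @ True # True # replicate j False @ bs) @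
     mark (s # bs) @ mark (False # True # replicate (j + 1) False @ bs)"

lemma enc_int_bits: "bs \<noteq> [] \<Longrightarrow> last bs \<Longrightarrow> enc_int (if s then - int (val bs) else int (val bs)) = mark (s # bs)"
proof -
  assume *: "bs \<noteq> []" "last bs"
  have "0 < val bs" using * by (induction bs) (auto split: if_splits)
  then show ?thesis using digits_val[of bs] * by (simp add: enc_int_def mark_def)
qed

lemma enc_arrow:
  assumes "bs \<noteq> []" "last bs" "e = (if s then -1 else 1)"
  shows "enc_mat (arrow (e, j, val bs)) = arrow_bits s j bs"
proof -
  let ?A = "arrow (e, j, val bs)"
  have 1: "?A $ 1 $ 1 = int (val (True # replicate j False @ bs))"
    using assms(3) by (simp add: arrow_def edge_def val_append)
  have 2: "?A $ 1 $ 2 = (if s then - int (val (replicate (j + 1) False @ True # True # replicate j False @ bs))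
      else int (val (replicate (j + 1) False @ True # True # replicate j False @ bs)))"
    using assms(3) by (simp add: arrow_def edge_def val_append algebra_simps)
  have 3: "?A $ 2 $ 1 = (if s then - int (val bs) else int (val bs))"
    using assms(3) by (simp add: arrow_def edge_def)
  have 4: "?A $ 2 $ 2 = int (val (True # replicate (j + 1) False @ bs))"
    using assms(3) by (simp add: arrow_def edge_def val_append algebra_simps)
  show ?thesis unfolding enc_mat_def 1 2 3 4 arrow_bits_def
    using assms(1,2) enc_int_bits[of "True # replicate j False @ bs" False]
      enc_int_bits[of "replicate (j + 1) False @ True # True # replicate j False @ bs" s] enc_int_bits[of bs s]
      enc_int_bits[of "True # replicate (j + 1) False @ bs" False]
    by (simp only: if_False) (simp add: last_append)
qed

lemma arrow_inj:
  assumes "arrow (e, j, s) = arrow (e', j', s')" "0 < s" "0 < s'" "e \<in> {1, -1}" "e' \<in> {1, -1}"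
  shows "(e, j, s) = (e', j', s')"
proof -
  have "e * int s = e' * int s'" using arg_cong[OF assms(1), of "\<lambda>A. A $ 2 $ 1"] by (simp add: arrow_def edge_def)
  then have es: "e = e'" "s = s'" using assms(2-) by auto
  have "e * 2 ^ (j + 1) * (e * int s) = e * 2 ^ (j' + 1) * (e * int s)"
    using arg_cong[OF assms(1), of "\<lambda>A. A $ 1 $ 1"] es by (simp add: arrow_def edge_def)
  then have "(2 :: int) ^ (j + 1) = 2 ^ (j' + 1)" using assms(2,4) by auto
  then have "j + 1 = j' + 1" by (intro iffD1[OF power_inject_exp, of "2 :: int"]) simp_all
  then show ?thesis using es by simp
qed

lemma distinct_concat_map:
  assumes "distinct xs" "\<And>x. x \<in> set xs \<Longrightarrow> distinct (F x)"
    "\<And>x y. x \<in> set xs \<Longrightarrow> y \<in> set xs \<Longrightarrow> x \<noteq> y \<Longrightarrow> set (F x) \<inter> set (F y) = {}"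
  shows "distinct (concat (map F xs))"
  using assms
proof (induction xs)
  case (Cons a xs)
  then have "set (F a) \<inter> set (concat (map F xs)) = {}" by fastforce
  with Cons show ?case by simp
qed simp

lemma concat_concat: "concat (concat xss) = concat (map concat xss)"
  by (induction xss) auto


subsection \<open>Building blocks\<close>

primrec kon :: "nat list \<Rightarrow> ex" where
  "kon [] = Nl"
| "kon (a # as) = Cat (Sym a) (kon as)"

lemma kon [simp]: "eval (kon as) env = as" "wf_ex (kon as)" "poly_ex (kon as)"
  by (induction as) auto

lemma concat_replicate_const [simp]:
  "concat (map (\<lambda>_. replicate m a) [0..<n]) = replicate (n * m) a"
  by (induction n) (auto simp: add.commute simp flip: replicate_add)

text \<open>Horner's scheme in unary: a \<open>Loop\<close> of \<open>n\<close> rounds multiplies by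
  \<open>n\<close>. The arbitrary \<open>env\<close> absorbs the loop variable.\<close>

lemma poly_expr:
  "\<exists>e. wf_ex e \<and> poly_ex e \<and> (\<forall>n env. eval e (un n # env) = un (poly p n))"
proof (induction p)
  case 0
  show ?case by (intro exI[of _ Nl]) simp
next
  case (pCons a p)
  then obtain e where e: "wf_ex e" "poly_ex e" "\<And>n env. eval e (un n # env) = un (poly p n)" by blast
  show ?case
    by (intro exI[of _ "Cat (kon (un a)) (Loop (Var 0) e)"]) (simp add: e replicate_add)
qed

definition mark_ex :: ex where
  "mark_ex = Cat (Loop (Var 0) (Cat (Sym 1) (Cond 1 (Drop (Var 1) (Var 0)) (Sym 1) (Sym 0)))) (Sym 0)"

lemma mark_ex: "eval mark_ex [map bit bs] = map bit (mark bs)"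
proof -
  have "concat (map (\<lambda>j. [1, if drop j (map bit bs) \<noteq> [] \<and> hd (drop j (map bit bs)) = 1 then 1 else 0])
      [0..<length bs]) = concat (map (\<lambda>j. [1, bit (bs ! j)]) [0..<length bs])"
    by (intro arg_cong[of _ _ concat] map_cong) (auto simp: hd_drop_conv_nth bit_def)
  also have "\<dots> = concat (map (\<lambda>b. [1, bit b]) (map ((!) bs) [0..<length bs]))"
    unfolding map_map comp_def ..
  also have "\<dots> = map bit (concat (map (\<lambda>b. [True, b]) bs))"
    unfolding map_nth by (simp add: map_concat comp_def bit_def)
  finally show ?thesis
    by (simp add: mark_ex_def mark_def bit_def if_distrib[of "\<lambda>x. [1, x]"] if_distrib[of "\<lambda>x. [x]"] cong: if_cong)
qed

definition zeros_ex :: "nat \<Rightarrow> ex \<Rightarrow> ex" where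
  "zeros_ex b e = Loop e (kon (un b))"

lemma zeros_ex [simp]: "eval (zeros_ex b e) env = replicate (length (eval e env) * b) (bit False)"
  by (simp add: zeros_ex_def bit_def)

text \<open>Arguments of the following expressions: \<open>un j\<close>, \<open>un W\<close>, \<open>un N\<close>.\<close>

definition weight_ex :: "nat \<Rightarrow> tile \<Rightarrow> ex" where
  "weight_ex b = (\<lambda>(d, u, l, r). let k = (\<lambda>x. kon (map bit (bits b x)));
     z = zeros_ex b (Var 0); z' = zeros_ex b (Drop (Cat (Sym 0) (Var 0)) (Var 2)) in
     Cat (Sym 0) (Cat z (Cat (k d) (Cat (zeros_ex b (Drop (Sym 0) (Var 1))) (Cat (k u) (Cat z'
       (Cat z (Cat (k l) (Cat (k r) (Cat z' (Sym 1)))))))))))"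

lemma weight_ex: "eval (weight_ex b q) [un j, un W, un N] = map bit (weight_bits b N W j q)"
  by (cases q) (simp add: weight_ex_def weight_bits_def Let_def bit_def)

text \<open>Arguments: \<open>un j\<close> and the digits of the weight.\<close>

definition arrow_ex :: "bool \<Rightarrow> ex" where
  "arrow_ex s = (let m = (\<lambda>e. Call mark_ex [e]); z = zeros_ex 1 (Var 0) in
     Cat (m (Cat (kon [0, 1]) (Cat z (Var 1))))
     (Cat (m (Cat (Sym (bit s)) (Cat z (Cat (kon [0, 1, 1]) (Cat z (Var 1))))))
     (Cat (m (Cat (Sym (bit s)) (Var 1))) (m (Cat (kon [0, 1, 0]) (Cat z (Var 1)))))))"

lemma arrow_ex: "eval (arrow_ex s) [un j, map bit bs] = map bit (arrow_bits s j bs)"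
proof -
  have m: "eval mark_ex [ys] = map bit (mark zs)" if "ys = map bit zs" for ys zs
    using that mark_ex by simp
  have 1: "eval mark_ex [0 # 1 # replicate j 0 @ map bit bs] = map bit (mark (False # True # replicate j False @ bs))"
    by (rule m) (simp add: bit_def)
  have 2: "eval mark_ex [bit s # replicate j 0 @ 0 # 1 # 1 # replicate j 0 @ map bit bs] =
      map bit (mark (s # replicate (j + 1) False @ True # True # replicate j False @ bs))"
    by (rule m) (simp add: bit_def replicate_app_Cons_same)
  have 3: "eval mark_ex [bit s # map bit bs] = map bit (mark (s # bs))" by (rule m) simp
  have 4: "eval mark_ex [0 # 1 # 0 # replicate j 0 @ map bit bs] = map bit (mark (False # True # replicate (j + 1) False @ bs))"
    by (rule m) (simp add: bit_def)
  show ?thesis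
    using 1 2 3 4 by (simp add: arrow_ex_def Let_def arrow_bits_def) (simp add: bit_def)
qed

definition option_ex :: "nat \<Rightarrow> tile \<Rightarrow> ex" where
  "option_ex b q = Cat (Call (arrow_ex False) [Var 0, weight_ex b q]) (Call (arrow_ex True) [Var 0, weight_ex b q])"

definition option_mats :: "nat \<Rightarrow> nat \<Rightarrow> nat \<Rightarrow> nat \<Rightarrow> tile \<Rightarrow> mat2 list" where
  "option_mats b N W j q = [arrow (1, j, weight b N W j q), arrow (-1, j, weight b N W j q)]"

lemma enc_weight:
  assumes "fst q < 2 ^ b" "fst (snd q) < 2 ^ b" "fst (snd (snd q)) < 2 ^ b" "snd (snd (snd q)) < 2 ^ b"
    "j < N" "0 < W"
  shows "enc_mat (arrow (if s then -1 else 1, j, weight b N W j q)) = arrow_bits s j (weight_bits b N W j q)"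
proof -
  have "val (weight_bits b N W j q) = weight b N W j q" using assms by (cases q) (simp add: val_weight_bits)
  moreover have "last (weight_bits b N W j q)" "weight_bits b N W j q \<noteq> []"
    by (cases q; simp add: weight_bits_def)+
  ultimately show ?thesis using enc_arrow[of "weight_bits b N W j q" _ s j] by metis
qed

lemma option_ex:
  assumes "fst q < 2 ^ b" "fst (snd q) < 2 ^ b" "fst (snd (snd q)) < 2 ^ b" "snd (snd (snd q)) < 2 ^ b"
    "j < N" "0 < W"
  shows "eval (option_ex b q) [un j, un W, un N] = map bit (concat (map enc_mat (option_mats b N W j q)))"
  using enc_weight[OF assms, of True] enc_weight[OF assms, of False]
  by (simp add: option_ex_def option_mats_def weight_ex arrow_ex)

primrec cats :: "ex list \<Rightarrow> ex" where
  "cats [] = Nl"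
| "cats (e # es) = Cat e (cats es)"

lemma cats [simp]: "eval (cats es) env = concat (map (\<lambda>e. eval e env) es)"
  "wf_ex (cats es) \<longleftrightarrow> (\<forall>e\<in>set es. wf_ex e)" "poly_ex (cats es) \<longleftrightarrow> (\<forall>e\<in>set es. poly_ex e)"
  by (induction es) auto

text \<open>Arguments: \<open>un j\<close>, \<open>un W\<close>, \<open>un N\<close> and the string of the kinds of all stages.\<close>

primrec stage_ex :: "nat \<Rightarrow> (nat \<Rightarrow> tile list) \<Rightarrow> nat \<Rightarrow> ex" where
  "stage_ex b tb 0 = Nl"
| "stage_ex b tb (Suc m) = Cond m (Drop (Var 0) (Var 3))
     (cats (map (\<lambda>q. Call (option_ex b q) [Var 0, Var 1, Var 2]) (tb m))) (stage_ex b tb m)"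

lemma stage_ex:
  assumes "j < length ks" "ks ! j < m"
  shows "eval (stage_ex b tb m) [un j, un W, un N, ks] =
    concat (map (\<lambda>q. eval (option_ex b q) [un j, un W, un N]) (tb (ks ! j)))"
  using assms(2)
proof (induction m)
  case (Suc m)
  then show ?case
    using assms(1) by (cases "ks ! j = m") (simp_all add: hd_drop_conv_nth comp_def less_Suc_eq)
qed simp

text \<open>Arguments: the string of kinds and \<open>un W\<close>.\<close>

definition stages_ex :: "nat \<Rightarrow> (nat \<Rightarrow> tile list) \<Rightarrow> nat \<Rightarrow> ex" where
  "stages_ex b tb m = Cat (Call (arrow_ex False) [Nl, Call (weight_ex b (hd (tb 0))) [Nl, Var 1, zeros_ex 1 (Var 0)]])
     (Loop (Var 0) (Call (stage_ex b tb m) [Var 2, Var 1, zeros_ex 1 (Var 0), Var 0]))"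

lemma wf_zeros_ex [simp]: "wf_ex (zeros_ex b e) = wf_ex e" "poly_ex (zeros_ex b e) = poly_ex e"
  by (simp_all add: zeros_ex_def)

lemma wf_option_ex [simp]: "wf_ex (option_ex b q)" "poly_ex (option_ex b q)"
  "wf_ex (weight_ex b q)" "poly_ex (weight_ex b q)" "wf_ex (arrow_ex s)" "poly_ex (arrow_ex s)"
  by (cases q; simp add: option_ex_def weight_ex_def arrow_ex_def mark_ex_def Let_def)+

lemma wf_stages_ex [simp]: "wf_ex (stages_ex b tb m)" "poly_ex (stages_ex b tb m)"
proof -
  have "wf_ex (stage_ex b tb m) \<and> poly_ex (stage_ex b tb m)"
    by (induction m) auto
  then show "wf_ex (stages_ex b tb m)" "poly_ex (stages_ex b tb m)"
    by (simp_all add: stages_ex_def)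
qed

definition stage_mats :: "nat \<Rightarrow> (nat \<Rightarrow> tile list) \<Rightarrow> nat list \<Rightarrow> nat \<Rightarrow> mat2 list" where
  "stage_mats b tb ks W = concat (map (\<lambda>j. concat (map (option_mats b (length ks) W j) (tb (ks ! j)))) [0..<length ks])"

text \<open>The encoded target comes first; it is a copy of the first generator, since the promise
  requires a member of the semigroup.\<close>

lemma stages_ex:
  assumes "\<And>k. k \<in> set ks \<Longrightarrow> k < m" "0 < W" "ks \<noteq> []" "ks ! 0 = 0" "tb 0 \<noteq> []"
    and codes: "\<And>k q. q \<in> set (tb k) \<Longrightarrow> fst q < 2 ^ b \<and> fst (snd q) < 2 ^ b \<and> fst (snd (snd q)) < 2 ^ b \<and> snd (snd (snd q)) < 2 ^ b"
  shows "eval (stages_ex b tb m) [ks, un W] =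
    map bit (enc_mat (hd (stage_mats b tb ks W)) @ concat (map enc_mat (stage_mats b tb ks W)))"
proof -
  let ?N = "length ks"
  have unN: "replicate ?N (bit False) = un ?N" by (simp add: bit_def)
  have N: "0 < ?N" using assms(3) by simp
  have upt: "[0..<?N] = 0 # [1..<?N]" using N by (simp add: upt_conv_Cons)
  have hd: "hd (stage_mats b tb ks W) = arrow (1, 0, weight b ?N W 0 (hd (tb 0)))"
    using assms(4,5) unfolding stage_mats_def upt by (cases "tb 0") (auto simp: option_mats_def)
  have "hd (tb 0) \<in> set (tb 0)" using assms(5) by simp
  from codes[OF this] have "enc_mat (hd (stage_mats b tb ks W)) = arrow_bits False 0 (weight_bits b ?N W 0 (hd (tb 0)))"
    unfolding hd using enc_weight[of "hd (tb 0)" b 0 ?N W False] N assms(2) by simp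
  moreover have "eval (Call (arrow_ex False) [Nl, Call (weight_ex b (hd (tb 0))) [Nl, Var 1, zeros_ex 1 (Var 0)]]) [ks, un W] =
      map bit (arrow_bits False 0 (weight_bits b ?N W 0 (hd (tb 0))))"
    using weight_ex[of b "hd (tb 0)" 0 W ?N] arrow_ex[of False 0 "weight_bits b ?N W 0 (hd (tb 0))"]
    by (simp add: unN)
  moreover have "eval (Loop (Var 0) (Call (stage_ex b tb m) [Var 2, Var 1, zeros_ex 1 (Var 0), Var 0])) [ks, un W] =
      concat (map (\<lambda>j. map bit (concat (map enc_mat (concat (map (option_mats b ?N W j) (tb (ks ! j))))))) [0..<?N])"
  proof -
    have "eval (Loop (Var 0) (Call (stage_ex b tb m) [Var 2, Var 1, zeros_ex 1 (Var 0), Var 0])) [ks, un W] =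
      concat (map (\<lambda>j. eval (stage_ex b tb m) [un j, un W, un ?N, ks]) [0..<?N])"
      by (simp add: unN)
    also have "\<dots> = concat (map (\<lambda>j. map bit (concat (map enc_mat (concat (map (option_mats b ?N W j) (tb (ks ! j))))))) [0..<?N])"
    proof (intro arg_cong[of _ _ concat] map_cong refl)
      fix j assume "j \<in> set [0..<?N]"
      then have j: "j < ?N" by simp
      then have "eval (stage_ex b tb m) [un j, un W, un ?N, ks] =
          concat (map (\<lambda>q. eval (option_ex b q) [un j, un W, un ?N]) (tb (ks ! j)))"
        using assms(1) by (intro stage_ex) auto
      also have "\<dots> = concat (map (\<lambda>q. map bit (concat (map enc_mat (option_mats b ?N W j q)))) (tb (ks ! j)))"
        using codes j assms(2) by (intro arg_cong[of _ _ concat] map_cong refl option_ex) auto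
      also have "\<dots> = map bit (concat (map enc_mat (concat (map (option_mats b ?N W j) (tb (ks ! j))))))"
        by (simp add: map_concat comp_def concat_concat)
      finally show "eval (stage_ex b tb m) [un j, un W, un ?N, ks] = \<dots>" .
    qed
    finally show ?thesis .
  qed
  ultimately show ?thesis
    by (simp add: stages_ex_def stage_mats_def map_concat comp_def concat_concat del: eval.simps(7,9))
qed

section \<open>The kinds of all stages as a string\<close>

definition cell_kind :: "nat \<Rightarrow> bool \<Rightarrow> bool \<Rightarrow> nat" where
  "cell_kind a v f = 4 + a + (if v then 3 else 0) + (if f then 6 else 0)"

text \<open>Kinds become symbols: 0 to 3 for the four fixed kinds, 4 to 15 for the cells of the
  initial row as numbered by \<open>cell_kind\<close>.\<close>

definition kindn :: "nat \<Rightarrow> kind" where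
  "kindn m = (if m = 0 then Start else if m = 1 then Mid else if m = 2 then Last else if m = 3 then LastCell
     else Row0 ((m - 4) mod 3) ((m - 4) div 3 mod 2 = 1) (6 \<le> m - 4))"

lemma kindn_cell_kind: "a \<le> 2 \<Longrightarrow> kindn (cell_kind a v f) = Row0 a v f"
proof -
  assume "a \<le> 2"
  then have "a = 0 \<or> a = 1 \<or> a = 2" by linarith
  then show ?thesis by (cases v; cases f) (auto simp: kindn_def cell_kind_def)
qed

lemma tape_of_le: "tape_of x p \<le> 2"
  by (simp add: tape_of_def)

text \<open>In the initial row, \<open>E\<close> blank cells lie to the left of the scanned one and
  \<open>E + 2\<close> cells start with it; the symbol 4 is the kind of a blank cell without
  witness.\<close>

definition kinds :: "bool list \<Rightarrow> nat \<Rightarrow> nat \<Rightarrow> nat \<Rightarrow> nat list" where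
  "kinds x P T E = 0 # replicate E 4 @ map (\<lambda>p. cell_kind (tape_of x (int p)) (p < P) (p = 0)) [0..<E + 2] @
     replicate ((T - 1) * (2 * E + 3)) 1 @ replicate (2 * E + 2) 2 @ [3]"

lemma length_kinds: "0 < T \<Longrightarrow> length (kinds x P T E) = (2 * E + 3) * (T + 1)"
  by (cases T) (simp_all add: kinds_def algebra_simps)

lemma kinds_less: "k \<in> set (kinds x P T E) \<Longrightarrow> k < 16"
proof -
  have "cell_kind (tape_of x q) v f < 16" for q v f using tape_of_le[of x q] by (simp add: cell_kind_def)
  then show "k \<in> set (kinds x P T E) \<Longrightarrow> k < 16" by (auto simp: kinds_def)
qed

lemma nth_segment:
  "length a \<le> j \<Longrightarrow> j < length a + length b \<Longrightarrow> (a @ b @ c) ! j = b ! (j - length a)"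
proof -
  assume "length a \<le> j" "j < length a + length b"
  then have "j - length a < length b" "\<not> j < length a" by linarith+
  then show ?thesis by (simp add: nth_append)
qed

lemma nth_segment_const:
  "length a \<le> j \<Longrightarrow> j < length a + n \<Longrightarrow> (a @ replicate n v @ c) ! j = v"
  by (subst nth_segment) auto

lemma row_col:
  assumes "i < (w :: nat)" "j = w * r + i"
  shows "j div w = r" "j mod w = i"
  using assms by simp_all

context tableau
begin

lemma kindn_kinds:
  assumes "0 < T" "j < (2 * E + 3) * (T + 1)"
  shows "kindn (kinds x P T E ! j) = kind_of x P E T (j div (2 * E + 3)) (j mod (2 * E + 3))"
proof -
  obtain W where W: "W = 2 * E + 3" by blast
  obtain cs where cs: "cs = map (\<lambda>p. cell_kind (tape_of x (int p)) (p < P) (p = 0)) [0..<E + 2]" by blast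
  obtain t where t: "T = Suc t" using assms(1) by (cases T) auto
  obtain n where n: "n = t * W" by blast
  obtain m where m: "m = 2 * E + 2" by blast
  have K: "kinds x P T E = [0] @ replicate E 4 @ cs @ replicate n 1 @ replicate m 2 @ [3]"
    by (simp add: kinds_def t W cs n m del: upt_Suc replicate_Suc)
  have lcs: "length cs = E + 2" by (simp add: cs)
  have WT: "W * T = W + n" by (simp add: t n)
  have "(2 * E + 3) * (T + 1) = W * T + W" by (simp add: W algebra_simps)
  then have len: "j < W + n + W" using assms(2) WT by linarith
  obtain q where q: "q = kinds x P T E ! j" by blast
  consider "j = 0" | "0 < j" "j \<le> E" | "E < j" "j < W" | "W \<le> j" "j < W + n" | "W + n \<le> j" "j < W + n + m"
    | "j = W + n + m"
    using len W m by linarith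
  then have "kindn q = kind_of x P E T (j div W) (j mod W)"
  proof cases
    case 1
    then show ?thesis by (simp add: q kinds_def kindn_def kind_of_def)
  next
    case 2
    have "q = 4" unfolding q K by (rule nth_segment_const) (use 2 in auto)
    moreover have "j < W" using 2 W by linarith
    then have "j div W = 0" "j mod W = j" by simp_all
    moreover have "tape_of x (int j - int (E + 1)) = 0" using 2 by (simp add: tape_of_def)
    ultimately show ?thesis using 2 by (simp add: kindn_def kind_of_def Let_def W)
  next
    case 3
    define p where "p = j - (E + 1)"
    have p: "j = E + 1 + p" "p < E + 2" using 3 W by (auto simp: p_def)
    have "q = (([0] @ replicate E 4) @ cs @ (replicate n 1 @ replicate m 2 @ [3])) ! j" by (simp only: q K append_assoc)
    also have "\<dots> = cs ! (j - length ([0] @ replicate E (4::nat)))" by (rule nth_segment) (use p lcs in auto)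
    also have "\<dots> = cs ! p" using p by simp
    also have "\<dots> = cell_kind (tape_of x (int p)) (p < P) (p = 0)" using p(2) unfolding cs by (subst nth_map) (simp_all del: upt_Suc)
    finally have a: "q = cell_kind (tape_of x (int p)) (p < P) (p = 0)" .
    have b: "j div W = 0" "j mod W = j" "j \<noteq> 0" using 3 by simp_all
    have c: "int j - int (E + 1) = int p" using p by simp
    have "j \<noteq> 2 * E + 3" using 3 W by linarith
    have z: "\<And>c. kind_of x P E T 0 c = (if c = 0 then Start else Row0 (tape_of x (int c - int (E + 1)))
        (0 \<le> int c - int (E + 1) \<and> int c - int (E + 1) < int P) (int c - int (E + 1) = 0))"
      by (simp add: kind_of_def Let_def)
    show ?thesis
      unfolding a b(1,2) z c kindn_cell_kind[OF tape_of_le] using b(3) by simp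
  next
    case 4
    have "q = ((([0] @ replicate E 4) @ cs) @ replicate n 1 @ (replicate m 2 @ [3])) ! j" by (simp only: q K append_assoc)
    also have "\<dots> = 1" by (rule nth_segment_const) (use 4 lcs W in auto)
    finally have a: "q = 1" .
    have "0 < W" using W by simp
    then have "0 < j div W" using 4(1) by (simp add: div_greater_zero_iff)
    moreover have "j < T * W" using 4(2) WT by (simp add: mult.commute)
    then have "j div W < T" using \<open>0 < W\<close> by (simp add: div_less_iff_less_mult)
    ultimately show ?thesis unfolding a by (simp add: kindn_def kind_of_def)
  next
    case 5
    define i where "i = j - (W + n)"
    have i: "i < W" "j = W * T + i" "i < m" using 5 W m WT by (auto simp: i_def)
    have "q = (((([0] @ replicate E 4) @ cs) @ replicate n 1) @ replicate m 2 @ [3]) ! j" by (simp only: q K append_assoc)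
    also have "\<dots> = 2" by (rule nth_segment_const) (use 5 lcs W in auto)
    finally have a: "q = 2" .
    show ?thesis unfolding a row_col[OF i(1,2)] using i(3) m assms(1) by (simp add: kindn_def kind_of_def)
  next
    case 6
    have i: "m < W" "j = W * T + m" using 6 W m WT by auto
    have "q = ((((([0] @ replicate E 4) @ cs) @ replicate n 1) @ replicate m 2) @ [3] @ []) ! j" by (simp only: q K append_assoc append_Nil2)
    also have "\<dots> = [3] ! (j - length (((([0] @ replicate E 4) @ cs) @ replicate n 1) @ replicate m (2::nat)))"
      by (rule nth_segment) (use 6 lcs W in auto)
    also have "\<dots> = 3" using 6 lcs W by simp
    finally have a: "q = 3" .
    show ?thesis unfolding a row_col[OF i] using m assms(1) by (simp add: kindn_def kind_of_def)
  qed
  then show ?thesis unfolding q W .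
qed

end

text \<open>Arguments: \<open>x\<close>, \<open>un P\<close>, \<open>un (T - 1)\<close>, \<open>un E\<close>.\<close>

definition kinds_ex :: ex where
  "kinds_ex = (let w = Cat (Cat (Var 3) (Var 3)) (kon [0, 0, 0]); dp = Drop (Var 4);
     f = (\<lambda>c. Cond 0 (Var 4) (Sym c) (Sym (c + 6))); v = (\<lambda>c. Cond 0 (dp (Var 1)) (f (c + 3)) (f c)) in
     Cat (Sym 0) (Cat (Loop (Var 3) (Sym 4)) (Cat
       (Loop (Cat (Var 3) (kon [0, 0])) (Cond 1 (dp (Var 0)) (v 6) (Cond 0 (dp (Var 0)) (v 5) (v 4))))
       (Cat (Loop (Var 2) (Loop w (Sym 1))) (Cat (Loop (Drop (Sym 0) w) (Sym 2)) (Sym 3))))))"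

lemma kinds_ex:
  "eval kinds_ex [map bit x, un P, un T, un E] = kinds x P (Suc T) E"
proof -
  let ?env = "\<lambda>p. [map bit x, un P, un T, un E, un p]"
  have cell: "eval (Cond 1 (Drop (Var 4) (Var 0)) (Cond 0 (Drop (Var 4) (Var 1)) (Cond 0 (Var 4) (Sym 9) (Sym 15)) (Cond 0 (Var 4) (Sym 6) (Sym 12)))
      (Cond 0 (Drop (Var 4) (Var 0)) (Cond 0 (Drop (Var 4) (Var 1)) (Cond 0 (Var 4) (Sym 8) (Sym 14)) (Cond 0 (Var 4) (Sym 5) (Sym 11)))
        (Cond 0 (Drop (Var 4) (Var 1)) (Cond 0 (Var 4) (Sym 7) (Sym 13)) (Cond 0 (Var 4) (Sym 4) (Sym 10))))) (?env p)
      = [cell_kind (tape_of x (int p)) (p < P) (p = 0)]" for p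
  proof -
    have d: "drop p (map bit x) \<noteq> [] \<and> hd (drop p (map bit x)) = a \<longleftrightarrow> p < length x \<and> bit (x ! p) = a" for a
      by (auto simp: hd_drop_conv_nth)
    have u: "drop p (un P) \<noteq> [] \<and> hd (drop p (un P)) = 0 \<longleftrightarrow> p < P"
      by (auto simp: hd_drop_conv_nth)
    have z: "un p \<noteq> [] \<and> hd (un p) = 0 \<longleftrightarrow> p \<noteq> 0" by (cases p) auto
    have t: "tape_of x (int p) = (if p < length x then if x ! p then 2 else 1 else 0)"
      by (simp add: tape_of_def)
    have e: "eval (Drop (Var 4) (Var 0)) (?env p) = drop p (map bit x)"
      "eval (Drop (Var 4) (Var 1)) (?env p) = drop p (un P)" "eval (Var 4) (?env p) = un p"
      by simp_all
    show ?thesis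
      unfolding eval.simps(3,6) e d u z by (simp add: t cell_kind_def bit_def)
  qed
  have c1: "concat (map (\<lambda>j. [a]) [0..<n]) = replicate n a" for a :: nat and n
    using concat_replicate_const[of 1 a n] by simp
  have "eval (Loop (Cat (Var 3) (kon [0, 0])) (Cond 1 (Drop (Var 4) (Var 0)) (Cond 0 (Drop (Var 4) (Var 1)) (Cond 0 (Var 4) (Sym 9) (Sym 15)) (Cond 0 (Var 4) (Sym 6) (Sym 12)))
      (Cond 0 (Drop (Var 4) (Var 0)) (Cond 0 (Drop (Var 4) (Var 1)) (Cond 0 (Var 4) (Sym 8) (Sym 14)) (Cond 0 (Var 4) (Sym 5) (Sym 11)))
        (Cond 0 (Drop (Var 4) (Var 1)) (Cond 0 (Var 4) (Sym 7) (Sym 13)) (Cond 0 (Var 4) (Sym 4) (Sym 10)))))) [map bit x, un P, un T, un E]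
      = concat (map (\<lambda>p. [cell_kind (tape_of x (int p)) (p < P) (p = 0)]) [0..<E + 2])"
    unfolding eval.simps(7) by (simp only: append_Cons append_Nil cell) simp
  then have loop: "eval (Loop (Cat (Var 3) (kon [0, 0])) (Cond 1 (Drop (Var 4) (Var 0)) (Cond 0 (Drop (Var 4) (Var 1)) (Cond 0 (Var 4) (Sym 9) (Sym 15)) (Cond 0 (Var 4) (Sym 6) (Sym 12)))
      (Cond 0 (Drop (Var 4) (Var 0)) (Cond 0 (Drop (Var 4) (Var 1)) (Cond 0 (Var 4) (Sym 8) (Sym 14)) (Cond 0 (Var 4) (Sym 5) (Sym 11)))
        (Cond 0 (Drop (Var 4) (Var 1)) (Cond 0 (Var 4) (Sym 7) (Sym 13)) (Cond 0 (Var 4) (Sym 4) (Sym 10)))))) [map bit x, un P, un T, un E]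
      = map (\<lambda>p. cell_kind (tape_of x (int p)) (p < P) (p = 0)) [0..<E + 2]"
    by (rule trans[OF _ concat_map_singleton])
  have loop_sym: "eval (Loop d (Sym a)) env = replicate (length (eval d env)) a" for d a env
    unfolding eval.simps by (rule c1)
  let ?w = "Cat (Cat (Var 3) (Var 3)) (kon [0, 0, 0])"
  have w: "length (eval ?w ([map bit x, un P, un T, un E] @ env)) = 2 * E + 3" for env by simp
  have r1: "eval (Loop (Var 3) (Sym 4)) [map bit x, un P, un T, un E] = replicate E 4"
    unfolding loop_sym by simp
  have r2: "eval (Loop (Var 2) (Loop ?w (Sym 1))) [map bit x, un P, un T, un E] = replicate (T * (2 * E + 3)) 1"
    unfolding eval.simps(7)[of "Var 2"] loop_sym w concat_replicate_const by simp
  have r3: "eval (Loop (Drop (Sym 0) ?w) (Sym 2)) [map bit x, un P, un T, un E] = replicate (2 * E + 2) 2"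
    unfolding loop_sym eval.simps(5)[of "Sym 0"] length_drop using w[of "[]"] by (simp only: append_Nil2) simp
  note rest = r1 r2 r3
  show ?thesis
    unfolding kinds_ex_def Let_def eval.simps(3,4)
    using loop rest by (simp add: kinds_def del: eval.simps upt_Suc replicate_Suc)
qed

lemma wf_kinds_ex [simp]: "wf_ex kinds_ex" "poly_ex kinds_ex"
  by (simp_all add: kinds_ex_def Let_def)

section \<open>Assembly of the reduction\<close>

definition red_ex :: "ex \<Rightarrow> ex \<Rightarrow> nat \<Rightarrow> (nat \<Rightarrow> tile list) \<Rightarrow> ex" where
  "red_ex pe rx b tb = (let n = zeros_ex 1 (Var 0); P = Call pe [n]; r = Call rx [Cat n P]; T = Cat r r;
     E = Cat (Cat (Sym 0) T) (Cat n P) in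
     Call (stages_ex b tb 16) [Call kinds_ex [Var 0, P, T, E], Cat (Cat E E) (kon [0, 0, 0])])"

lemma red_ex:
  assumes "\<And>n env. eval pe (un n # env) = un (poly p n)" "\<And>n env. eval rx (un n # env) = un (poly r n)"
  defines "P \<equiv> \<lambda>n. poly p n" and "T \<equiv> \<lambda>n. 2 * poly r (n + poly p n)"
    and "E \<equiv> \<lambda>n. Suc (2 * poly r (n + poly p n)) + n + poly p n"
  shows "eval (red_ex pe rx b tb) [map bit x] = eval (stages_ex b tb 16)
     [kinds x (P (length x)) (Suc (T (length x))) (E (length x)), un (2 * E (length x) + 3)]"
proof -
  let ?env = "[map bit x]" and ?l = "length x"
  define n where "n = zeros_ex 1 (Var 0)"
  define pP where "pP = Call pe [n]"
  define pr where "pr = Call rx [Cat n pP]"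
  define pT where "pT = Cat pr pr"
  define pE where "pE = Cat (Cat (Sym 0) pT) (Cat n pP)"
  have u: "un a @ un b = un (a + b)" "[0] @ un a = un (Suc a)" for a b by (simp_all add: replicate_add)
  have n: "eval n ?env = un ?l" by (simp add: n_def bit_def)
  have pP: "eval pP ?env = un (P ?l)" by (simp only: pP_def eval.simps list.map n assms(1) P_def)
  have pr: "eval pr ?env = un (poly r (?l + P ?l))" by (simp only: pr_def eval.simps list.map n pP u assms(2))
  have pT: "eval pT ?env = un (T ?l)" by (simp only: pT_def eval.simps pr u T_def mult_2 P_def)
  have pE: "eval pE ?env = un (E ?l)" by (simp only: pE_def eval.simps pT n pP u E_def T_def P_def) (simp add: add_ac)
  have pW: "eval (Cat (Cat pE pE) (kon [0, 0, 0])) ?env = un (2 * E ?l + 3)"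
    by (simp only: eval.simps pE u) (simp add: mult_2 numeral_3_eq_3 flip: replicate_append_same)
  have x: "eval (Var 0) ?env = map bit x" by simp
  have "red_ex pe rx b tb = Call (stages_ex b tb 16) [Call kinds_ex [Var 0, pP, pT, pE], Cat (Cat pE pE) (kon [0, 0, 0])]"
    by (simp only: red_ex_def Let_def n_def pP_def pr_def pT_def pE_def)
  then show ?thesis
    by (simp only: eval.simps(9) list.map x pP pT pE pW kinds_ex)
qed

theorem NP_hard_recurrent: "NP_hard recurrent_matrix_problem"
  unfolding NP_hard_def
proof
  fix L assume "L \<in> NP"
  then obtain R p where "polytime_rel R" and L: "\<And>x. x \<in> L \<longleftrightarrow> (\<exists>w. length w \<le> poly p (length x) \<and> R x w)"
    by (auto simp: NP_def)
  then obtain V r where V: "wf_tm V" "\<And>x w. halts_with V [x, w] [R x w] (poly r (length x + length w))"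
    by (auto simp: polytime_rel_def)
  have two: "2 \<le> num_tapes V" using V(2)[of "[]" "[]"] by (simp add: halts_with_def)
  let ?C = "cells V"
  obtain h n where h: "h ` (?C \<times> ?C \<times> ?C) = {i. i < (n :: nat)}" "inj_on h (?C \<times> ?C \<times> ?C)"
    using finite_imp_inj_to_nat_seg[OF finite_cartesian_product[OF finite_cells[of V]
      finite_cartesian_product[OF finite_cells[of V] finite_cells[of V]]]] by (elim exE conjE) (rule that)
  obtain v m where v: "v ` ?C = {i. i < (m :: nat)}" "inj_on v ?C"
    using finite_imp_inj_to_nat_seg[OF finite_cells[of V]] by (elim exE conjE) (rule that)
  define b where "b = Suc (n + m)"
  have "n + m < 2 ^ (n + m)" by (rule less_exp)
  then have b: "Suc n < 2 ^ b" "Suc m < 2 ^ b" unfolding b_def power_Suc by linarith+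
  interpret tableau V "\<lambda>c. Suc (h c)" "\<lambda>c. Suc (v c)" b
  proof
    show "inj_on (\<lambda>c. Suc (h c)) (?C \<times> ?C \<times> ?C)" "inj_on (\<lambda>c. Suc (v c)) ?C"
      using h(2) v(2) by (auto simp: inj_on_def)
    show "(\<lambda>c. Suc (h c)) ` (?C \<times> ?C \<times> ?C) \<subseteq> {1..<2 ^ b}"
    proof
      fix y assume "y \<in> (\<lambda>c. Suc (h c)) ` (?C \<times> ?C \<times> ?C)"
      then obtain c where "c \<in> ?C \<times> ?C \<times> ?C" "y = Suc (h c)" by blast
      moreover from this have "h c < n" using h(1) by blast
      ultimately show "y \<in> {1..<2 ^ b}" using b by simp
    qed
    show "(\<lambda>c. Suc (v c)) ` ?C \<subseteq> {1..<2 ^ b}"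
    proof
      fix y assume "y \<in> (\<lambda>c. Suc (v c)) ` ?C"
      then obtain c where "c \<in> ?C" "y = Suc (v c)" by blast
      moreover from this have "v c < m" using v(1) by blast
      ultimately show "y \<in> {1..<2 ^ b}" using b by simp
    qed
  qed (rule V(1), rule two)
  \<comment> \<open>The tile sets depend on the verifier only, so they are built into the reduction
    as constants.\<close>
  have "\<forall>k. \<exists>xs. set xs = tab (kindn k) \<and> distinct xs" using finite_distinct_list[OF tab_finite] by blast
  then obtain tb where tb: "\<And>k. set (tb k) = tab (kindn k)" "\<And>k. distinct (tb k)" by metis
  obtain pe where pe: "wf_ex pe" "poly_ex pe" "\<And>n env. eval pe (un n # env) = un (poly p n)"
    using poly_expr[of p] by blast
  obtain rx where rx: "wf_ex rx" "poly_ex rx" "\<And>n env. eval rx (un n # env) = un (poly r n)"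
    using poly_expr[of r] by blast
  define P where "P x = poly p (length x)" for x :: "bool list"
  \<comment> \<open>An odd number of steps makes the number \<open>W * (T + 1)\<close> of stages
    even. Exceeding the time bound is harmless because halted configurations do not change.\<close>
  define T where "T x = Suc (2 * poly r (length x + P x))" for x :: "bool list"
  define E where "E x = T x + length x + P x" for x :: "bool list"
  define W where "W x = 2 * E x + 3" for x :: "bool list"
  define ks where "ks x = kinds x (P x) (T x) (E x)" for x
  define mats where "mats x = stage_mats b tb (ks x) (W x)" for x
  define f where "f x = enc_mat (hd (mats x)) @ concat (map enc_mat (mats x))" for x
  have codes: "fst q < 2 ^ b \<and> fst (snd q) < 2 ^ b \<and> fst (snd (snd q)) < 2 ^ b \<and> snd (snd (snd q)) < 2 ^ b"
    if "q \<in> set (tb k)" for q k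
    using tab_codes[of "fst q" "fst (snd q)" "fst (snd (snd q))" "snd (snd (snd q))" "kindn k"] that tb(1) by simp
  have tb0: "tb 0 \<noteq> []" using tab_Start tb(1)[of 0] by (auto simp: kindn_def)
  have ks0: "ks x \<noteq> []" "ks x ! 0 = 0" for x by (simp_all add: ks_def kinds_def)
  have W: "0 < W x" for x by (simp add: W_def)
  have "eval (red_ex pe rx b tb) [map bit x] = map bit (f x)" for x
  proof -
    have "eval (red_ex pe rx b tb) [map bit x] = eval (stages_ex b tb 16) [ks x, un (W x)]"
      using red_ex[OF pe(3) rx(3), of b tb x]
      by (simp add: ks_def W_def E_def T_def P_def add.assoc)
    also have "\<dots> = map bit (f x)"
      unfolding f_def mats_def using kinds_less ks0 W tb0 codes by (intro stages_ex) (auto simp: ks_def)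
    finally show ?thesis .
  qed
  moreover have "wf_ex (red_ex pe rx b tb)" "poly_ex (red_ex pe rx b tb)"
    using pe rx by (simp_all add: red_ex_def Let_def)
  ultimately have "polytime f" by (intro ex_polytime)
  moreover have "(x \<in> L \<longrightarrow> f x \<in> fst recurrent_matrix_problem) \<and> (x \<notin> L \<longrightarrow> f x \<in> snd recurrent_matrix_problem)" for x
  proof -
    define N where "N = length (ks x)"
    have T: "0 < T x" by (simp add: T_def)
    have N: "N = W x * (T x + 1)" using length_kinds[OF T] by (simp add: N_def ks_def W_def)
    have N0: "0 < N" "odd (W x)" "even N" using W by (simp_all add: N W_def T_def)
    define tabj where "tabj j = tab (kindn (ks x ! j))" for j
    define G where "G = arrow ` arrows N (options b N (W x) tabj)"
    have mats: "mats x = concat (map (\<lambda>j. concat (map (option_mats b N (W x) j) (tb (ks x ! j)))) [0..<N])"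
      by (simp add: mats_def stage_mats_def N_def)
    have set_mats: "set (mats x) = G"
      unfolding mats G_def arrows_def options_def
      by (auto simp: tb(1) tabj_def option_mats_def image_iff)
    have wi: "q = q'" if "weight b N (W x) j q = weight b N (W x) j q'" "q \<in> set (tb k)" "q' \<in> set (tb k')" "j < N" for q q' j k k'
      by (rule weight_inj[OF that(1,4) W]) (use codes[OF that(2)] codes[OF that(3)] in auto)
    have ai: "e = e' \<and> j = j' \<and> weight b N (W x) j q = weight b N (W x) j' q'"
      if h: "arrow (e, j, weight b N (W x) j q) = arrow (e', j', weight b N (W x) j' q')" "e \<in> {1, -1}" "e' \<in> {1, -1}"
      for e e' j j' q q'
      using arrow_inj[OF h(1) weight_pos weight_pos h(2,3)] unfolding prod.inject .
    have om: "\<exists>e\<in>{1, -1}. A = arrow (e, j, weight b N (W x) j q)" if "A \<in> set (option_mats b N (W x) j q)" for A j q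
      using that unfolding option_mats_def by auto
    have od: "set (option_mats b N (W x) j q) \<inter> set (option_mats b N (W x) j' q') = {}"
      if ne: "\<not> (j = j' \<and> weight b N (W x) j q = weight b N (W x) j' q')" for j j' q q'
    proof (rule equals0I)
      fix A assume "A \<in> set (option_mats b N (W x) j q) \<inter> set (option_mats b N (W x) j' q')"
      then obtain e e' where e: "e \<in> {1, -1}" "A = arrow (e, j, weight b N (W x) j q)"
          "e' \<in> {1, -1}" "A = arrow (e', j', weight b N (W x) j' q')"
        using om[of A j q] om[of A j' q'] by blast
      show False using ai[OF trans[OF e(2)[symmetric] e(4)] e(1,3)] ne by blast
    qed
    have dist: "distinct (mats x)"
      unfolding mats
    proof (intro distinct_concat_map)
      fix j q assume "j \<in> set [0..<N]" "q \<in> set (tb (ks x ! j))"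
      have "arrow (1, j, weight b N (W x) j q) \<noteq> arrow (-1, j, weight b N (W x) j q)"
        using ai[of 1 j q "-1" j q] by fastforce
      then show "distinct (option_mats b N (W x) j q)" unfolding option_mats_def by simp
    next
      fix j q q' assume j: "j \<in> set [0..<N]" and q: "q \<in> set (tb (ks x ! j))" "q' \<in> set (tb (ks x ! j))" "q \<noteq> q'"
      have "weight b N (W x) j q \<noteq> weight b N (W x) j q'" using wi[OF _ q(1,2), of j] q(3) j by fastforce
      then show "set (option_mats b N (W x) j q) \<inter> set (option_mats b N (W x) j q') = {}"
        by (intro od) simp
    next
      fix j j' :: nat assume ne: "j \<noteq> j'"
      show "set (concat (map (option_mats b N (W x) j) (tb (ks x ! j)))) \<inter>
          set (concat (map (option_mats b N (W x) j') (tb (ks x ! j')))) = {}"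
      proof (rule equals0I)
        fix A assume A: "A \<in> set (concat (map (option_mats b N (W x) j) (tb (ks x ! j)))) \<inter>
          set (concat (map (option_mats b N (W x) j') (tb (ks x ! j'))))"
        obtain q where "A \<in> set (option_mats b N (W x) j q)" using IntD1[OF A] unfolding set_concat set_map by blast
        moreover obtain q' where "A \<in> set (option_mats b N (W x) j' q')" using IntD2[OF A] unfolding set_concat set_map by blast
        ultimately show False using od[of j j' q q'] ne by blast
      qed
    qed (simp_all add: tb(2))
    have ne: "mats x \<noteq> []"
    proof -
      have "tabj 0 \<noteq> {}" using tab_Start ks0 by (simp add: tabj_def kindn_def)
      then have "G \<noteq> {}" using N0(1) by (auto simp: G_def arrows_def options_def)
      then show ?thesis using set_mats by auto
    qed
    have M: "hd (mats x) \<in> semigroup_gen G"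
      unfolding semigroup_gen_def using ne set_mats hd_in_set[OF ne]
      by (intro CollectI exI[of _ "[hd (mats x)]"]) auto
    have enc: "encodes (f x) G (hd (mats x))"
      unfolding encodes_def f_def using dist set_mats by blast
    have fin: "finite G" using set_mats by (metis List.finite_set)
    have SL: "G \<subseteq> SL2Z" by (auto simp: G_def arrow_def edge_SL2Z)
    have kd: "kindn (ks x ! j) = kind_of x (P x) (E x) (T x) (j div W x) (j mod W x)" if "j < N" for j
      using kindn_kinds[OF T] that by (simp add: ks_def N W_def)
    have start: "kindn (ks x ! j) = Start \<Longrightarrow> j = 0" if "j < N" for j
    proof -
      assume "kindn (ks x ! j) = Start"
      then have "j div W x = 0 \<and> j mod W x = 0" using kd[OF that] by (auto simp: kind_of_def Let_def split: if_splits)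
      then show "j = 0" by (metis div_mod_decomp mult_0 add_0)
    qed
    have last: "kindn (ks x ! j) = LastCell \<Longrightarrow> Suc j = N" if "j < N" for j
    proof -
      assume "kindn (ks x ! j) = LastCell"
      then have k: "T x \<le> j div W x" "j mod W x = 2 * E x + 2"
        using kd[OF that] by (auto simp: kind_of_def Let_def split: if_splits)
      have "W x * T x \<le> W x * (j div W x)" using k(1) by simp
      then have "W x * T x + (2 * E x + 2) \<le> j" using k(2) mult_div_mod_eq[of "W x" j] by linarith
      then show "Suc j = N" using that by (simp add: N W_def)
    qed
    have "infinite (factorizations G (hd (mats x))) \<longleftrightarrow> (\<exists>z. tiling N (W x) tabj z)"
      unfolding G_def
    proof (rule tiling_factorizations[OF N0(2,3,1)])
      show "0 < b" by (simp add: b_def)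
      show "finite (tabj j)" for j by (simp add: tabj_def tab_finite)
      show "d < 2 ^ b \<and> u < 2 ^ b \<and> l < 2 ^ b \<and> r < 2 ^ b \<and> (0 < i \<longrightarrow> l \<noteq> 0) \<and> (Suc i < N \<longrightarrow> r \<noteq> 0)"
        if "i < N" "(d, u, l, r) \<in> tabj i" for i d u l r
        using tab_codes[of d u l r "kindn (ks x ! i)"] that start[of i] last[of i] by (auto simp: tabj_def)
      show "hd (mats x) \<in> semigroup_gen (arrow ` arrows N (options b N (W x) tabj))" using M by (simp add: G_def)
    qed
    also have "\<dots> \<longleftrightarrow> (\<exists>z. tiling N (W x) (\<lambda>j. tab (kind_of x (P x) (E x) (T x) (j div W x) (j mod W x))) z)"
      unfolding tiling_def using kd by (simp add: tabj_def)
    also have "\<dots> \<longleftrightarrow> x \<in> L"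
    proof -
      have halts: "halts_with V [x, w] [R x w] (T x)" if "length w \<le> P x" for w
      proof -
        have "poly r (length x + length w) \<le> poly r (length x + P x)" using that by (intro poly_nat_mono) simp
        then show ?thesis by (intro halts_with_mono[OF V(2)]) (simp add: T_def)
      qed
      show ?thesis
      proof
        assume "\<exists>z. tiling N (W x) (\<lambda>j. tab (kind_of x (P x) (E x) (T x) (j div W x) (j mod W x))) z"
        then obtain w where w: "length w \<le> P x" "fst (config V x w (T x)) = 1" "hd (snd (config V x w (T x))) 0 = 2"
          using tableau_sound[OF T, of x "P x" "E x"] by (auto simp: N W_def E_def)
        then have "R x w" using accept_iff(2)[OF halts[OF w(1)]] by simp
        then show "x \<in> L" using L w(1) by (auto simp: P_def)
      next
        assume "x \<in> L"
        then obtain w where w: "length w \<le> P x" "R x w" using L by (auto simp: P_def)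
        note acc = accept_iff[OF halts[OF w(1)]]
        have "T x + length x + length w \<le> E x" using w(1) by (simp add: E_def)
        from tableau_complete[OF T this w(1) acc(1)] show "\<exists>z. tiling N (W x) (\<lambda>j. tab (kind_of x (P x) (E x) (T x) (j div W x) (j mod W x))) z"
          using acc(2) w(2) by (simp add: N W_def)
      qed
    qed
    finally have iff: "infinite (factorizations G (hd (mats x))) \<longleftrightarrow> x \<in> L" .
    show ?thesis
      using iff enc fin SL M unfolding recurrent_matrix_problem_def by auto
  qed
  ultimately show "\<exists>f. polytime f \<and> (\<forall>x. (x \<in> L \<longrightarrow> f x \<in> fst recurrent_matrix_problem) \<and> (x \<notin> L \<longrightarrow> f x \<in> snd recurrent_matrix_problem))"
    by blast
qed

section \<open>The decision procedure\<close>

text \<open>\<open>st\<close> maps an abstract state to the variables that represent it, so that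
  iterations can be analysed on abstract states.\<close>

lemma eval_Iter:
  assumes "map (\<lambda>s. eval s env) ins = st a" "\<And>a. map (\<lambda>s. eval s (env @ st a)) ss = st (f a)"
  shows "eval (Iter d ins ss e) env = eval e (env @ st ((f ^^ length (eval d env)) a))"
proof -
  have "((\<lambda>vs. map (\<lambda>g. g (env @ vs)) (map eval ss)) ^^ n) (st a) = st ((f ^^ n) a)" for n
  proof (induction n)
    case (Suc n)
    then show ?case using assms(2)[of "(f ^^ n) a"] by (simp add: o_def)
  qed simp
  then show ?thesis using assms(1) by (simp add: o_def)
qed

lemma funpow_fixed: "f a = a \<Longrightarrow> (f ^^ n) a = a"
  by (induction n) simp_all

section \<open>Unary arithmetic and parsing by iteration\<close>

definition pow2_ex :: ex where
  "pow2_ex = Iter (Var 0) [Sym 0] [Cat (Var 1) (Var 1)] (Var 1)"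

lemma pow2_ex: "eval pow2_ex [un n] = un (2 ^ n)"
proof -
  have "eval pow2_ex [un n] = eval (Var 1) ([un n] @ (\<lambda>a. [un a]) (((\<lambda>a. a + a) ^^ length (eval (Var 0) [un n])) 1))"
    unfolding pow2_ex_def by (rule eval_Iter) (simp_all add: replicate_add)
  moreover have "((\<lambda>a. a + a) ^^ n) (1 :: nat) = 2 ^ n" for n by (induction n) simp_all
  ultimately show ?thesis by simp
qed

text \<open>Counts up to the first argument while updating quotient and remainder, held in
  \<open>Var 2\<close> and \<open>Var 3\<close>; \<open>i\<close> selects one of them.\<close>

definition divmod_ex :: "nat \<Rightarrow> ex" where
  "divmod_ex i = (let s = Cat (Sym 0) (Var 3); lt = Cond 0 (Drop s (Var 1)) in
     Iter (Var 0) [Nl, Nl] [lt (Var 2) (Cat (Sym 0) (Var 2)), lt s Nl] (Var i))"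

lemma divmod_ex:
  assumes "0 < K"
  shows "eval (divmod_ex 2) [un c, un K] = un (c div K)" "eval (divmod_ex 3) [un c, un K] = un (c mod K)"
proof -
  define f where "f = (\<lambda>(q :: nat, r). if Suc r < K then (q, Suc r) else (Suc q, 0))"
  have "eval (divmod_ex i) [un c, un K] = eval (Var i) ([un c, un K] @ (\<lambda>(q, r). [un q, un r]) ((f ^^ length (eval (Var 0) [un c, un K])) (0, 0)))" for i
    unfolding divmod_ex_def Let_def by (rule eval_Iter) (auto simp: f_def)
  moreover have "(f ^^ n) (0, 0) = (n div K, n mod K)" for n
  proof (induction n)
    case (Suc n)
    have "n mod K < K" using assms by simp
    then have "f (n div K, n mod K) = (Suc n div K, Suc n mod K)"
      by (auto simp: f_def div_Suc mod_Suc)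
    then show ?case using Suc by simp
  qed (use assms in simp)
  ultimately show "eval (divmod_ex 2) [un c, un K] = un (c div K)" "eval (divmod_ex 3) [un c, un K] = un (c mod K)"
    by simp_all
qed

text \<open>A scanner for marked bits: at the start of a pair, 0 closes a number and 1 announces one
  more bit. The input length suffices as number of rounds, because the state becomes
  stationary.\<close>

definition skip_ex :: ex where
  "skip_ex = Iter (Var 0) [Var 0, Var 1]
     [Cond 0 (Var 3) (Cond 0 (Var 2) (Drop (Sym 0) (Var 2)) (Drop (kon [0, 0]) (Var 2))) (Var 2),
      Cond 0 (Var 3) (Cond 0 (Var 2) (Drop (Sym 0) (Var 3)) (Var 3)) (Var 3)] (Var 2)"

lemma mark_simps [simp]: "mark [] = [False]" "mark (b # bs) = True # b # mark bs"
  by (simp_all add: mark_def)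

lemma skip_ex:
  "eval skip_ex [map bit (concat (map mark bss)), un k] = map bit (concat (map mark (drop k bss)))"
proof -
  define f where "f = (\<lambda>(r :: nat list, k :: nat). if 0 < k then if r \<noteq> [] \<and> hd r = 0 then (drop 1 r, k - 1) else (drop 2 r, k) else (r, k))"
  let ?s = "\<lambda>bss. map bit (concat (map mark bss))"
  have "eval skip_ex [?s bss, un k] = eval (Var 2) ([?s bss, un k] @ (\<lambda>(r, k). [r, un k])
      ((f ^^ length (eval (Var 0) [?s bss, un k])) (?s bss, k)))"
    unfolding skip_ex_def by (rule eval_Iter) (auto simp: f_def numeral_2_eq_2)
  moreover have "fst ((f ^^ n) (?s bss, k)) = ?s (drop k bss)" if "length (concat (map mark bss)) \<le> n" for n
    using that
  proof (induction n arbitrary: bss k)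
    case 0
    then show ?case by (cases bss) (auto simp: mark_def)
  next
    case (Suc n)
    have rec: "(f ^^ Suc n) s = (f ^^ n) (f s)" for s by (simp add: funpow_Suc_right del: funpow.simps)
    show ?case
    proof (cases "k = 0")
      case True
      then have "f (?s bss, k) = (?s bss, k)" by (simp add: f_def)
      from funpow_fixed[of f, OF this] show ?thesis using True by (simp del: funpow.simps)
    next
      case k: False
      show ?thesis
      proof (cases bss)
        case Nil
        then have "f (?s bss, k) = (?s bss, k)" by (simp add: f_def)
        from funpow_fixed[of f, OF this] show ?thesis using Nil by (simp del: funpow.simps)
      next
        case (Cons bs bss')
        show ?thesis
        proof (cases bs)
          case Nil
          have "f (?s bss, k) = (?s bss', k - 1)" using k by (simp add: f_def Cons Nil bit_def)
          moreover have "length (concat (map mark bss')) \<le> n" using Suc.prems by (simp add: Cons Nil)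
          ultimately show ?thesis using Suc.IH[of bss' "k - 1"] k unfolding rec
            by (simp add: Cons drop_Cons' del: funpow.simps)
        next
          case bs: (Cons b bs')
          have "f (?s bss, k) = (?s (bs' # bss'), k)" using k by (simp add: f_def Cons bs bit_def)
          moreover have "length (concat (map mark (bs' # bss'))) \<le> n" using Suc.prems by (simp add: Cons bs)
          ultimately show ?thesis using Suc.IH[of "bs' # bss'" k] k unfolding rec
            by (simp add: Cons drop_Cons' del: funpow.simps)
        qed
      qed
    qed
  qed
  ultimately show ?thesis by (simp add: case_prod_beta)
qed

text \<open>The positive or the negative part of the first number of the second argument.\<close>

definition num_ex :: "bool \<Rightarrow> ex" where
  "num_ex s = (let c = Cond 1 (Var 2) in
     Iter (Var 0) [Drop (kon [0, 0]) (Var 1), Sym 0, Nl]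
       [c (Drop (kon [0, 0]) (Var 2)) (Var 2), c (Cat (Var 3) (Var 3)) (Var 3),
        c (Cond 1 (Drop (Sym 0) (Var 2)) (Cat (Var 4) (Var 3)) (Var 4)) (Var 4)]
       (if s then Cond 1 (Drop (Sym 0) (Var 1)) Nl (Var 4) else Cond 1 (Drop (Sym 0) (Var 1)) (Var 4) Nl))"

text \<open>The state holds the unread bits, the current power of two and the value so far. Reading
  past the end of the input counts as 0.\<close>

lemma num_ex:
  assumes "r = [] \<and> v = 0 \<or> (\<exists>y. r = map bit (mark (sg # bs)) @ y \<and> v = val bs \<and> length bs \<le> length x)"
  shows "eval (num_ex s) [x, r] = un (if (r \<noteq> [] \<and> sg) = s then 0 else v)"
proof -
  define f where "f = (\<lambda>(r :: nat list, w :: nat, v). if r \<noteq> [] \<and> hd r = 1 then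
    (drop 2 r, w + w, if drop 1 r \<noteq> [] \<and> hd (drop 1 r) = 1 then v + w else v) else (r, w, v))"
  define st where "st = (\<lambda>(r :: nat list, w, v). [r, un w, un v])"
  let ?e = "if s then Cond 1 (Drop (Sym 0) (Var 1)) Nl (Var 4) else Cond 1 (Drop (Sym 0) (Var 1)) (Var 4) Nl"
  have main: "eval (num_ex s) [x, r] = eval ?e ([x, r] @ st ((f ^^ length (eval (Var 0) [x, r])) (drop 2 r, 1, 0)))"
    unfolding num_ex_def Let_def by (rule eval_Iter) (auto simp: f_def st_def replicate_add numeral_2_eq_2)
  have run: "snd (snd ((f ^^ n) (map bit (mark bs) @ y, w, v))) = v + w * val bs" if "length bs \<le> n" for bs n y w v
    using that
  proof (induction bs arbitrary: n w v)
    case Nil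
    have "f (map bit (mark []) @ y, w, v) = (map bit (mark []) @ y, w, v)" by (simp add: f_def bit_def)
    from funpow_fixed[of f, OF this] show ?case by simp
  next
    case (Cons b bs)
    then obtain m where m: "n = Suc m" "length bs \<le> m" by (cases n) auto
    have rec: "(f ^^ Suc m) s = (f ^^ m) (f s)" for s by (simp add: funpow_Suc_right del: funpow.simps)
    have "f (map bit (mark (b # bs)) @ y, w, v) = (map bit (mark bs) @ y, w + w, if b then v + w else v)"
      by (simp add: f_def bit_def)
    then show ?case unfolding m(1) rec using Cons.IH[OF m(2)] by (simp add: algebra_simps)
  qed
  obtain r' w' v' where fin: "(f ^^ length x) (drop 2 r, 1, 0) = (r', w', v')" by (metis prod_cases3)
  have v: "v' = v \<and> (r \<noteq> [] \<longrightarrow> drop 1 r \<noteq> [] \<and> hd (drop 1 r) = bit sg)"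
  proof (cases "r = []")
    case True
    have "f ([], 1, 0) = ([], 1, 0)" by (simp add: f_def)
    from funpow_fixed[of f, OF this] show ?thesis using True assms fin by simp
  next
    case False
    then obtain y where y: "r = map bit (mark (sg # bs)) @ y" "v = val bs" "length bs \<le> length x" using assms by blast
    then have "drop 2 r = map bit (mark bs) @ y" by simp
    then show ?thesis using run[OF y(3), of y 1 0] fin y by simp
  qed
  have "eval (Var 0) [x, r] = x" by simp
  then have "[x, r] @ st ((f ^^ length (eval (Var 0) [x, r])) (drop 2 r, 1, 0)) = [x, r, r', un w', un v]"
    using v by (simp only: fin st_def prod.case append_Cons append_Nil)
  then have "eval (num_ex s) [x, r] = eval ?e [x, r, r', un w', un v]" by (simp only: main)
  also have "\<dots> = un (if (r \<noteq> [] \<and> sg) = s then 0 else v)"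
    using conjunct2[OF v] by (cases "r = []"; cases sg; cases s) (simp_all add: bit_def)
  finally show ?thesis .
qed

section \<open>Access to the integers of the input\<close>

definition lookup :: "int list \<Rightarrow> nat \<Rightarrow> int" where
  "lookup zs m = (if m < length zs then zs ! m else 0)"

definition entry_ex :: "bool \<Rightarrow> ex" where
  "entry_ex s = Call (num_ex s) [Var 0, Call skip_ex [Var 0, Var 1]]"

text \<open>Unary strings are never negative, so integers are handled as differences of their
  positive and negative parts.\<close>

definition part :: "bool \<Rightarrow> int \<Rightarrow> nat" where
  "part s z = nat (if s then z else - z)"

lemma part_diff: "int (part True z) - int (part False z) = z"
  by (simp add: part_def)

lemma enc_int_mark: "enc_int z = mark ((z < 0) # digits (nat \<bar>z\<bar>))"
  by (simp add: enc_int_def mark_def)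

lemma length_mark: "length (mark bs) = 2 * length bs + 1"
  by (induction bs) auto

lemma entry_ex:
  "eval (entry_ex s) [map bit (concat (map enc_int zs)), un m] = un (part s (lookup zs m))"
proof -
  let ?b = "\<lambda>z. (z < 0) # digits (nat \<bar>z\<bar>)"
  let ?x = "map bit (concat (map enc_int zs))"
  define r where "r = map bit (concat (map enc_int (drop m zs)))"
  have em: "map enc_int zs = map mark (map ?b zs)" for zs by (simp add: enc_int_mark)
  have "eval skip_ex [?x, un m] = r"
    unfolding r_def em skip_ex drop_map by simp
  then have e: "eval (entry_ex s) [?x, un m] = eval (num_ex s) [?x, r]"
    by (simp add: entry_ex_def)
  show ?thesis
  proof (cases "m < length zs")
    case False
    then have "r = []" by (simp add: r_def)
    with False show ?thesis unfolding e by (subst num_ex[of _ 0 False "[]"]) (auto simp: lookup_def part_def)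
  next
    case True
    define z where "z = zs ! m"
    have r: "r = map bit (mark (?b z)) @ map bit (concat (map enc_int (drop (Suc m) zs)))"
      using True by (simp add: r_def z_def enc_int_mark flip: Cons_nth_drop_Suc)
    have "zs = take m zs @ z # drop (Suc m) zs" using True unfolding z_def by (rule id_take_nth_drop)
    from arg_cong[OF this, of "\<lambda>zs. length (concat (map enc_int zs))"]
    have "length (enc_int z) \<le> length (concat (map enc_int zs))"
      unfolding map_append list.map concat_append concat.simps length_append by linarith
    then have l: "length (digits (nat \<bar>z\<bar>)) \<le> length ?x" by (simp add: enc_int_mark length_mark)
    have "eval (num_ex s) [?x, r] = un (if (r \<noteq> [] \<and> z < 0) = s then 0 else nat \<bar>z\<bar>)"
      by (rule num_ex[of _ _ _ "digits (nat \<bar>z\<bar>)"], intro disjI2 exI conjI, rule r, rule val_digits[symmetric], rule l)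
    moreover have "r \<noteq> []" unfolding r by simp
    moreover have "(if (z < 0) = s then 0 else nat \<bar>z\<bar>) = part s z" by (cases s) (auto simp: part_def)
    moreover have "lookup zs m = z" using True by (simp add: lookup_def z_def)
    ultimately show ?thesis unfolding e by simp
  qed
qed

lemma wf_decider [simp]: "wf_ex pow2_ex" "wf_ex (divmod_ex i)" "wf_ex skip_ex" "wf_ex (num_ex s)" "wf_ex (entry_ex s)"
  by (simp_all add: pow2_ex_def divmod_ex_def skip_ex_def num_ex_def entry_ex_def Let_def)

section \<open>Words coded as numbers, and their products\<close>

primrec dec :: "nat \<Rightarrow> nat \<Rightarrow> nat \<Rightarrow> nat list" where
  "dec K 0 c = []"
| "dec K (Suc l) c = (c mod K) # dec K l (c div K)"

lemma length_dec [simp]: "length (dec K l c) = l"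
  by (induction l arbitrary: c) simp_all

lemma dec_surj: "set ds \<subseteq> {..<K} \<Longrightarrow> \<exists>c<K ^ length ds. dec K (length ds) c = ds"
proof (induction ds)
  case (Cons d ds)
  then obtain c where c: "c < K ^ length ds" "dec K (length ds) c = ds" by auto
  have d: "d < K" using Cons.prems by simp
  have "d + K * c < K * Suc c" using d by simp
  also have "\<dots> \<le> K * K ^ length ds" using c(1) by (intro mult_le_mono2) simp
  finally have "d + K * c < K ^ length (d # ds)" by simp
  moreover have "dec K (length (d # ds)) (d + K * c) = d # ds" using d c(2) by simp
  ultimately show ?case by blast
qed simp

definition mat_at :: "int list \<Rightarrow> nat \<Rightarrow> mat2" where
  "mat_at zs i = mk (lookup zs (4 * i)) (lookup zs (4 * i + 1)) (lookup zs (4 * i + 2)) (lookup zs (4 * i + 3))"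

definition entries :: "mat2 \<Rightarrow> int list" where
  "entries A = [A $ 1 $ 1, A $ 1 $ 2, A $ 2 $ 1, A $ 2 $ 2]"

text \<open>Indices past the end of the list yield the zero matrix, which later disqualifies words
  with invalid factors.\<close>

lemma mat_at_entries: "mat_at (concat (map entries As)) i = (if i < length As then As ! i else 0)"
proof (induction As arbitrary: i)
  case Nil
  show ?case by (simp add: mat_at_def lookup_def mat2_eq_iff)
next
  case (Cons A As)
  have Suc: "lookup (a # zs) (Suc m) = lookup zs m" for a zs m by (simp add: lookup_def)
  show ?case
  proof (cases i)
    case 0
    then show ?thesis by (simp add: mat_at_def lookup_def entries_def mat2_eq_iff numeral_3_eq_3 numeral_2_eq_2)
  next
    case i: (Suc j)
    have n: "4 * Suc j = Suc (Suc (Suc (Suc (4 * j))))" "m + 3 = Suc (Suc (Suc m))" for m by simp_all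
    have "mat_at (concat (map entries (A # As))) (Suc j) = mat_at (concat (map entries As)) j"
      unfolding mat_at_def n by (simp add: entries_def Suc)
    then show ?thesis using Cons.IH[of j] by (simp add: i)
  qed
qed

lemma enc_entries: "concat (map enc_mat As) = concat (map enc_int (concat (map entries As)))"
  by (induction As) (simp_all add: enc_mat_def entries_def)

text \<open>
  Arguments: the input, \<open>un K\<close>, \<open>un c\<close>, \<open>un l\<close>, \<open>un k\<close> (the column). The five state variables
  are the code of the remaining factors and the current column, each of whose entries is a
  difference of two unary numbers.
\<close>

definition coef_ex :: "bool \<Rightarrow> nat \<Rightarrow> ex" where
  "coef_ex s i = (let d = Cat (Sym 0) (Call (divmod_ex 3) [Var 5, Var 1]) in
     Call (entry_ex s) [Var 0, Cat (Cat (Cat d d) (Cat d d)) (kon (un i))])"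

text \<open>The minuend of a row times the column, both given as differences; with the registers of
  each pair exchanged it gives the subtrahend.\<close>

definition row_ex :: "nat \<Rightarrow> nat \<Rightarrow> nat \<Rightarrow> nat \<Rightarrow> nat \<Rightarrow> ex" where
  "row_ex i a b a' b' = Cat (Loop (coef_ex True i) (Var a)) (Cat (Loop (coef_ex False i) (Var b))
     (Cat (Loop (coef_ex True (Suc i)) (Var a')) (Loop (coef_ex False (Suc i)) (Var b'))))"

definition target_ex :: "bool \<Rightarrow> nat \<Rightarrow> ex" where
  "target_ex s i = Call (entry_ex s) [Var 0, Cat (Var 4) (kon (un i))]"

text \<open>The product is evaluated one column at a time from the last factor to the first, so that
  only a vector is kept, starting with a standard basis vector. The comparison with the target adds
  negative parts crosswise instead of subtracting.\<close>

definition col_ex :: ex where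
  "col_ex = (let eq = (\<lambda>u v e. Cond 0 (Drop u v) Nl (Cond 0 (Drop v u) Nl e)) in
     Iter (Var 3) [Var 2, Drop (Var 4) (Sym 0), Nl, Var 4, Nl]
       [Call (divmod_ex 2) [Var 5, Var 1], row_ex 0 6 7 8 9, row_ex 0 7 6 9 8, row_ex 2 6 7 8 9, row_ex 2 7 6 9 8]
       (eq (Cat (Var 6) (target_ex False 0)) (Cat (Var 7) (target_ex True 0))
         (eq (Cat (Var 8) (target_ex False 2)) (Cat (Var 9) (target_ex True 2)) (Sym 1))))"

definition row_val :: "int \<Rightarrow> int \<Rightarrow> nat \<Rightarrow> nat \<Rightarrow> nat \<Rightarrow> nat \<Rightarrow> nat" where
  "row_val z z' a b a' b' = part True z * a + (part False z * b + (part True z' * a' + part False z' * b'))"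

lemma row_val_diff:
  "int (row_val z z' a b a' b') - int (row_val z z' b a b' a') = z * (int a - int b) + z' * (int a' - int b')"
proof -
  have "z = int (part True z) - int (part False z)" "z' = int (part True z') - int (part False z')"
    by (simp_all add: part_diff)
  then show ?thesis unfolding row_val_def by (simp only: of_nat_add of_nat_mult) algebra
qed

lemma loop_var:
  assumes "a < length env" "env ! a = un n"
  shows "eval (Loop d (Var a)) env = un (length (eval d env) * n)"
proof -
  have "eval (Var a) (env @ [un j]) = un n" for j using assms by (simp add: nth_append)
  then show ?thesis unfolding eval.simps(7) by simp
qed

lemma coef_ex:
  assumes "0 < K"
  shows "eval (coef_ex s i) (map bit (concat (map enc_int zs)) # un K # u # v # w # un c # env) =
    un (part s (lookup zs (4 * Suc (c mod K) + i)))"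
proof -
  have r: "un (4 * Suc m + i) = (([0] @ un m) @ ([0] @ un m)) @ (([0] @ un m) @ ([0] @ un m)) @ un i" for m
  proof -
    have e: "4 * Suc m + i = ((Suc 0 + m) + (Suc 0 + m)) + (((Suc 0 + m) + (Suc 0 + m)) + i)" by simp
    show ?thesis unfolding e replicate_add by simp
  qed
  have "eval (coef_ex s i) (map bit (concat (map enc_int zs)) # un K # u # v # w # un c # env) =
      eval (entry_ex s) [map bit (concat (map enc_int zs)), un (4 * Suc (c mod K) + i)]"
    unfolding r using divmod_ex(2)[OF assms, of c] by (simp add: coef_ex_def Let_def)
  then show ?thesis by (simp only: entry_ex)
qed

lemma row_ex:
  fixes p n p' n' c i :: nat and zs :: "int list" and u v w :: "nat list"
  assumes "0 < K"
  defines "env \<equiv> [map bit (concat (map enc_int zs)), un K, u, v, w, un c, un p, un n, un p', un n']"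
  defines "z \<equiv> lookup zs (4 * Suc (c mod K) + i)" and "z' \<equiv> lookup zs (4 * Suc (c mod K) + Suc i)"
  shows "eval (row_ex i 6 7 8 9) env = un (row_val z z' p n p' n')"
    "eval (row_ex i 7 6 9 8) env = un (row_val z z' n p n' p')"
proof -
  have nth: "env ! 6 = un p" "env ! 7 = un n" "env ! 8 = un p'" "env ! 9 = un n'" by (simp_all add: env_def)
  have len: "6 < length env" "7 < length env" "8 < length env" "9 < length env" by (simp_all add: env_def)
  have c: "eval (coef_ex s j) env = un (part s (lookup zs (4 * Suc (c mod K) + j)))" for s j
    unfolding env_def by (rule coef_ex[OF assms(1)])
  have l: "eval (Loop (coef_ex s j) (Var a)) env = un (part s (lookup zs (4 * Suc (c mod K) + j)) * m)"
    if "a < length env" "env ! a = un m" for s j a m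
    unfolding loop_var[OF that] c length_replicate ..
  show "eval (row_ex i 6 7 8 9) env = un (row_val z z' p n p' n')"
    "eval (row_ex i 7 6 9 8) env = un (row_val z z' n p n' p')"
    unfolding row_ex_def eval.simps(4) row_val_def z_def z'_def replicate_add
    by (simp_all only: l[OF len(1) nth(1)] l[OF len(2) nth(2)] l[OF len(3) nth(3)] l[OF len(4) nth(4)])
qed

definition col_step :: "nat \<Rightarrow> int list \<Rightarrow> nat \<times> nat \<times> nat \<times> nat \<times> nat \<Rightarrow> nat \<times> nat \<times> nat \<times> nat \<times> nat" where
  "col_step K zs = (\<lambda>(c, p, n, p', n'). let z = (\<lambda>i. lookup zs (4 * Suc (c mod K) + i)) in
     (c div K, row_val (z 0) (z 1) p n p' n', row_val (z 0) (z 1) n p n' p',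
      row_val (z 2) (z 3) p n p' n', row_val (z 2) (z 3) n p n' p'))"

text \<open>Each step multiplies from the left, so the lowest digit is the last factor; hence the
  reversal.\<close>

lemma col_step_run:
  assumes "int p - int n = P $ 1 $ k" "int p' - int n' = P $ 2 $ k"
    "(col_step K zs ^^ l) (c, p, n, p', n') = (d, q, m, q', m')"
  shows "int q - int m = (matprod (map (\<lambda>i. mat_at zs (Suc i)) (rev (dec K l c))) ** P) $ 1 $ k \<and>
    int q' - int m' = (matprod (map (\<lambda>i. mat_at zs (Suc i)) (rev (dec K l c))) ** P) $ 2 $ k"
  using assms
proof (induction l arbitrary: c p n p' n' P)
  case 0
  then show ?case by simp
next
  case (Suc l)
  define A where "A = mat_at zs (Suc (c mod K))"
  obtain a b a' b' where s: "col_step K zs (c, p, n, p', n') = (c div K, a, b, a', b')"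
    by (simp add: col_step_def Let_def)
  have "int a - int b = A $ 1 $ 1 * (int p - int n) + A $ 1 $ 2 * (int p' - int n') \<and>
      int a' - int b' = A $ 2 $ 1 * (int p - int n) + A $ 2 $ 2 * (int p' - int n')"
    using s row_val_diff by (auto simp: col_step_def Let_def A_def mat_at_def)
  then have e: "int a - int b = (A ** P) $ 1 $ k" "int a' - int b' = (A ** P) $ 2 $ k"
    using Suc.prems(1,2) by simp_all
  have r: "(col_step K zs ^^ l) (c div K, a, b, a', b') = (d, q, m, q', m')"
    using Suc.prems(3) s by (simp add: funpow_Suc_right del: funpow.simps)
  have "matprod (map (\<lambda>i. mat_at zs (Suc i)) (rev (dec K (Suc l) c))) ** P =
      matprod (map (\<lambda>i. mat_at zs (Suc i)) (rev (dec K l (c div K)))) ** (A ** P)"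
    by (simp add: matprod_append A_def matrix_mul_assoc)
  then show ?case using Suc.IH[OF e r] by simp
qed

lemma col_ex:
  fixes k :: 2 and K c l :: nat and zs :: "int list"
  assumes "0 < K" "kn = (if k = 1 then 0 else Suc 0)"
  defines "Q \<equiv> matprod (map (\<lambda>i. mat_at zs (Suc i)) (rev (dec K l c)))" and "M \<equiv> mat_at zs 0"
  shows "eval col_ex [map bit (concat (map enc_int zs)), un K, un c, un l, un kn] =
    (if Q $ 1 $ k = M $ 1 $ k \<and> Q $ 2 $ k = M $ 2 $ k then [1] else [])"
proof -
  let ?x = "map bit (concat (map enc_int zs))"
  let ?env = "[?x, un K, un c, un l, un kn]"
  define st where "st = (\<lambda>(c, p, n, p', n'). [un c, un p, un n, un p', un n'])"
  define out where "out = (let eq = (\<lambda>u v e. Cond 0 (Drop u v) Nl (Cond 0 (Drop v u) Nl e)) in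
     eq (Cat (Var 6) (target_ex False 0)) (Cat (Var 7) (target_ex True 0))
         (eq (Cat (Var 8) (target_ex False 2)) (Cat (Var 9) (target_ex True 2)) (Sym 1)))"
  have main: "eval col_ex ?env = eval out (?env @ st ((col_step K zs ^^ length (eval (Var 3) ?env)) (c, 1 - kn, 0, kn, 0)))"
    unfolding col_ex_def Let_def out_def
  proof (rule eval_Iter)
    show "map (\<lambda>s. eval s ?env) [Var 2, Drop (Var 4) (Sym 0), Nl, Var 4, Nl] = st (c, 1 - kn, 0, kn, 0)"
      using assms(2) by (simp add: st_def)
    fix a :: "nat \<times> nat \<times> nat \<times> nat \<times> nat"
    obtain b p n p' n' where a: "a = (b, p, n, p', n')" by (metis prod_cases5)
    have e: "?env @ st a = [?x, un K, un c, un l, un kn, un b, un p, un n, un p', un n']" by (simp add: st_def a)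
    have d: "eval (Call (divmod_ex 2) [Var 5, Var 1]) [?x, un K, un c, un l, un kn, un b, un p, un n, un p', un n'] = un (b div K)"
      using divmod_ex(1)[OF assms(1), of b] by simp
    show "map (\<lambda>s. eval s (?env @ st a)) [Call (divmod_ex 2) [Var 5, Var 1], row_ex 0 6 7 8 9, row_ex 0 7 6 9 8,
        row_ex 2 6 7 8 9, row_ex 2 7 6 9 8] = st (col_step K zs a)"
      unfolding e list.map d row_ex[OF assms(1)]
      unfolding a st_def col_step_def Let_def prod.case by (simp add: numeral_3_eq_3 numeral_2_eq_2)
  qed
  obtain d q m q' m' where run: "(col_step K zs ^^ l) (c, 1 - kn, 0, kn, 0) = (d, q, m, q', m')" by (metis prod_cases5)
  have k: "k = 1 \<or> k = 2" by (rule exhaust_2)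
  have "int (1 - kn) - int 0 = (mat 1 :: mat2) $ 1 $ k \<and> int kn - int 0 = (mat 1 :: mat2) $ 2 $ k"
    using k assms(2) by auto
  from col_step_run[OF conjunct1[OF this] conjunct2[OF this] run]
  have Q: "int q - int m = Q $ 1 $ k" "int q' - int m' = Q $ 2 $ k" by (simp_all add: Q_def)
  let ?e = "[?x, un K, un c, un l, un kn, un d, un q, un m, un q', un m']"
  have t: "eval (target_ex s i) ?e = un (part s (lookup zs (kn + i)))" for s i
    using entry_ex[of s zs "kn + i"] by (simp add: target_ex_def replicate_add)
  have M: "lookup zs (kn + 0) = M $ 1 $ k" "lookup zs (kn + 2) = M $ 2 $ k"
    using k assms(2) by (auto simp: M_def mat_at_def numeral_3_eq_3 numeral_2_eq_2)
  have v: "eval (Var 6) ?e = un q" "eval (Var 7) ?e = un m" "eval (Var 8) ?e = un q'" "eval (Var 9) ?e = un m'" by simp_all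
  have eq: "eval (Cond 0 (Drop u v) Nl (Cond 0 (Drop v u) Nl e)) env = (if a = b then eval e env else [])"
    if "eval u env = un a" "eval v env = un b" for u v e env a b
    using that by (cases a b rule: linorder_cases) auto
  have cat: "eval (Cat e e') env = un (a + b)" if "eval e env = un a" "eval e' env = un b" for e e' env a b
    using that by (simp add: replicate_add)
  have l: "length (eval (Var 3) ?env) = l" by simp
  have "eval col_ex ?env = eval out ?e"
    unfolding main l run by (simp add: st_def)
  also have "\<dots> = (if q + part False (M $ 1 $ k) = m + part True (M $ 1 $ k) then
      if q' + part False (M $ 2 $ k) = m' + part True (M $ 2 $ k) then [1] else [] else [])"
    unfolding out_def Let_def
    by (subst eq[OF cat[OF v(1) t] cat[OF v(2) t]], subst eq[OF cat[OF v(3) t] cat[OF v(4) t]]) (simp only: M eval.simps(3))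
  also have "\<dots> = (if Q $ 1 $ k = M $ 1 $ k \<and> Q $ 2 $ k = M $ 2 $ k then [1] else [])"
  proof -
    have "a + part False z = b + part True z \<longleftrightarrow> int a - int b = z" for a b z
      using part_diff[of z] by linarith
    then show ?thesis unfolding Q[symmetric] by simp
  qed
  finally show ?thesis .
qed

lemma wf_col_ex [simp]: "wf_ex col_ex"
  by (simp add: col_ex_def row_ex_def coef_ex_def target_ex_def Let_def)

definition check_ex :: ex where
  "check_ex = (let a = (\<lambda>k. Call col_ex [Var 0, Var 1, Var 2, Var 3, k]) in Cond 1 (a Nl) (a (Sym 0)) Nl)"

lemma check_ex:
  assumes "0 < K"
  shows "eval check_ex [map bit (concat (map enc_int zs)), un K, un c, un l] =
    (if matprod (map (\<lambda>i. mat_at zs (Suc i)) (rev (dec K l c))) = mat_at zs 0 then [1] else [])"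
proof -
  let ?env = "[map bit (concat (map enc_int zs)), un K, un c, un l]"
  have "eval (Call col_ex [Var 0, Var 1, Var 2, Var 3, Nl]) ?env = eval col_ex [map bit (concat (map enc_int zs)), un K, un c, un l, un 0]"
    "eval (Call col_ex [Var 0, Var 1, Var 2, Var 3, Sym 0]) ?env = eval col_ex [map bit (concat (map enc_int zs)), un K, un c, un l, un (Suc 0)]"
    by simp_all
  then show ?thesis
    unfolding check_ex_def Let_def eval.simps(2,6) using col_ex[OF assms, of 0 1 zs c l] col_ex[OF assms, of "Suc 0" 2 zs c l]
    by (auto simp: mat2_eq_iff)
qed

text \<open>All verdicts are concatenated; a failure contributes nothing, so the head of the result
  tells whether some word succeeds.\<close>

definition search_ex :: ex where
  "search_ex = Cond 1 (Loop (Cat (Var 2) (Var 2)) (Loop (Var 3) (Call check_ex [Var 0, Var 1, Var 5, Cat (Var 2) (Var 4)])))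
     (Sym 1) (Sym 0)"

lemma search_ex:
  assumes "0 < K"
  shows "eval search_ex [map bit (concat (map enc_int zs)), un K, un B, un C] =
    (if \<exists>j<2 * B. \<exists>c<C. matprod (map (\<lambda>i. mat_at zs (Suc i)) (rev (dec K (B + j) c))) = mat_at zs 0 then [1] else [0])"
proof -
  let ?x = "map bit (concat (map enc_int zs))"
  define good where "good j c \<longleftrightarrow> matprod (map (\<lambda>i. mat_at zs (Suc i)) (rev (dec K (B + j) c))) = mat_at zs 0" for j c
  have "eval (Call check_ex [Var 0, Var 1, Var 5, Cat (Var 2) (Var 4)]) [?x, un K, un B, un C, un j, un c] =
      (if good j c then [1] else [])" for j c
    using check_ex[OF assms, of zs c "B + j"] by (simp add: replicate_add good_def)
  then have L: "eval (Loop (Cat (Var 2) (Var 2)) (Loop (Var 3) (Call check_ex [Var 0, Var 1, Var 5, Cat (Var 2) (Var 4)])))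
      [?x, un K, un B, un C] = concat (map (\<lambda>j. concat (map (\<lambda>c. if good j c then [1] else []) [0..<C])) [0..<2 * B])"
    unfolding eval.simps(7) by (simp add: mult_2)
  define L where "L = concat (map (\<lambda>j. concat (map (\<lambda>c. if good j c then [1 :: nat] else []) [0..<C])) [0..<2 * B])"
  have sub: "set L \<subseteq> {1}" by (auto simp: L_def split: if_splits)
  have mem: "a \<in> set (concat (map F [0..<n])) \<longleftrightarrow> (\<exists>j<n. a \<in> set (F j))" for a :: nat and F n
    by auto
  have one: "1 \<in> set (if g then [1 :: nat] else []) \<longleftrightarrow> g" for g by simp
  have "L \<noteq> [] \<longleftrightarrow> 1 \<in> set L" using sub by (cases L) auto
  also have "\<dots> \<longleftrightarrow> (\<exists>j<2 * B. \<exists>c<C. good j c)" unfolding L_def mem one ..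
  finally have "L \<noteq> [] \<longleftrightarrow> (\<exists>j<2 * B. \<exists>c<C. good j c)" .
  then have "L \<noteq> [] \<and> hd L = 1 \<longleftrightarrow> (\<exists>j<2 * B. \<exists>c<C. good j c)" using sub hd_in_set[of L] by blast
  then show ?thesis
    unfolding search_ex_def eval.simps(6) L L_def[symmetric] good_def[symmetric] by simp
qed

text \<open>The input length \<open>n\<close> bounds the number of generators, \<open>B\<close> is
  the bound of \<open>tball_card_pow\<close>, and \<open>2 ^ (n * (B + (B + B)))\<close> bounds the
  number of words of each length below \<open>3 * B\<close>, because
  \<open>n < 2 ^ n\<close>.\<close>

definition decide_ex :: ex where
  "decide_ex = (let n = zeros_ex 1 (Var 0); p = (\<lambda>e. Call pow2_ex [e]); B = p (p (p (Cat n (kon (un 9))))) in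
     Call search_ex [Var 0, n, B, p (Loop n (Cat B (Cat B B)))])"

lemma decide_ex:
  assumes "n = length x" "B = 2 ^ (2 ^ (2 ^ (n + 9)))"
  shows "eval decide_ex [map bit x] = eval search_ex [map bit x, un n, un B, un (2 ^ (n * (B + (B + B))))]"
proof -
  define ne where "ne = zeros_ex 1 (Var 0)"
  define be where "be = Call pow2_ex [Call pow2_ex [Call pow2_ex [Cat ne (kon (un 9))]]]"
  have ne: "eval ne (map bit x # env) = un n" for env by (simp add: ne_def assms(1) bit_def)
  have nk: "un n @ un 9 = un (n + 9)" by (simp only: replicate_add)
  have be: "eval be (map bit x # env) = un B" for env
    by (simp only: be_def eval.simps list.map o_def ne kon nk pow2_ex assms(2))
  have "eval (Loop ne (Cat be (Cat be be))) [map bit x] = un (n * (B + (B + B)))"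
    by (simp only: eval.simps(7,4) ne be append_Cons append_Nil length_replicate concat_replicate_const replicate_add[symmetric])
  then have c: "eval (Call pow2_ex [Loop ne (Cat be (Cat be be))]) [map bit x] = un (2 ^ (n * (B + (B + B))))"
    by (simp only: eval.simps(9) list.map pow2_ex)
  have v: "eval (Var 0) [map bit x] = map bit x" by simp
  have d: "decide_ex = Call search_ex [Var 0, ne, be, Call pow2_ex [Loop ne (Cat be (Cat be be))]]"
    by (simp only: decide_ex_def Let_def ne_def be_def)
  have "eval (Call search_ex [e1, e2, e3, e4]) env = eval search_ex [eval e1 env, eval e2 env, eval e3 env, eval e4 env]"
    for e1 e2 e3 e4 env by simp
  from this[of "Var 0" ne be] show ?thesis unfolding d v ne be c by (simp only: v ne be c)
qed

lemma wf_decide_ex: "wf_ex decide_ex"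
  by (simp add: decide_ex_def search_ex_def check_ex_def Let_def)

section \<open>Correctness of the search bound\<close>

lemma val_less: "val bs < 2 ^ length bs"
  by (induction bs) auto

lemma entry_bound:
  assumes "z \<in> set zs"
  shows "\<bar>z\<bar> < 2 ^ length (concat (map enc_int zs))"
proof -
  have "length (enc_int z) \<le> length (concat (map enc_int zs))"
    using assms by (induction zs) auto
  then have l: "length (digits (nat \<bar>z\<bar>)) \<le> length (concat (map enc_int zs))" by (simp add: enc_int_mark length_mark)
  have "nat \<bar>z\<bar> < 2 ^ length (digits (nat \<bar>z\<bar>))" using val_less[of "digits (nat \<bar>z\<bar>)"] by (simp add: val_digits)
  also have "\<dots> \<le> 2 ^ length (concat (map enc_int zs))" using l by (intro power_increasing) simp_all
  finally have "int (nat \<bar>z\<bar>) < int (2 ^ length (concat (map enc_int zs)))" by (simp only: of_nat_less_iff)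
  then show ?thesis by simp
qed

text \<open>With \<open>n\<close> the length of the encoding, the four entries are below
  \<open>2 ^ n\<close> in absolute value, so the norm is at most \<open>4 * 2 ^ n\<close>;
  \<open>tlen_bounds\<close> gives the radius.\<close>

lemma input_tball:
  assumes "A \<in> set As" "A \<in> SL2Z"
  shows "A \<in> tball (16 * 2 ^ length (concat (map enc_mat As)) + 32)"
proof -
  define N :: int where "N = 2 ^ length (concat (map enc_mat As))"
  have "set (entries A) \<subseteq> set (concat (map entries As))" using assms(1) by auto
  then have "\<bar>z\<bar> < N" if "z \<in> set (entries A)" for z
    using entry_bound[of z "concat (map entries As)"] that unfolding N_def enc_entries by blast
  then have "\<bar>A $ 1 $ 1\<bar> < N" "\<bar>A $ 1 $ 2\<bar> < N" "\<bar>A $ 2 $ 1\<bar> < N" "\<bar>A $ 2 $ 2\<bar> < N"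
    by (simp_all add: entries_def)
  then have "int (mnorm A) \<le> 4 * N" by (simp add: mnorm_def)
  then have "int (mnorm A) \<le> int (4 * 2 ^ length (concat (map enc_mat As)))" by (simp add: N_def)
  then have "mnorm A \<le> 4 * 2 ^ length (concat (map enc_mat As))" by (simp only: of_nat_le_iff)
  then show ?thesis using tlen_bounds(3)[OF assms(2)] assms(2) by (simp add: tball_def)
qed

text \<open>The ball has at most \<open>(2 ^ (R + 27)) ^ 4\<close> elements, and
  \<open>(R + 27) * 4\<close> equals \<open>64 * 2 ^ n + 236\<close>. Its value 300 at
  \<open>n = 0\<close> calls for the 9 in the exponent.\<close>

lemma tball_card_pow: "2 ^ card (tball (16 * 2 ^ n + 32)) \<le> (2 :: nat) ^ (2 ^ (2 ^ (n + 9)))"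
proof -
  define R where "R = 16 * 2 ^ n + (32 :: nat)"
  obtain y :: nat where y: "y = 2 ^ n" by blast
  have "1 \<le> y" by (simp add: y)
  then have "(R + 27) * 4 \<le> 512 * y" unfolding R_def y[symmetric] by (simp add: algebra_simps)
  then have "(R + 27) * 4 \<le> 512 * 2 ^ n" by (simp only: y)
  then have R: "(R + 27) * 4 \<le> 2 ^ (n + 9)" by (simp add: power_add)
  have "(1 :: nat) \<le> 2 ^ (R + 25)" by simp
  moreover have "(2 :: nat) ^ (R + 27) = 4 * 2 ^ (R + 25)" by (simp add: power_add)
  ultimately have "2 * 2 ^ (R + 25) + 1 \<le> (2 :: nat) ^ (R + 27)" by linarith
  then have "(2 * 2 ^ (R + 25) + 1) ^ 4 \<le> ((2 :: nat) ^ (R + 27)) ^ 4" by (intro power_mono) simp_all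
  also have "\<dots> = 2 ^ ((R + 27) * 4)" by (simp only: power_mult)
  also have "\<dots> \<le> 2 ^ (2 ^ (n + 9))" using R by (intro power_increasing) simp_all
  finally have "card (tball R) \<le> 2 ^ (2 ^ (n + 9))" using tball_card[of R] by linarith
  then show ?thesis unfolding R_def by (intro power_increasing) simp_all
qed

lemma matprod_0: "0 \<in> set As \<Longrightarrow> matprod As = 0"
  by (induction As) (auto simp: mat2_eq_iff)

text \<open>Digits that are no index of a generator denote the zero matrix. A product containing it
  is zero and differs from \<open>M\<close>, so \<open>K\<close> may exceed the number of
  generators.\<close>

lemma factorization_search:
  assumes "M \<in> SL2Z" "length Gs \<le> K" "0 < B"
  shows "(\<exists>ws\<in>factorizations (set Gs) M. B \<le> length ws \<and> length ws < 3 * B) \<longleftrightarrow>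
    (\<exists>j<2 * B. \<exists>c<2 ^ (K * (B + (B + B))).
       matprod (map (\<lambda>i. if i < length Gs then Gs ! i else 0) (rev (dec K (B + j) c))) = M)"
    (is "?L \<longleftrightarrow> ?R")
proof
  let ?g = "\<lambda>i. if i < length Gs then Gs ! i else 0"
  assume ?L
  then obtain ws where ws: "set ws \<subseteq> set Gs" "matprod ws = M" "B \<le> length ws" "length ws < 3 * B"
    by (auto simp: factorizations_def)
  define pos where "pos A = (SOME i. i < length Gs \<and> Gs ! i = A)" for A
  have pos: "pos A < length Gs \<and> Gs ! pos A = A" if "A \<in> set Gs" for A
    unfolding pos_def using that[unfolded in_set_conv_nth] by (rule someI_ex)
  define ds where "ds = rev (map pos ws)"
  have "set ds \<subseteq> {..<K}"
  proof
    fix d assume "d \<in> set ds"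
    then obtain A where "A \<in> set ws" "d = pos A" by (auto simp: ds_def)
    then show "d \<in> {..<K}" using pos[of A] ws(1) assms(2) by fastforce
  qed
  then obtain c where c: "c < K ^ length ds" "dec K (length ds) c = ds" using dec_surj by blast
  have len: "length ds = length ws" by (simp add: ds_def)
  have m: "map ?g (rev ds) = ws" unfolding ds_def rev_rev_ident map_map o_def
    using pos ws(1) by (intro map_idI) auto
  define j where "j = length ws - B"
  have j: "length ds = B + j" "j < 2 * B" using ws(3,4) by (auto simp: j_def len)
  have "K \<le> 2 ^ K" using less_exp[of K] by linarith
  then have "K ^ length ds \<le> (2 ^ K) ^ length ds" by (intro power_mono) simp_all
  also have "\<dots> = 2 ^ (K * length ds)" by (simp only: power_mult)
  also have "\<dots> \<le> 2 ^ (K * (B + (B + B)))" using j by (intro power_increasing mult_le_mono2) simp_all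
  finally have b: "c < 2 ^ (K * (B + (B + B)))" using c(1) by linarith
  show ?R
    by (rule exI[of _ j], intro conjI, rule j(2), rule exI[of _ c], intro conjI, rule b)
      (simp only: c(2)[unfolded j(1)] m ws(2))
next
  let ?g = "\<lambda>i. if i < length Gs then Gs ! i else 0"
  assume ?R
  then obtain j c where j: "j < 2 * B" and m: "matprod (map ?g (rev (dec K (B + j) c))) = M" by blast
  define ws where "ws = map ?g (rev (dec K (B + j) c))"
  have len: "length ws = B + j" by (simp add: ws_def)
  have "0 \<notin> set ws"
  proof
    assume "0 \<in> set ws"
    then have "M = 0" using matprod_0 m by (simp add: ws_def)
    then show False using assms(1) by (simp add: SL2Z_iff)
  qed
  then have "set ws \<subseteq> set Gs" by (auto simp: ws_def split: if_splits)
  moreover have "ws \<noteq> []" using len assms(3) by auto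
  ultimately show ?L using m len j by (intro bexI[of _ ws]) (auto simp: factorizations_def ws_def)
qed

theorem decide_ex_correct:
  assumes "encodes x G M" "G \<subseteq> SL2Z" "M \<in> semigroup_gen G"
  shows "eval decide_ex [map bit x] = (if infinite (factorizations G M) then [1] else [0])"
proof -
  obtain Gs where Gs: "set Gs = G" and x: "x = concat (map enc_mat (M # Gs))" using assms(1) by (auto simp: encodes_def)
  have M: "M \<in> SL2Z" using assms(2,3) matprod_SL2Z by (auto simp: semigroup_gen_def)
  define n where "n = length x"
  define B :: nat where "B = 2 ^ (2 ^ (2 ^ (n + 9)))"
  define zs where "zs = concat (map entries (M # Gs))"
  have xz: "x = concat (map enc_int zs)" by (simp only: x zs_def enc_entries)
  have ne: "1 \<le> length (enc_mat A)" for A using enc_mat_nonempty[of A] by (simp add: Suc_le_eq)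
  have "length Gs \<le> length (concat (map enc_mat Gs))" for Gs
  proof (induction Gs)
    case (Cons A Gs)
    then show ?case using ne[of A] by simp
  qed simp
  from this[of Gs] have K: "length Gs \<le> n" "0 < n" using enc_mat_nonempty[of M] by (auto simp: n_def x)
  have B0: "0 < B" by (simp add: B_def)
  have g: "mat_at zs (Suc i) = (if i < length Gs then Gs ! i else 0)" for i
    unfolding zs_def mat_at_entries by (cases "i < length Gs") simp_all
  have g0: "mat_at zs 0 = M" unfolding zs_def mat_at_entries by simp
  have "G \<subseteq> tball (16 * 2 ^ n + 32)" "M \<in> tball (16 * 2 ^ n + 32)"
    using input_tball[of _ "M # Gs"] Gs assms(2) M unfolding n_def x by auto
  then have "infinite (factorizations G M) \<longleftrightarrow> (\<exists>ws\<in>factorizations G M. B \<le> length ws \<and> length ws < 3 * B)"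
    using Gs tball_card_pow[of n] by (intro infinite_factorizations_iff) (auto simp: B_def)
  also have "\<dots> \<longleftrightarrow> (\<exists>j<2 * B. \<exists>c<2 ^ (n * (B + (B + B))).
       matprod (map (\<lambda>i. if i < length Gs then Gs ! i else 0) (rev (dec n (B + j) c))) = M)"
    unfolding Gs[symmetric] by (rule factorization_search[OF M K(1) B0])
  also have "\<dots> \<longleftrightarrow> (\<exists>j<2 * B. \<exists>c<2 ^ (n * (B + (B + B))).
       matprod (map (\<lambda>i. mat_at zs (Suc i)) (rev (dec n (B + j) c))) = mat_at zs 0)"
    unfolding g g0 ..
  finally have iff: "infinite (factorizations G M) \<longleftrightarrow> \<dots>" .
  show ?thesis
    unfolding decide_ex[OF n_def B_def] iff unfolding xz by (rule search_ex[OF K(2)])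
qed

theorem decidable_recurrent: "decidable recurrent_matrix_problem"
  by (rule ex_decidable[OF wf_decide_ex]) (auto simp: recurrent_matrix_problem_def decide_ex_correct)

theorem theorem6:
  "decidable recurrent_matrix_problem \<and> NP_hard recurrent_matrix_problem"
  using decidable_recurrent NP_hard_recurrent by simp

end
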